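(* Let $(\Sigma,\sigma)$ be a topologically mixing countable Markov shift, with alphabet $\mathbb{N}$, satisfying the BIP property. Let $\{A_1,A_2,\dots\}$ be a countable collection of $d\times d$ matrices having strictly positive entries. For $n\in\mathbb{N}$ define $\phi_n:\Sigma\to\mathbb{R}$ by $\phi_n(w)=\|A_{i_{n-1}}\cdots A_{i_1}A_{i_0}\|$ for $w=(i_0,i_1,\dots)\in\Sigma$. If $\mathcal{F}=\{\log\phi_n\}_{n=1}^\infty$ is an almost-additive sequence on $\Sigma$ with $\sum_{i=1}^\infty\|A_i\|<\infty$, then $$P(\mathcal{F})=\sup\left\{h(\mu)+\lim_{n\to\infty}\frac1n\int\log\phi_n\,d\mu \;:\; \mu\in\mathcal{M}\text{ and }\lim_{n\to\infty}\frac1n\int\log\phi_n\,d\mu\ne-\infty\right\},$$ and there exists a Gibbs measure $\mu$ for $\mathcal{F}$ which is mixing.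
   Context: For a $d\times d$ matrix $A$, $\|A\|:=U^tAU$, where $U$ is the $d$-dimensional column vector with all coordinates equal to $1$. Let $S$ be a countable alphabet (here $S=\mathbb{N}$) and $(t_{ij})_{S\times S}$ a matrix of zeros and ones with no row and no column made entirely of zeros. The (one-sided) countable Markov shift is $\Sigma=\{x=(x_0,x_1,\dots)\in S^{\mathbb{N}_0}: t_{x_ix_{i+1}}=1\text{ for all } i\ge 0\}$ with the shift map $(\sigma x)_n=x_{n+1}$, with the topology generated by cylinders $C_{i_0\dots i_{n-1}}=\{x\in\Sigma: x_j=i_j,\ 0\le j\le n-1\}$ (for admissible words $i_0\dots i_{n-1}$). It is topologically mixing if for all $a,b\in S$ there is $N_{ab}\in\mathbb{N}$ with $C_a\cap\sigma^{-n}C_b\ne\emptyset$ for all $n>N_{ab}$. It satisfies the big images and preimages (BIP) property if there is a finite set $\{b_1,\dots,b_n\}\subset S$ such that for every $a\in S$ there exist $i,j$ with $t_{b_ia}t_{ab_j}=1$. $\mathcal{M}$ is the set of $\sigma$-invariant Borel probability measures on $\Sigma$ and $h(\mu)$ is the measure-theoretic entropy of $\mu$ with respect to $\sigma$. For continuous $f_n:\Sigma\to(0,\infty)$, the sequence $\mathcal{F}=\{\log f_n\}_{n=1}^\infty$ is almost-additive if there is a constant $C\ge 0$ such that for all $n,m\in\mathbb{N}$, $x\in\Sigma$: $f_n(x)f_m(\sigma^nx)e^{-C}\le f_{n+m}(x)\le f_n(x)f_m(\sigma^nx)e^{C}$. The almost-additive Gurevich pressure is $P(\mathcal{F})=\lim_{n\to\infty}\frac1n\log\sum_{\sigma^nx=x}f_n(x)\chi_{C_a}(x)$,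 where $a\in S$ and $\chi_{C_a}$ is the characteristic function of $C_a$; the limit exists and does not depend on $a$ for almost-additive sequences on a topologically mixing shift such that $f_n(x)/f_n(y)$ is bounded uniformly in $n$ over all $x,y$ with the same first $n$ coordinates (which is the case here, since $\phi_n$ depends only on the first $n$ coordinates). A measure $\mu\in\mathcal{M}$ is Gibbs for $\mathcal{F}=\{\log f_n\}_{n=1}^\infty$ if there exist constants $K>0$ and $P\in\mathbb{R}$ such that for every $n\in\mathbb{N}$ and every $x\in C_{i_0\dots i_{n-1}}$, $\frac1K\le\frac{\mu(C_{i_0\dots i_{n-1}})}{\exp(-nP)f_n(x)}\le K$. *)

theory Defs
  imports "HOL-Probability.Probability"
begin

section \<open>Countable Markov shifts\<close>

text \<open>The alphabet is the type \<^typ>\<open>nat\<close>, and the 0-1 transition matrix is given as a relation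
  \<open>t\<close>: the entry at \<open>(i, j)\<close> is 1 iff \<open>t i j\<close>.\<close>

definition transition_matrix :: "(nat \<Rightarrow> nat \<Rightarrow> bool) \<Rightarrow> bool" where
  "transition_matrix t \<longleftrightarrow> (\<forall>i. \<exists>j. t i j) \<and> (\<forall>j. \<exists>i. t i j)"

definition shift_space :: "(nat \<Rightarrow> nat \<Rightarrow> bool) \<Rightarrow> (nat \<Rightarrow> nat) set" where
  "shift_space t = {x. \<forall>i. t (x i) (x (Suc i))}"

definition shift_map :: "(nat \<Rightarrow> nat) \<Rightarrow> nat \<Rightarrow> nat" where
  "shift_map x = (\<lambda>n. x (Suc n))"

definition cylinder :: "(nat \<Rightarrow> nat \<Rightarrow> bool) \<Rightarrow> nat list \<Rightarrow> (nat \<Rightarrow> nat) set" where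
  "cylinder t w = {x \<in> shift_space t. \<forall>j<length w. x j = w ! j}"

text \<open>Inadmissible words give empty cylinders, so they do not affect the generated topology.\<close>

definition shift_topology :: "(nat \<Rightarrow> nat \<Rightarrow> bool) \<Rightarrow> (nat \<Rightarrow> nat) topology" where
  "shift_topology t = topology_generated_by {cylinder t w | w. w \<noteq> []}"

definition topologically_mixing :: "(nat \<Rightarrow> nat \<Rightarrow> bool) \<Rightarrow> bool" where
  "topologically_mixing t \<longleftrightarrow>
    (\<forall>a b. \<exists>N. \<forall>n>N. cylinder t [a] \<inter> (shift_map ^^ n) -` cylinder t [b] \<noteq> {})"

definition BIP :: "(nat \<Rightarrow> nat \<Rightarrow> bool) \<Rightarrow> bool" where
  "BIP t \<longleftrightarrow> (\<exists>B. finite B \<and> (\<forall>a. \<exists>b\<in>B. \<exists>b'\<in>B. t b a \<and> t a b'))"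


section \<open>Invariant measures and entropy\<close>

definition borel_shift :: "(nat \<Rightarrow> nat \<Rightarrow> bool) \<Rightarrow> (nat \<Rightarrow> nat) measure" where
  "borel_shift t = sigma (shift_space t) {U. openin (shift_topology t) U}"

definition invariant_measures :: "(nat \<Rightarrow> nat \<Rightarrow> bool) \<Rightarrow> (nat \<Rightarrow> nat) measure set" where
  "invariant_measures t =
    {\<mu>. prob_space \<mu> \<and> sets \<mu> = sets (borel_shift t) \<and>
        (\<forall>E\<in>sets \<mu>. shift_map -` E \<inter> space \<mu> \<in> sets \<mu> \<and>
                      emeasure \<mu> (shift_map -` E \<inter> space \<mu>) = emeasure \<mu> E)}"

definition mixing :: "'a measure \<Rightarrow> ('a \<Rightarrow> 'a) \<Rightarrow> bool" where
  "mixing M T \<longleftrightarrow>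
    (\<forall>E\<in>sets M. \<forall>F\<in>sets M.
      (\<lambda>n. measure M (E \<inter> (T ^^ n) -` F)) \<longlonglongrightarrow> measure M E * measure M F)"

definition finite_measurable_partition :: "'a measure \<Rightarrow> 'a set set \<Rightarrow> bool" where
  "finite_measurable_partition M \<alpha> \<longleftrightarrow> finite \<alpha> \<and> \<alpha> \<subseteq> sets M \<and> partition_on (space M) \<alpha>"

text \<open>Null cells contribute 0 because of the factor \<open>measure M B\<close>.\<close>

definition partition_entropy :: "'a measure \<Rightarrow> 'a set set \<Rightarrow> real" where
  "partition_entropy M \<alpha> = - (\<Sum>B\<in>\<alpha>. measure M B * ln (measure M B))"

definition iterated_partition :: "'a measure \<Rightarrow> ('a \<Rightarrow> 'a) \<Rightarrow> 'a set set \<Rightarrow> nat \<Rightarrow> 'a set set" where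
  "iterated_partition M T \<alpha> n =
    common_refinement ((\<lambda>i. (\<lambda>B. (T ^^ i) -` B \<inter> space M) ` \<alpha>) ` {..<n})"

text \<open>Kolmogorov--Sinai entropy; it may be infinite.\<close>

definition measure_entropy :: "'a measure \<Rightarrow> ('a \<Rightarrow> 'a) \<Rightarrow> ereal" where
  "measure_entropy M T =
    (SUP \<alpha>\<in>{\<alpha>. finite_measurable_partition M \<alpha>}.
      ereal (lim (\<lambda>n. partition_entropy M (iterated_partition M T \<alpha> n) / real n)))"


section \<open>Almost-additive sequences\<close>

text \<open>A sequence \<open>{log f\<^sub>n}\<close> is represented by \<open>f\<close>; only the indices \<open>n \<ge> 1\<close> matter.\<close>

definition almost_additive :: "(nat \<Rightarrow> nat \<Rightarrow> bool) \<Rightarrow> (nat \<Rightarrow> (nat \<Rightarrow> nat) \<Rightarrow> real) \<Rightarrow> bool" where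
  "almost_additive t f \<longleftrightarrow>
    (\<forall>n\<ge>1. continuous_map (shift_topology t) euclideanreal (f n) \<and> (\<forall>x\<in>shift_space t. 0 < f n x)) \<and>
    (\<exists>C\<ge>0. \<forall>n\<ge>1. \<forall>m\<ge>1. \<forall>x\<in>shift_space t.
      f n x * f m ((shift_map ^^ n) x) * exp (- C) \<le> f (n + m) x \<and>
      f (n + m) x \<le> f n x * f m ((shift_map ^^ n) x) * exp C)"

definition ennreal_log :: "ennreal \<Rightarrow> ereal" where
  "ennreal_log z = (if z = 0 then - \<infinity> else if z = top then \<infinity> else ereal (ln (enn2real z)))"

text \<open>The sum over periodic points is infinite in general, so it is taken in \<^typ>\<open>ennreal\<close>.\<close>

definition gurevich_seq ::
    "(nat \<Rightarrow> nat \<Rightarrow> bool) \<Rightarrow> (nat \<Rightarrow> (nat \<Rightarrow> nat) \<Rightarrow> real) \<Rightarrow> nat \<Rightarrow> nat \<Rightarrow> ereal" where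
  "gurevich_seq t f a n =
    ennreal_log (\<Sum>\<^sub>\<infinity>x\<in>{x \<in> shift_space t. (shift_map ^^ n) x = x}.
      ennreal (f n x) * indicator (cylinder t [a]) x) / ereal (real n)"

definition gurevich_pressure ::
    "(nat \<Rightarrow> nat \<Rightarrow> bool) \<Rightarrow> (nat \<Rightarrow> (nat \<Rightarrow> nat) \<Rightarrow> real) \<Rightarrow> nat \<Rightarrow> ereal" where
  "gurevich_pressure t f a = lim (gurevich_seq t f a)"

text \<open>The integral with values in the extended reals, for functions at least one of whose positive
  and negative parts has finite integral. (The Bochner integral of a function whose integral is
  \<open>-\<infinity>\<close> would be 0.)\<close>

definition extended_integral :: "'a measure \<Rightarrow> ('a \<Rightarrow> real) \<Rightarrow> ereal" where
  "extended_integral M g =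
    enn2ereal (\<integral>\<^sup>+x. ennreal (g x) \<partial>M) - enn2ereal (\<integral>\<^sup>+x. ennreal (- g x) \<partial>M)"

definition gibbs_measure ::
    "(nat \<Rightarrow> nat \<Rightarrow> bool) \<Rightarrow> (nat \<Rightarrow> (nat \<Rightarrow> nat) \<Rightarrow> real) \<Rightarrow> (nat \<Rightarrow> nat) measure \<Rightarrow> bool" where
  "gibbs_measure t f \<mu> \<longleftrightarrow>
    \<mu> \<in> invariant_measures t \<and>
    (\<exists>K>0. \<exists>P::real. \<forall>w. w \<noteq> [] \<longrightarrow> (\<forall>x\<in>cylinder t w.
      1 / K \<le> measure \<mu> (cylinder t w) / (exp (- real (length w) * P) * f (length w) x) \<and>
      measure \<mu> (cylinder t w) / (exp (- real (length w) * P) * f (length w) x) \<le> K))"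


section \<open>Matrix products\<close>

text \<open>The number \<open>U\<^sup>t A U\<close> for the column vector \<open>U\<close> with all coordinates 1.\<close>

definition mat_norm :: "real ^ 'd ^ 'd \<Rightarrow> real" where
  "mat_norm A = (let U = (\<chi> i. 1) in U \<bullet> (A *v U))"

text \<open>\<open>A\<^bsub>w (n-1)\<^esub> \<cdots> A\<^bsub>w 1\<^esub> A\<^bsub>w 0\<^esub>\<close>: later factors are multiplied on the left.\<close>

primrec matrix_product :: "(nat \<Rightarrow> real ^ 'd ^ 'd) \<Rightarrow> (nat \<Rightarrow> nat) \<Rightarrow> nat \<Rightarrow> real ^ 'd ^ 'd" where
  "matrix_product A w 0 = mat 1"
| "matrix_product A w (Suc n) = A (w n) ** matrix_product A w n"

definition mat_potential ::
    "(nat \<Rightarrow> real ^ 'd ^ 'd) \<Rightarrow> nat \<Rightarrow> (nat \<Rightarrow> nat) \<Rightarrow> real" where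
  "mat_potential A n w = mat_norm (matrix_product A w n)"

end

theory Submission
  imports Defs "HOL-Complex_Analysis.Great_Picard"
begin

text \<open>Summability makes the transfer operator \<open>(i, k) \<mapsto> (j, l)\<close> with weight \<open>t\<^sub>i\<^sub>j (A\<^sub>j)\<^sub>l\<^sub>k\<close> on the
  hidden states \<open>(letter, coordinate)\<close> compact, so it has positive left and right eigenvectors
  \<open>u\<close>, \<open>v\<close> for one eigenvalue \<open>\<lambda>\<close>. The matrix-product weights
  \<open>\<lambda>\<^bsup>-n\<^esup> \<langle>u, A\<^bsub>w(n-1)\<^esub> \<cdots> A\<^bsub>w(1)\<^esub> v\<rangle>\<close> of words are then the cylinder probabilities of a stationary hidden
  Markov chain. By BIP the eigenvectors are comparable to the all-ones vector, which is the Gibbs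
  property with \<open>P = ln \<lambda>\<close>, and BIP with topological mixing gives a Doeblin condition, hence mixing.
  Loops at \<open>a\<close> carry total weight of order \<open>\<lambda>\<^sup>n\<close> because the Gibbs measure of
  \<open>[a] \<inter> \<sigma>\<^bsup>-n\<^esup> [a]\<close> converges to a positive limit. The upper bound of the variational principle is Gibbs'
  inequality applied to the joint law of partition names and words; for the lower bound the same
  construction on finite irreducible subalphabets has entropy plus energy at least \<open>ln \<lambda>\<^sub>F\<close>, and
  \<open>\<lambda>\<^sub>F \<rightarrow> \<lambda>\<close>.\<close>


section \<open>A Perron--Frobenius theorem for summably dominated kernels\<close>

text \<open>The factors of the product need not commute, so the logarithm of
  \<open>mat_potential\<close> is no Birkhoff sum. Adding the matrix coordinate to the letter
  repairs this: the product becomes an iterated scalar kernel, and measure, mixing and pressure are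
  all read off one pair of eigenvectors. Compactness enters only as the pointwise bound
  \<open>G s r \<le> a r\<close> with \<open>a\<close> summable. It does two jobs: the scalar
  sequence \<open>c n\<close> is submultiplicative up to an index shift, and limits keep their mass.
  Uniform lower bounds on an infinite alphabet come from the finite set \<open>B\<close>: every
  state is one step from \<open>B\<close> in both directions, so minima over finitely many values
  suffice. The measure of the full shift cannot in general serve as maximiser: summability of the
  norms allows infinite entropy together with energy \<open>-\<infinity>\<close>, and such a measure
  is excluded from the supremum. This forces the detour through finite subalphabets, where the
  entropy of the letter partition is finite and the energy limit exists.\<close>

lemma fekete:
  fixes a :: "nat \<Rightarrow> real"
  assumes sub: "\<And>m n. 1 \<le> m \<Longrightarrow> 1 \<le> n \<Longrightarrow> a (m + n) \<le> a m + a n"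
    and low: "\<And>n. 1 \<le> n \<Longrightarrow> real n * c \<le> a n"
  shows "\<exists>l. (\<lambda>n. a n / real n) \<longlonglongrightarrow> l \<and> (\<forall>n\<ge>1. l \<le> a n / real n)"
proof -
  define X where "X = (\<lambda>n. a n / real n) ` {1..}"
  define l where "l = Inf X"
  have bdd: "bdd_below X"
    unfolding X_def using low by (intro bdd_belowI[of _ c]) (auto simp: field_simps)
  have l_le: "l \<le> a n / real n" if "1 \<le> n" for n
    unfolding l_def using that by (intro cInf_lower bdd) (auto simp: X_def)
  have mult: "a (q * m) \<le> real q * a m" if "1 \<le> m" "1 \<le> q" for q m
    using that(2)
  proof (induction q rule: dec_induct)
    case (step q)
    have "a (Suc q * m) = a (q * m + m)" by (simp add: add.commute)
    also have "\<dots> \<le> a (q * m) + a m" using that step by (intro sub) auto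
    finally show ?case using step by (simp add: algebra_simps)
  qed simp
  have "(\<lambda>n. a n / real n) \<longlonglongrightarrow> l"
  proof (rule LIMSEQ_I)
    fix e :: real assume e: "0 < e"
    have "X \<noteq> {}" by (auto simp: X_def)
    then obtain x where "x \<in> X" "x < l + e / 2"
      using cInf_lessD[of X "l + e / 2"] e by (auto simp: l_def)
    then obtain m where m: "1 \<le> m" "a m / real m < l + e / 2"
      by (auto simp: X_def)
    \<comment> \<open>\<open>K\<close> absorbs all that does not grow with \<open>n\<close>: the
      values at remainders below \<open>2 * m\<close>, and the error from replacing
      \<open>q * m\<close> by \<open>n\<close>.\<close>
    define K where "K = Max ((\<lambda>r. \<bar>a r\<bar>) ` {0..<2*m}) + real m * \<bar>a m / real m\<bar> * 2"
    have Kr: "\<bar>a r\<bar> + real m * \<bar>a m / real m\<bar> * 2 \<le> K" if "r < 2 * m" for r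
      using that by (auto simp: K_def)
    obtain N0 where N0: "2 * \<bar>K\<bar> / e < real N0" using reals_Archimedean2 by blast
    show "\<exists>no. \<forall>n\<ge>no. norm (a n / real n - l) < e"
    proof (intro exI allI impI)
      fix n assume n: "max (2 * m) (Suc N0) \<le> n"
      \<comment> \<open>One block fewer than \<open>n div m\<close>, so that the remainder lies
        between \<open>m\<close> and \<open>2 * m\<close>: subadditivity is assumed for positive
        indices only, and \<open>a 0\<close> is unconstrained.\<close>
      define q where "q = n div m - 1"
      define r where "r = n - q * m"
      have nm: "2 \<le> n div m" using n m(1) by (simp add: less_eq_div_iff_mult_less_eq)
      have r: "r < 2 * m" "1 \<le> r" "n = q * m + r" "1 \<le> q"
      proof -
        have "n = (n div m) * m + n mod m" by simp
        moreover have "(n div m) * m = q * m + m"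
          using nm by (simp add: q_def algebra_simps)
        ultimately show "n = q * m + r" "r < 2 * m" "1 \<le> r"
          using mod_less_divisor[of m n] m(1) unfolding r_def by linarith+
        show "1 \<le> q" using nm by (simp add: q_def)
      qed
      have n0: "0 < real n" using n by simp
      have "a n \<le> a (q * m) + a r" using r m(1) by (subst r(3), intro sub) auto
      also have "\<dots> \<le> real q * a m + a r" using mult[OF m(1) r(4)] by simp
      also have "real q * a m = (real n - real r) * (a m / real m)"
        using m(1) r(3) by (simp add: field_simps)
      also have "\<dots> \<le> real n * (a m / real m) + real r * \<bar>a m / real m\<bar>"
        using mult_left_mono[OF abs_ge_minus_self[of "a m / real m"], of "real r"]
        by (simp add: left_diff_distrib del: abs_divide times_divide_eq_right)
      also have "real r * \<bar>a m / real m\<bar> \<le> real m * \<bar>a m / real m\<bar> * 2"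
        using mult_right_mono[of "real r" "real m * 2" "\<bar>a m / real m\<bar>"] r(1) by (simp add: mult_ac)
      finally have "a n \<le> real n * (a m / real m) + K"
        using Kr[OF r(1)] by linarith
      then have "a n / real n \<le> a m / real m + K / real n"
        using n0 by (simp add: field_simps)
      moreover have "K / real n < e / 2"
      proof -
        have "2 * \<bar>K\<bar> / e < real n" using N0 n by linarith
        then have "2 * \<bar>K\<bar> < real n * e" using e by (simp add: field_simps)
        then show ?thesis using n0 e by (simp add: field_simps)
      qed
      ultimately have "a n / real n < l + e" using m(2) by linarith
      moreover have "l \<le> a n / real n" using n m(1) by (intro l_le) auto
      ultimately show "norm (a n / real n - l) < e" by auto
    qed
  qed
  then show ?thesis using l_le by blast
qed

section \<open>Summable families and dominated kernels on countable sets\<close>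

lemma integrable_count_space_bound:
  fixes f g :: "'s \<Rightarrow> real"
  assumes "integrable (count_space UNIV) g" "\<And>x. \<bar>f x\<bar> \<le> K * g x"
  shows "integrable (count_space UNIV) f"
proof (rule Bochner_Integration.integrable_bound)
  show "integrable (count_space UNIV) (\<lambda>x. K * g x)" using assms(1) by simp
  show "AE x in count_space UNIV. norm (f x) \<le> norm (K * g x)"
    using assms(2) by (intro AE_I2) (auto intro: order_trans abs_ge_self)
qed simp

lemma count_space_integral_swap:
  fixes f :: "'s::countable \<Rightarrow> 't::countable \<Rightarrow> real"
  assumes g: "integrable (count_space UNIV) g" and h: "integrable (count_space UNIV) h"
    and f: "\<And>s t. \<bar>f s t\<bar> \<le> g s * h t"
  shows "(\<integral>s. (\<integral>t. f s t \<partial>count_space UNIV) \<partial>count_space UNIV) =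
    (\<integral>t. (\<integral>s. f s t \<partial>count_space UNIV) \<partial>count_space UNIV)"
proof -
  have "Infinite_Set_Sum.abs_summable_on (\<lambda>(s, t). g s * h t) (UNIV \<times> UNIV)"
    using g h by (intro abs_summable_on_product) (auto simp: abs_summable_on_def)
  then have "Infinite_Set_Sum.abs_summable_on (\<lambda>(s, t). f s t) (UNIV \<times> UNIV)"
    by (rule abs_summable_on_comparison_test') (use f in auto)
  from infsetsum_swap[OF countableI_type countableI_type this] show ?thesis by (simp add: infsetsum_def)
qed

text \<open>The bound on the entries of column \<open>r\<close> is uniform in the starting state
  \<open>s\<close>; it stands in for compactness of the operator on an infinite state space.\<close>

locale dominated_kernel =
  fixes G :: "'s::countable \<Rightarrow> 's \<Rightarrow> real" and a :: "'s \<Rightarrow> real"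
  assumes G_nonneg: "0 \<le> G s r" and G_le: "G s r \<le> a r"
    and a_int: "integrable (count_space UNIV) a"
begin

abbreviation S :: "('s \<Rightarrow> real) \<Rightarrow> real" where "S f \<equiv> integral\<^sup>L (count_space UNIV) f"

lemma a_nonneg: "0 \<le> a r" using G_nonneg[of undefined r] G_le[of undefined r] by linarith

lemma integrable_dom: "(\<And>r. \<bar>f r\<bar> \<le> K * a r) \<Longrightarrow> integrable (count_space UNIV) f"
  by (rule integrable_count_space_bound[OF a_int])

text \<open>The row vector \<open>a G\<^sup>n\<close>, started from the dominating function;
  \<open>colit n\<close> below is the column vector \<open>G\<^sup>n 1\<close>. One application of
  \<open>G\<close> can always be replaced by \<open>a\<close>, which is how these particular
  starting vectors control the later iterates.\<close>

primrec rowit :: "nat \<Rightarrow> 's \<Rightarrow> real" where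
  "rowit 0 = a"
| "rowit (Suc n) = (\<lambda>r. S (\<lambda>s. rowit n s * G s r))"

primrec colit :: "nat \<Rightarrow> 's \<Rightarrow> real" where
  "colit 0 = (\<lambda>s. 1)"
| "colit (Suc n) = (\<lambda>s. S (\<lambda>r. G s r * colit n r))"

definition c :: "nat \<Rightarrow> real" where "c n = S (rowit n)"

lemma colit_bounds: "0 \<le> colit n s \<and> colit n s \<le> S a ^ n"
proof (induction n arbitrary: s)
  case (Suc n)
  have b: "\<bar>G s r * colit n r\<bar> \<le> S a ^ n * a r" for r
    using Suc[of r] G_nonneg[of s r] G_le[of s r]
      mult_mono[of "G s r" "a r" "colit n r" "S a ^ n"] a_nonneg[of r]
    by (simp add: abs_mult mult.commute)
  have "S (\<lambda>r. G s r * colit n r) \<le> S (\<lambda>r. S a ^ n * a r)"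
    using b by (intro integral_mono integrable_dom[where K="S a ^ n"])
      (auto simp: a_nonneg intro: order_trans[OF abs_ge_self] Suc mult_nonneg_nonneg
        zero_le_power Bochner_Integration.integral_nonneg)
  then show ?case using Suc G_nonneg
    by (auto simp: mult.commute intro!: Bochner_Integration.integral_nonneg mult_nonneg_nonneg)
qed auto

lemma rowit_bounds: "0 \<le> rowit n r \<and> rowit n r \<le> S a ^ n * a r"
proof (induction n arbitrary: r)
  case (Suc n)
  have Sa: "0 \<le> S a" using a_nonneg by simp
  have b: "\<bar>rowit n s * G s r\<bar> \<le> S a ^ n * a r * a s" for s
    using Suc[of s] G_nonneg[of s r] G_le[of s r]
      mult_mono[of "rowit n s" "S a ^ n * a s" "G s r" "a r"] a_nonneg[of s] Sa
    by (simp add: abs_mult mult_ac)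
  have "S (\<lambda>s. rowit n s * G s r) \<le> S (\<lambda>s. S a ^ n * a r * a s)"
    using b by (intro integral_mono integrable_dom[where K="S a ^ n * a r"])
      (auto simp: a_nonneg Sa intro: order_trans[OF abs_ge_self] Suc mult_nonneg_nonneg)
  then show ?case using Suc G_nonneg
    by (auto simp: mult_ac intro!: Bochner_Integration.integral_nonneg mult_nonneg_nonneg)
qed (simp add: a_nonneg)

lemma rowit_int[simp]: "integrable (count_space UNIV) (rowit n)"
  using rowit_bounds by (intro integrable_dom[where K="S a ^ n"]) (simp add: abs_of_nonneg)

lemma G_colit_int: "integrable (count_space UNIV) (\<lambda>r. G s r * colit n r)"
proof (rule integrable_dom[where K="S a ^ n"])
  show "\<bar>G s r * colit n r\<bar> \<le> S a ^ n * a r" for r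
    using colit_bounds[of n r] G_nonneg[of s r] G_le[of s r]
      mult_mono[of "G s r" "a r" "colit n r" "S a ^ n"] a_nonneg[of r]
    by (simp add: abs_mult mult.commute)
qed

lemma row_col_int: "integrable (count_space UNIV) (\<lambda>r. rowit n r * colit m r)"
proof (rule integrable_dom[where K="S a ^ n * S a ^ m"])
  show "\<bar>rowit n r * colit m r\<bar> \<le> S a ^ n * S a ^ m * a r" for r
    using colit_bounds[of m r] rowit_bounds[of n r]
      mult_mono[of "rowit n r" "S a ^ n * a r" "colit m r" "S a ^ m"] a_nonneg[of r]
    by (simp add: abs_mult mult_ac)
qed

lemma row_G_int: "integrable (count_space UNIV) (\<lambda>s. rowit n s * G s r)"
proof (rule integrable_count_space_bound[OF rowit_int, where K="a r"])
  show "\<bar>rowit n s * G s r\<bar> \<le> a r * rowit n s" for s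
    using rowit_bounds[of n s] G_nonneg[of s r] G_le[of s r]
    by (simp add: abs_mult mult.commute mult_right_mono)
qed

text \<open>The scalar \<open>a G\<^sup>n G\<^sup>m 1\<close> depends only on \<open>n + m\<close>:
  kernels move from the column to the row one at a time by interchange of sums.\<close>

lemma row_col: "S (\<lambda>r. rowit n r * colit m r) = c (n + m)"
proof (induction m arbitrary: n)
  case (Suc m)
  have "S (\<lambda>s. rowit n s * colit (Suc m) s) = S (\<lambda>s. S (\<lambda>r. rowit n s * (G s r * colit m r)))"
    by (simp)
  also have "\<dots> = S (\<lambda>r. S (\<lambda>s. rowit n s * (G s r * colit m r)))"
  proof (rule count_space_integral_swap[where g="rowit n" and h="\<lambda>r. S a ^ m * a r"])
    show "\<bar>rowit n s * (G s r * colit m r)\<bar> \<le> rowit n s * (S a ^ m * a r)" for s r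
      using colit_bounds[of m r] rowit_bounds[of n s] G_nonneg[of s r] G_le[of s r]
        mult_mono[of "G s r" "a r" "colit m r" "S a ^ m"] a_nonneg[of r]
      by (simp add: abs_mult mult_left_mono mult.commute)
  qed (auto simp: a_int)
  also have "\<dots> = S (\<lambda>r. rowit (Suc n) r * colit m r)"
    by (simp add: mult.assoc[symmetric])
  finally show ?case using Suc[of "Suc n"] by simp
qed (simp add: c_def)

lemma colit_le_c: "colit (Suc n) s \<le> c n"
proof -
  have "colit (Suc n) s \<le> S (\<lambda>r. rowit 0 r * colit n r)"
    unfolding colit.simps using G_colit_int row_col_int[of 0 n] colit_bounds G_le
    by (intro integral_mono) (auto intro: mult_right_mono)
  then show ?thesis by (simp add: row_col[of 0 n, simplified])
qed

lemma rowit_le_c: "rowit (Suc n) r \<le> a r * c n"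
proof -
  have "rowit (Suc n) r \<le> S (\<lambda>s. a r * rowit n s)"
    unfolding rowit.simps using row_G_int rowit_bounds G_le
    by (intro integral_mono) (auto simp: mult.commute intro: mult_right_mono)
  then show ?thesis by (simp add: c_def)
qed

text \<open>Replacing one kernel in the middle by its bound \<open>a\<close> cuts the chain into two
  independent ones. That kernel is used up, hence the \<open>+ 1\<close>.\<close>

lemma c_submult: "c (n + m + 1) \<le> c n * c m"
proof -
  have "c (n + m + 1) = S (\<lambda>r. rowit (Suc n) r * colit m r)" by (simp only: row_col) simp
  also have "\<dots> \<le> S (\<lambda>r. c n * (rowit 0 r * colit m r))"
    using row_col_int rowit_le_c[of n] colit_bounds[of m]
    by (intro integral_mono integrable_mult_right row_col_int)
      (metis mult.assoc mult.commute mult_right_mono rowit.simps(1))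
  also have "\<dots> = c n * c m" using row_col[of 0 m] by simp
  finally show ?thesis .
qed


text \<open>The eigenvectors are subsequential limits of the normalised truncated resolvents
  \<open>\<Sum>k\<le>n. z\<^sup>k G\<^sup>k\<close> (applied to \<open>a\<close> from the left and to \<open>1\<close> from the right) as \<open>z\<close> increases to
  \<open>1 / l\<close>. By submultiplicativity of \<open>c\<close> their norms diverge, and domination by \<open>a\<close> prevents the mass
  from escaping in the limit.\<close>

theorem perron_frobenius:
  assumes F0: "finite F0" "F0 \<noteq> {}" "\<And>s. s \<in> F0 \<Longrightarrow> \<exists>r\<in>F0. 0 < G s r"
  shows "\<exists>l u v. 0 < l \<and> (\<forall>s. 0 \<le> u s \<and> u s \<le> 1 / l) \<and> (\<forall>s. 0 \<le> v s \<and> v s \<le> a s / l) \<and>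
    S v = 1 \<and> S (\<lambda>s. a s * u s) = 1 \<and>
    (\<forall>s. S (\<lambda>r. G s r * u r) = l * u s) \<and> (\<forall>r. S (\<lambda>s. v s * G s r) = l * v r)"
proof -
  obtain nx where nx: "\<And>s. s \<in> F0 \<Longrightarrow> nx s \<in> F0 \<and> 0 < G s (nx s)" using F0(3) by metis
  define \<delta> where "\<delta> = Min ((\<lambda>s. G s (nx s)) ` F0)"
  have \<delta>: "0 < \<delta>" and \<delta>_le: "\<And>s. s \<in> F0 \<Longrightarrow> \<delta> \<le> G s (nx s)"
    using F0 nx by (auto simp: \<delta>_def)
  have ge_point: "f x \<le> S f" if "\<And>x. 0 \<le> f x" "integrable (count_space UNIV) f" for f :: "'s \<Rightarrow> real" and x
  proof -
    have "S (\<lambda>y. f x * indicator {x} y) \<le> S f"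
    proof (rule integral_mono)
      show "integrable (count_space UNIV) (\<lambda>y. f x * indicator {x} y)"
        by (rule integrable_count_space_bound[OF that(2), of _ 1]) (auto simp: indicator_def that(1))
    qed (auto simp: that indicator_def)
    then show ?thesis by simp
  qed
  \<comment> \<open>Inside \<open>F0\<close> the chain never gets stuck, so
    \<open>G\<^sup>n 1\<close> decays at most geometrically there; this keeps the growth rate
    \<open>l\<close> positive.\<close>
  have col_low: "\<delta> ^ n \<le> colit n s" if "s \<in> F0" for n s
    using that
  proof (induction n arbitrary: s)
    case (Suc n)
    have "\<delta> * \<delta> ^ n \<le> G s (nx s) * colit n (nx s)"
      using Suc.prems nx \<delta> \<delta>_le by (intro mult_mono Suc.IH) (auto simp: G_nonneg)
    also have "\<dots> \<le> S (\<lambda>r. G s r * colit n r)"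
      using G_nonneg colit_bounds G_colit_int by (intro ge_point) auto
    finally show ?case by simp
  qed simp
  obtain s0 where s0: "s0 \<in> F0" using F0 by auto
  \<comment> \<open>The successor of \<open>s0\<close> instead of \<open>s0\<close> itself:
    \<open>0 < G s0 s1 \<le> a s1\<close> makes \<open>a\<close> positive there.\<close>
  define s1 where "s1 = nx s0"
  have s1: "s1 \<in> F0" "0 < a s1" using nx[OF s0] G_le[of s0 s1] by (auto simp: s1_def)
  have c_low: "a s1 * \<delta> ^ n \<le> c n" for n
  proof -
    have "a s1 * \<delta> ^ n \<le> rowit 0 s1 * colit n s1"
      using col_low[OF s1(1)] s1 by simp
    also have "\<dots> \<le> S (\<lambda>r. rowit 0 r * colit n r)"
      using rowit_bounds[of 0] colit_bounds by (intro ge_point row_col_int) auto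
    finally show ?thesis by (simp only: row_col) simp
  qed
  then have c_pos: "0 < c n" for n
    using s1 \<delta> by (meson less_le_trans mult_pos_pos zero_less_power)
  \<comment> \<open>The index shift turns \<open>c_submult\<close> into subadditivity.\<close>
  define b where "b n = ln (c (n - 1))" for n
  obtain L where L: "(\<lambda>n. b n / real n) \<longlonglongrightarrow> L" "\<And>n. 1 \<le> n \<Longrightarrow> L \<le> b n / real n"
  proof -
    have "\<exists>l. (\<lambda>n. b n / real n) \<longlonglongrightarrow> l \<and> (\<forall>n\<ge>1. l \<le> b n / real n)"
    proof (rule fekete)
      fix m n :: nat assume "1 \<le> m" "1 \<le> n"
      then obtain m' n' where "m = Suc m'" "n = Suc n'" by (metis Suc_le_D One_nat_def)
      then have "c (m + n - 1) \<le> c (m - 1) * c (n - 1)"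
        using c_submult[of m' n'] by simp
      then show "b (m + n) \<le> b m + b n"
      proof -
        assume le: "c (m + n - 1) \<le> c (m - 1) * c (n - 1)"
        have "ln (c (m + n - 1)) \<le> ln (c (m - 1) * c (n - 1))"
          using le c_pos by (subst ln_le_cancel_iff) auto
        also have "\<dots> = ln (c (m - 1)) + ln (c (n - 1))"
          by (rule ln_mult_pos[OF c_pos c_pos])
        finally show ?thesis by (simp only: b_def)
      qed
    next
      fix n :: nat assume n: "1 \<le> n"
      let ?q = "min 0 (ln (a s1)) + ln \<delta>  - \<bar>ln \<delta>\<bar>"
      have "ln (a s1 * \<delta> ^ (n - 1)) \<le> b n"
        unfolding b_def using c_low[of "n - 1"] s1 \<delta> c_pos by (subst ln_le_cancel_iff) auto
      also have "ln (a s1 * \<delta> ^ (n - 1)) = ln (a s1) + real (n - 1) * ln \<delta>"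
        using s1 \<delta> by (simp add: ln_mult ln_realpow)
      finally have A: "ln (a s1) + real (n - 1) * ln \<delta> \<le> b n" .
      have "real n * min 0 (ln (a s1)) \<le> 1 * min 0 (ln (a s1))"
        using n by (intro mult_right_mono_neg) auto
      moreover have "real n * (ln \<delta> - \<bar>ln \<delta>\<bar>) \<le> real (n - 1) * (ln \<delta> - \<bar>ln \<delta>\<bar>)"
        using n by (intro mult_right_mono_neg) auto
      moreover have "real (n - 1) * (ln \<delta> - \<bar>ln \<delta>\<bar>) \<le> real (n - 1) * ln \<delta>"
        by (intro mult_left_mono) auto
      moreover have "real n * ?q = real n * min 0 (ln (a s1)) + real n * (ln \<delta> - \<bar>ln \<delta>\<bar>)"
        by (simp add: algebra_simps)
      ultimately have "real n * min 0 (ln (a s1)) + real n * (ln \<delta> - \<bar>ln \<delta>\<bar>) \<le> b n"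
        using A min.cobounded2[of 0 "ln (a s1)"] by linarith
      then show "real n * ?q \<le> b n" by (simp add: algebra_simps)
    qed
    then show thesis using that by blast
  qed
  define l where "l = exp L"
  have l: "0 < l" by (simp add: l_def)
  \<comment> \<open>Fekete's limit is a lower bound for every quotient, so this holds for all
    \<open>n\<close>; it makes the series of \<open>z ^ k * c k\<close> diverge at
    \<open>z = 1 / l\<close>.\<close>
  have c_ge: "l ^ Suc n \<le> c n" for n
  proof -
    have "real (Suc n) * L \<le> ln (c n)" using L(2)[of "Suc n"] by (simp add: b_def field_simps)
    then have "exp (real (Suc n) * L) \<le> c n" using c_pos[of n] by (metis exp_le_cancel_iff exp_ln)
    then show ?thesis unfolding l_def by (simp only: exp_of_nat_mult)
  qed
  \<comment> \<open>Here \<open>3\<close> is an upper bound for \<open>exp 1\<close>: each of the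
    first \<open>m j\<close> terms of the resolvent will be at least \<open>l / 3\<close>, so with
    \<open>K \<ge> 3 / l\<close> their sum reaches \<open>j + 1\<close>.\<close>
  obtain K :: nat where K: "3 / l \<le> real K" using real_arch_simple by blast
  have K0: "0 < K" using K l by (cases K) (auto simp: field_simps)
  define m where "m j = Suc j * K" for j
  define z where "z j = exp (- (1 / real (m j))) / l" for j
  have m0: "0 < m j" "Suc j \<le> m j" for j using K0 by (auto simp: m_def simp del: mult_Suc)
  have z0: "0 < z j" for j using l by (simp add: z_def)
  have zl: "z j \<le> 1 / l" for j using l by (simp add: z_def field_simps)
  have z_lim: "z \<longlonglongrightarrow> 1 / l"
  proof -
    have "(\<lambda>j. 1 / real (m j)) \<longlonglongrightarrow> 0"
    proof (rule Lim_null_comparison[OF _ lim_inverse_n])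
      have "1 / real (m n) \<le> inverse (real n)" if "0 < n" for n
        using that m0(2)[of n] by (simp add: field_simps)
      then show "\<forall>\<^sub>F n in sequentially. norm (1 / real (m n)) \<le> inverse (real n)"
        by (intro eventually_mono[OF eventually_gt_at_top[of 0]]) simp
    qed
    then have "z \<longlonglongrightarrow> exp (- 0) / l"
      unfolding z_def using l by (intro tendsto_divide tendsto_exp tendsto_minus tendsto_const) auto
    then show ?thesis by simp
  qed
  \<comment> \<open>Below the radius of convergence the terms tend to \<open>0\<close>, so the
    truncation point can be taken where the term is at most \<open>1\<close>, yet beyond the first
    \<open>m j\<close> large terms.\<close>
  have ex_n: "\<exists>n. z j ^ n * c n \<le> 1 \<and> m j \<le> n" for j
  proof -
    define e where "e = 1 / real (m j)"
    have e: "0 < e" using m0 by (simp add: e_def)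
    have "\<forall>\<^sub>F n in sequentially. b n / real n < L + e / 2"
      using L(1) e by (intro order_tendstoD) auto
    then obtain n0 where n0: "\<And>n. n0 \<le> n \<Longrightarrow> b n / real n < L + e / 2"
      by (auto simp: eventually_sequentially)
    have bound: "z j ^ n * c n \<le> exp (L + e / 2) * exp (- (e / 2)) ^ n" if "n0 \<le> n" for n
    proof -
      have "ln (c n) \<le> real (Suc n) * (L + e / 2)"
        using n0[of "Suc n"] that by (simp add: b_def field_simps)
      then have "c n \<le> exp (real (Suc n) * (L + e / 2))"
        using c_pos[of n] by (metis exp_le_cancel_iff exp_ln)
      then have "z j ^ n * c n \<le> z j ^ n * exp (real (Suc n) * (L + e / 2))"
        using z0[of j] by (intro mult_left_mono) auto
      also have "z j ^ n * exp (real (Suc n) * (L + e / 2)) = exp (L + e / 2) * exp (real n * (- (e / 2)))"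
      proof -
        have "z j ^ n = exp (real n * (- e - L))"
          by (simp add: z_def l_def e_def exp_of_nat_mult exp_diff)
        then show ?thesis by (simp only: exp_add[symmetric]) (simp add: field_simps)
      qed
      also have "exp (real n * (- (e / 2))) = exp (- (e / 2)) ^ n" by (rule exp_of_nat_mult)
      finally show ?thesis .
    qed
    have "(\<lambda>n. exp (L + e / 2) * exp (- (e / 2)) ^ n) \<longlonglongrightarrow> exp (L + e / 2) * 0"
      using e by (intro tendsto_mult tendsto_const LIMSEQ_realpow_zero) auto
    then have "\<forall>\<^sub>F n in sequentially. exp (L + e / 2) * exp (- (e / 2)) ^ n < 1"
      by (rule order_tendstoD(2)) simp
    with eventually_ge_at_top[of n0] eventually_ge_at_top[of "m j"]
    have "\<forall>\<^sub>F n in sequentially. z j ^ n * c n \<le> 1 \<and> m j \<le> n"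
      by eventually_elim (use bound in fastforce)
    then show ?thesis by (rule eventually_happens'[OF sequentially_bot])
  qed
  then obtain n where n: "\<And>j. z j ^ n j * c (n j) \<le> 1" "\<And>j. m j \<le> n j" by metis
  \<comment> \<open>By \<open>row_col\<close> this is both the sum of the truncated row resolvent
    and the \<open>a\<close>-weighted sum of the truncated column resolvent, so one sequence
    normalises both vectors.\<close>
  define N where "N j = (\<Sum>k\<le>n j. z j ^ k * c k)" for j
  have N_ge: "real (Suc j) \<le> N j" for j
  proof -
    have "l / 3 \<le> z j ^ k * c k" if "k \<le> m j" for k
    proof -
      have "exp (- 1) \<le> exp (- (real k / real (m j)))"
        using that m0(1)[of j] by (simp add: field_simps)
      also have "\<dots> = (z j * l) ^ k"
        using l by (simp add: z_def exp_of_nat_mult[symmetric])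
      finally have "l * exp (- 1) \<le> z j ^ k * l ^ Suc k"
        using l by (simp add: power_mult_distrib mult_ac)
      also have "\<dots> \<le> z j ^ k * c k"
        using z0[of j] c_ge[of k] by (intro mult_left_mono) auto
      finally have "l * exp (- 1) \<le> z j ^ k * c k" .
      moreover have "1 / 3 \<le> exp (- 1 :: real)"
        using exp_le by (simp add: exp_minus field_simps)
      then have "l / 3 \<le> l * exp (- 1)" using l by simp
      ultimately show ?thesis by linarith
    qed
    then have "(\<Sum>k<m j. l / 3) \<le> (\<Sum>k<m j. z j ^ k * c k)" by (intro sum_mono) auto
    also have "\<dots> \<le> N j"
      unfolding N_def using n(2)[of j] z0[of j] c_pos
      by (intro sum_mono2) (auto intro!: mult_nonneg_nonneg simp: less_imp_le)
    finally have up: "real (m j) * (l / 3) \<le> N j" by simp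
    have "real (Suc j) = real (Suc j) * 1" by simp
    also have "\<dots> \<le> real (Suc j) * (real K * (l / 3))"
      using K l by (intro mult_left_mono) (auto simp: field_simps)
    also have "\<dots> = real (m j) * (l / 3)"
      by (simp only: m_def of_nat_mult mult.assoc)
    also note up
    finally show ?thesis .
  qed
  then have N0: "0 < N j" for j
    using N_ge[of j] by (meson less_le_trans of_nat_0_less_iff zero_less_Suc)
  have N_lim: "(\<lambda>j. 1 / N j) \<longlonglongrightarrow> 0"
  proof (rule Lim_null_comparison[OF _ LIMSEQ_inverse_real_of_nat])
    have "1 / N j \<le> inverse (real (Suc j))" for j
      using N_ge[of j] by (simp add: inverse_eq_divide frac_le del: of_nat_Suc)
    then show "\<forall>\<^sub>F j in sequentially. norm (1 / N j) \<le> inverse (real (Suc j))"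
      using N0 by (intro always_eventually allI) (simp add: less_imp_le del: of_nat_Suc)
  qed
  define V where "V j r = (\<Sum>k\<le>n j. z j ^ k * rowit k r) / N j" for j r
  define U where "U j s = (\<Sum>k\<le>n j. z j ^ k * colit k s) / N j" for j s
  \<comment> \<open>Bounds the term at the cut that survives when the kernel is applied to a
    truncated resolvent.\<close>
  define E where "E j = z j ^ Suc (n j) * c (n j)" for j
  have E: "0 \<le> E j" "E j \<le> 1 / l" for j
  proof -
    show "0 \<le> E j" using z0[of j] c_pos[of "n j"] by (simp add: E_def)
    have "E j = z j * (z j ^ n j * c (n j))" by (simp add: E_def)
    also have "\<dots> \<le> z j * 1" using n(1) z0[of j] by (intro mult_left_mono) auto
    finally show "E j \<le> 1 / l" using zl[of j] by simp
  qed
  have sumN: "(\<Sum>k<n j. z j ^ k * c k) \<le> N j" for j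
    unfolding N_def using z0[of j] c_pos
    by (intro sum_mono2) (auto intro!: mult_nonneg_nonneg simp: less_imp_le)
  have V0: "0 \<le> V j r" for j r
    unfolding V_def using N0[of j] rowit_bounds z0[of j]
    by (intro divide_nonneg_pos sum_nonneg mult_nonneg_nonneg) (auto simp: less_imp_le)
  have U0: "0 \<le> U j r" for j r
    unfolding U_def using N0[of j] colit_bounds z0[of j]
    by (intro divide_nonneg_pos sum_nonneg mult_nonneg_nonneg) (auto simp: less_imp_le)
  \<comment> \<open>Every term except \<open>k = 0\<close> contains an application of the kernel and
    is at most \<open>a r\<close> times a term of the normalising sum; the term \<open>k = 0\<close>
    vanishes in the limit because \<open>1 / N j\<close> tends to \<open>0\<close>.\<close>
  have V_le: "V j r \<le> a r * (1 / N j + 1 / l)" for j r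
  proof -
    have "(\<Sum>k\<le>n j. z j ^ k * rowit k r) = a r + (\<Sum>k<n j. z j * z j ^ k * rowit (Suc k) r)"
      by (simp only: sum.atMost_shift) simp
    also have "(\<Sum>k<n j. z j * z j ^ k * rowit (Suc k) r) \<le> (\<Sum>k<n j. z j * z j ^ k * (a r * c k))"
      using z0[of j] by (intro sum_mono mult_left_mono rowit_le_c) auto
    also have "\<dots> = a r * z j * (\<Sum>k<n j. z j ^ k * c k)"
      by (simp add: sum_distrib_left mult_ac)
    also have "\<dots> \<le> a r * (1 / l) * N j"
      using sumN z0[of j] a_nonneg[of r] zl[of j] c_pos
      by (intro mult_mono mult_nonneg_nonneg sum_nonneg) (auto simp: less_imp_le l)
    finally show ?thesis using N0[of j] by (simp add: V_def field_simps)
  qed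
  have U_le: "U j s \<le> 1 / N j + 1 / l" for j s
  proof -
    have "(\<Sum>k\<le>n j. z j ^ k * colit k s) = 1 + (\<Sum>k<n j. z j * z j ^ k * colit (Suc k) s)"
      by (simp only: sum.atMost_shift) simp
    also have "(\<Sum>k<n j. z j * z j ^ k * colit (Suc k) s) \<le> (\<Sum>k<n j. z j * z j ^ k * c k)"
      using z0[of j] by (intro sum_mono mult_left_mono colit_le_c) auto
    also have "\<dots> = z j * (\<Sum>k<n j. z j ^ k * c k)"
      by (simp add: sum_distrib_left mult_ac)
    also have "\<dots> \<le> (1 / l) * N j"
      using sumN z0[of j] zl[of j] c_pos
      by (intro mult_mono mult_nonneg_nonneg sum_nonneg) (auto simp: less_imp_le l)
    finally show ?thesis using N0[of j] by (simp add: U_def field_simps)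
  qed
  have SV: "S (V j) = 1" for j
    using N0[of j] by (simp add: V_def[abs_def] N_def c_def)
  have SaU: "S (\<lambda>s. a s * U j s) = 1" for j
  proof -
    have int: "integrable (count_space UNIV) (\<lambda>s. a s * colit k s)" for k
      using row_col_int[of 0 k] by simp
    have "S (\<lambda>s. a s * U j s) = S (\<lambda>s. (\<Sum>k\<le>n j. z j ^ k * (a s * colit k s)) / N j)"
      by (simp add: U_def sum_distrib_left mult_ac)
    also have "\<dots> = (\<Sum>k\<le>n j. z j ^ k * S (\<lambda>s. a s * colit k s)) / N j"
      using int by simp
    also have "\<dots> = 1" using N0[of j] row_col[of 0] by (simp add: N_def)
    finally show ?thesis .
  qed
  \<comment> \<open>Applying the kernel shifts the truncated resolvent by one index, so only its
    first and last terms fail to cancel; divided by \<open>N j\<close>, this defect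
    disappears.\<close>
  have VG: "\<bar>z j * S (\<lambda>s. V j s * G s r) - V j r\<bar> \<le> a r * (1 + 1 / l) / N j" for j r
  proof -
    have "S (\<lambda>s. V j s * G s r) = S (\<lambda>s. (\<Sum>k\<le>n j. z j ^ k * (rowit k s * G s r)) / N j)"
      by (simp only: V_def sum_distrib_right times_divide_eq_left mult.assoc)
    also have "\<dots> = (\<Sum>k\<le>n j. z j ^ k * rowit (Suc k) r) / N j"
      using row_G_int by simp
    finally have "z j * S (\<lambda>s. V j s * G s r) = (\<Sum>k\<le>n j. z j ^ Suc k * rowit (Suc k) r) / N j"
      by (simp add: sum_distrib_left mult_ac del: rowit.simps)
    also have "(\<Sum>k\<le>n j. z j ^ Suc k * rowit (Suc k) r) = (\<Sum>k\<le>Suc (n j). z j ^ k * rowit k r) - a r"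
      by (subst sum.atMost_Suc_shift) simp
    also have "\<dots> = (\<Sum>k\<le>n j. z j ^ k * rowit k r) + z j ^ Suc (n j) * rowit (Suc (n j)) r - a r"
      by simp
    finally have eq: "z j * S (\<lambda>s. V j s * G s r) - V j r =
        (z j ^ Suc (n j) * rowit (Suc (n j)) r - a r) / N j"
      by (simp add: V_def add_divide_distrib diff_divide_distrib del: rowit.simps)
    have "0 \<le> z j ^ Suc (n j) * rowit (Suc (n j)) r"
      using z0[of j] rowit_bounds[of "Suc (n j)" r] by (simp del: rowit.simps)
    moreover have "z j ^ Suc (n j) * rowit (Suc (n j)) r \<le> z j ^ Suc (n j) * (a r * c (n j))"
      using z0[of j] by (intro mult_left_mono rowit_le_c) auto
    then have "z j ^ Suc (n j) * rowit (Suc (n j)) r \<le> a r * E j" by (simp add: E_def mult_ac)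
    then have "z j ^ Suc (n j) * rowit (Suc (n j)) r \<le> a r * (1 / l)"
      using mult_left_mono[OF E(2)[of j] a_nonneg[of r]] by linarith
    ultimately have "\<bar>z j ^ Suc (n j) * rowit (Suc (n j)) r - a r\<bar> \<le> a r * (1 + 1 / l)"
      using a_nonneg[of r] by (simp add: algebra_simps abs_le_iff)
    then show ?thesis unfolding eq using N0[of j] by (simp add: abs_divide divide_right_mono)
  qed
  have UG: "\<bar>z j * S (\<lambda>r. G s r * U j r) - U j s\<bar> \<le> (1 + 1 / l) / N j" for j s
  proof -
    have "S (\<lambda>r. G s r * U j r) = S (\<lambda>r. (\<Sum>k\<le>n j. z j ^ k * (G s r * colit k r)) / N j)"
      by (simp only: U_def sum_distrib_left times_divide_eq_right mult.left_commute)
    also have "\<dots> = (\<Sum>k\<le>n j. z j ^ k * colit (Suc k) s) / N j"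
      using G_colit_int by simp
    finally have "z j * S (\<lambda>r. G s r * U j r) = (\<Sum>k\<le>n j. z j ^ Suc k * colit (Suc k) s) / N j"
      by (simp add: sum_distrib_left mult_ac del: colit.simps)
    also have "(\<Sum>k\<le>n j. z j ^ Suc k * colit (Suc k) s) = (\<Sum>k\<le>Suc (n j). z j ^ k * colit k s) - 1"
      by (subst sum.atMost_Suc_shift) simp
    also have "\<dots> = (\<Sum>k\<le>n j. z j ^ k * colit k s) + z j ^ Suc (n j) * colit (Suc (n j)) s - 1"
      by simp
    finally have eq: "z j * S (\<lambda>r. G s r * U j r) - U j s =
        (z j ^ Suc (n j) * colit (Suc (n j)) s - 1) / N j"
      by (simp add: U_def add_divide_distrib diff_divide_distrib del: colit.simps)
    have "0 \<le> z j ^ Suc (n j) * colit (Suc (n j)) s"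
      using z0[of j] colit_bounds[of "Suc (n j)" s] by (simp del: colit.simps)
    moreover have "z j ^ Suc (n j) * colit (Suc (n j)) s \<le> E j"
      unfolding E_def using z0[of j] by (intro mult_left_mono colit_le_c) auto
    ultimately have "\<bar>z j ^ Suc (n j) * colit (Suc (n j)) s - 1\<bar> \<le> 1 + 1 / l"
      using E(2)[of j] by linarith
    then show ?thesis unfolding eq using N0[of j] by (simp add: abs_divide divide_right_mono)
  qed
  have N1: "1 / N j \<le> 1" for j using N_ge[of j] N0[of j] by simp
  have bdd: "norm (U j s, V j s) \<le> (1 + 1 / l) + (1 + 1 / l) * S a" for j s
  proof -
    have as: "a s \<le> S a" by (intro ge_point a_nonneg a_int)
    have "V j s \<le> a s * (1 + 1 / l)"
      using V_le[of j s] N1[of j] a_nonneg[of s] by (meson add_right_mono mult_left_mono order_trans)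
    also have "\<dots> \<le> S a * (1 + 1 / l)" using as l by (intro mult_right_mono) auto
    finally have "V j s \<le> (1 + 1 / l) * S a" by (simp add: mult.commute)
    moreover have "U j s \<le> 1 + 1 / l" using U_le[of j s] N1[of j] by linarith
    moreover have "norm (U j s, V j s) \<le> \<bar>U j s\<bar> + \<bar>V j s\<bar>"
      using norm_Pair_le[of "U j s" "V j s"] by simp
    ultimately show ?thesis using U0[of j s] V0[of j s] by simp
  qed
  \<comment> \<open>Diagonal extraction over the countable state space, for both vectors at once by
    pairing them.\<close>
  obtain k where k: "strict_mono (k :: nat \<Rightarrow> nat)"
    and "\<And>s. s \<in> UNIV \<Longrightarrow> \<exists>l. (\<lambda>j. (U (k j) s, V (k j) s)) \<longlonglongrightarrow> l"
    using function_convergent_subsequence[of UNIV "\<lambda>j s. (U j s, V j s)", OF countableI_type bdd]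
    by metis
  then obtain w where w: "\<And>s. (\<lambda>j. (U (k j) s, V (k j) s)) \<longlonglongrightarrow> w s" by (metis UNIV_I)
  define u where "u = fst \<circ> w"
  define v where "v = snd \<circ> w"
  have u: "(\<lambda>j. U (k j) s) \<longlonglongrightarrow> u s" and v: "(\<lambda>j. V (k j) s) \<longlonglongrightarrow> v s" for s
    using tendsto_fst[OF w[of s]] tendsto_snd[OF w[of s]] by (auto simp: u_def v_def)
  note sub = LIMSEQ_subseq_LIMSEQ[OF _ k, unfolded comp_def]
  have dom: "(\<lambda>j. S (f j)) \<longlonglongrightarrow> S g"
    if "\<And>s. (\<lambda>j. f j s) \<longlonglongrightarrow> g s" "\<And>j s. \<bar>f j s\<bar> \<le> q * a s" for f g q
    by (rule integral_dominated_convergence[where w="\<lambda>s. q * a s"]) (use that a_int in auto)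
  have V_le': "V j s \<le> (1 + 1 / l) * a s" for j s
    using V_le[of j s] N1[of j] a_nonneg[of s] mult_left_mono[of "1 / N j + 1 / l" "1 + 1 / l" "a s"]
    by (simp add: mult.commute)
  have U_le': "U j s \<le> 1 + 1 / l" for j s using U_le[of j s] N1[of j] by linarith
  have u_bounds: "0 \<le> u s \<and> u s \<le> 1 / l" for s
  proof
    show "0 \<le> u s" by (rule LIMSEQ_le_const[OF u]) (use U0 in auto)
    have "(\<lambda>j. 1 / N (k j) + 1 / l) \<longlonglongrightarrow> 0 + 1 / l"
      by (intro tendsto_add tendsto_const sub[OF N_lim])
    then show "u s \<le> 1 / l" by (intro LIMSEQ_le[OF u]) (use U_le in auto)
  qed
  have v_bounds: "0 \<le> v s \<and> v s \<le> a s / l" for s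
  proof
    show "0 \<le> v s" by (rule LIMSEQ_le_const[OF v]) (use V0 in auto)
    have "(\<lambda>j. a s * (1 / N (k j) + 1 / l)) \<longlonglongrightarrow> a s * (0 + 1 / l)"
      by (intro tendsto_add tendsto_mult tendsto_const sub[OF N_lim])
    then show "v s \<le> a s / l" by (intro LIMSEQ_le[OF v]) (use V_le in auto)
  qed
  have Sv: "S v = 1"
  proof -
    have "(\<lambda>j. S (V (k j))) \<longlonglongrightarrow> S v"
      by (rule dom[OF v, where q="1 + 1 / l"]) (use V0 V_le' in auto)
    then show ?thesis by (simp add: SV LIMSEQ_const_iff)
  qed
  have Sau: "S (\<lambda>s. a s * u s) = 1"
  proof -
    have "(\<lambda>j. S (\<lambda>s. a s * U (k j) s)) \<longlonglongrightarrow> S (\<lambda>s. a s * u s)"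
    proof (rule dom[where q="1 + 1 / l"])
      show "(\<lambda>j. a s * U (k j) s) \<longlonglongrightarrow> a s * u s" for s by (intro tendsto_diff tendsto_mult tendsto_const u)
      show "\<bar>a s * U (k j) s\<bar> \<le> (1 + 1 / l) * a s" for j s
        using mult_left_mono[OF U_le'[of "k j" s] a_nonneg[of s]] a_nonneg[of s] U0[of "k j" s]
        by (metis abs_of_nonneg mult.commute mult_nonneg_nonneg)
    qed
    then show ?thesis by (simp add: SaU LIMSEQ_const_iff)
  qed
  have cancel: "X = l * Y" if "1 / l * X - Y = 0" for X Y using that l by (simp add: field_simps)
  have Gu: "\<forall>s. S (\<lambda>r. G s r * u r) = l * u s"
  proof
    fix s
    have "(\<lambda>j. S (\<lambda>r. G s r * U (k j) r)) \<longlonglongrightarrow> S (\<lambda>r. G s r * u r)"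
    proof (rule dom[where q="1 + 1 / l"])
      show "(\<lambda>j. G s r * U (k j) r) \<longlonglongrightarrow> G s r * u r" for r by (intro tendsto_diff tendsto_mult tendsto_const u)
      show "\<bar>G s r * U (k j) r\<bar> \<le> (1 + 1 / l) * a r" for j r
        using mult_mono[OF G_le[of s r] U_le'[of "k j" r]] a_nonneg[of r] U0[of "k j" r] G_nonneg[of s r]
        by (simp add: mult.commute)
    qed
    then have "(\<lambda>j. z (k j) * S (\<lambda>r. G s r * U (k j) r) - U (k j) s) \<longlonglongrightarrow> 1 / l * S (\<lambda>r. G s r * u r) - u s"
      by (intro tendsto_diff tendsto_mult tendsto_const u sub[OF z_lim])
    moreover have "(\<lambda>j. z (k j) * S (\<lambda>r. G s r * U (k j) r) - U (k j) s) \<longlonglongrightarrow> 0"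
    proof (rule Lim_null_comparison)
      show "\<forall>\<^sub>F j in sequentially. norm (z (k j) * S (\<lambda>r. G s r * U (k j) r) - U (k j) s) \<le> (1 + 1 / l) * (1 / N (k j))"
        using UG by (intro always_eventually allI) simp
      have "(\<lambda>j. (1 + 1 / l) * (1 / N (k j))) \<longlonglongrightarrow> (1 + 1 / l) * 0"
        by (intro tendsto_mult tendsto_const sub[OF N_lim])
      then show "(\<lambda>j. (1 + 1 / l) * (1 / N (k j))) \<longlonglongrightarrow> 0" by simp
    qed
    ultimately have "1 / l * S (\<lambda>r. G s r * u r) - u s = 0" by (rule LIMSEQ_unique)
    then show "S (\<lambda>r. G s r * u r) = l * u s" by (rule cancel)
  qed
  have vG: "\<forall>r. S (\<lambda>s. v s * G s r) = l * v r"
  proof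
    fix r
    have Gr: "G s r \<le> S a" for s
      using G_le[of s r] ge_point[of a r, OF a_nonneg a_int] by linarith
    have "(\<lambda>j. S (\<lambda>s. V (k j) s * G s r)) \<longlonglongrightarrow> S (\<lambda>s. v s * G s r)"
    proof (rule dom[where q="(1 + 1 / l) * S a"])
      show "(\<lambda>j. V (k j) s * G s r) \<longlonglongrightarrow> v s * G s r" for s by (intro tendsto_diff tendsto_mult tendsto_const v)
      show "\<bar>V (k j) s * G s r\<bar> \<le> (1 + 1 / l) * S a * a s" for j s
        using mult_mono[OF V_le'[of "k j" s] Gr[of s]] a_nonneg[of s] V0[of "k j" s] G_nonneg[of s r] l
        by (simp add: mult_ac)
    qed
    then have "(\<lambda>j. z (k j) * S (\<lambda>s. V (k j) s * G s r) - V (k j) r) \<longlonglongrightarrow> 1 / l * S (\<lambda>s. v s * G s r) - v r"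
      by (intro tendsto_diff tendsto_mult tendsto_const v sub[OF z_lim])
    moreover have "(\<lambda>j. z (k j) * S (\<lambda>s. V (k j) s * G s r) - V (k j) r) \<longlonglongrightarrow> 0"
    proof (rule Lim_null_comparison)
      show "\<forall>\<^sub>F j in sequentially. norm (z (k j) * S (\<lambda>s. V (k j) s * G s r) - V (k j) r) \<le> a r * (1 + 1 / l) * (1 / N (k j))"
        using VG by (intro always_eventually allI) simp
      have "(\<lambda>j. a r * (1 + 1 / l) * (1 / N (k j))) \<longlonglongrightarrow> a r * (1 + 1 / l) * 0"
        by (intro tendsto_mult tendsto_const sub[OF N_lim])
      then show "(\<lambda>j. a r * (1 + 1 / l) * (1 / N (k j))) \<longlonglongrightarrow> 0" by simp
    qed
    ultimately have "1 / l * S (\<lambda>s. v s * G s r) - v r = 0" by (rule LIMSEQ_unique)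
    then show "S (\<lambda>s. v s * G s r) = l * v r" by (rule cancel)
  qed
  show ?thesis
    by (rule exI[of _ l], rule exI[of _ u], rule exI[of _ v])
      (intro conjI Gu vG allI l Sv Sau u_bounds[THEN conjunct1] u_bounds[THEN conjunct2]
        v_bounds[THEN conjunct1] v_bounds[THEN conjunct2])
qed

end


section \<open>The Borel structure of the shift space\<close>

lemma map_upt_eq_iff: "map x [0..<n] = w \<longleftrightarrow> length w = n \<and> (\<forall>j<n. x j = w ! j)"
  by (subst list_eq_iff_nth_eq) auto

lemma cylinder_iff_map: "x \<in> cylinder t w \<longleftrightarrow> x \<in> shift_space t \<and> map x [0..<length w] = w"
  by (simp add: cylinder_def map_upt_eq_iff)

lemma cylinder_Nil[simp]: "cylinder t [] = shift_space t"
  by (auto simp: cylinder_def)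

lemma cylinder_subset: "cylinder t w \<subseteq> shift_space t"
  by (auto simp: cylinder_def)

lemma in_cylinder_prefix: "x \<in> shift_space t \<Longrightarrow> x \<in> cylinder t (map x [0..<n])"
  by (simp add: cylinder_iff_map)

lemma cylinder_prefix_mono:
  assumes "m \<le> n" shows "cylinder t (map x [0..<n]) \<subseteq> cylinder t (map x [0..<m])"
  using assms by (auto simp: cylinder_def)

lemma cylinder_Int:
  assumes "length w \<le> length w'"
  shows "cylinder t w \<inter> cylinder t w' = (if take (length w) w' = w then cylinder t w' else {})"
proof -
  have "take (length w) w' = w \<longleftrightarrow> (\<forall>j<length w. w' ! j = w ! j)"
    using assms by (subst list_eq_iff_nth_eq) (simp add: min_absorb2)
  then show ?thesis using assms by (auto simp: cylinder_def)
qed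

lemma cylinder_Int_cases: "cylinder t w \<inter> cylinder t w' \<in> insert {} (range (cylinder t))"
  using cylinder_Int[of w w' t] cylinder_Int[of w' w t]
  by (cases "length w \<le> length w'") (auto simp: Int_commute)

lemma topspace_shift_topology: "topspace (shift_topology t) = shift_space t"
proof -
  have "x \<in> \<Union> {cylinder t w | w. w \<noteq> []}" if "x \<in> shift_space t" for x
    using in_cylinder_prefix[OF that, of 1] by fastforce
  then show ?thesis
    unfolding shift_topology_def topology_generated_by_topspace using cylinder_subset by blast
qed

text \<open>The prefix cylinders of a point are nested, so the generating family already yields a
  neighbourhood base.\<close>

lemma openin_shift_topology_prefix:
  assumes "openin (shift_topology t) U" "x \<in> U"
  shows "\<exists>n. cylinder t (map x [0..<n]) \<subseteq> U"
proof -
  have "generate_topology_on {cylinder t w | w. w \<noteq> []} U"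
    using assms(1) by (simp add: shift_topology_def openin_topology_generated_by_iff)
  then have "\<forall>x\<in>U. \<exists>n. cylinder t (map x [0..<n]) \<subseteq> U"
  proof induction
    case (Int a b)
    show ?case
    proof
      fix x assume "x \<in> a \<inter> b"
      then obtain n m where "cylinder t (map x [0..<n]) \<subseteq> a" "cylinder t (map x [0..<m]) \<subseteq> b"
        using Int by blast
      then have "cylinder t (map x [0..<max n m]) \<subseteq> a \<inter> b"
        using cylinder_prefix_mono[of n "max n m" t x] cylinder_prefix_mono[of m "max n m" t x] by auto
      then show "\<exists>n. cylinder t (map x [0..<n]) \<subseteq> a \<inter> b" ..
    qed
  next
    case (UN K)
    then show ?case by (metis Union_iff Union_upper subset_trans)
  next
    case (Basis s)
    then obtain w where "s = cylinder t w" by blast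
    moreover have "cylinder t (map x [0..<length w]) \<subseteq> cylinder t w" if "x \<in> cylinder t w" for x
      using that by (simp add: cylinder_iff_map)
    ultimately show ?case by blast
  qed simp
  with assms(2) show ?thesis by blast
qed

lemma openin_cylinder: "openin (shift_topology t) (cylinder t w)"
proof (cases "w = []")
  case True
  then show ?thesis using openin_topspace[of "shift_topology t"] by (simp add: topspace_shift_topology)
next
  case False
  then show ?thesis
    unfolding shift_topology_def openin_topology_generated_by_iff
    by (intro generate_topology_on.Basis) auto
qed

lemma space_borel_shift[simp]: "space (borel_shift t) = shift_space t"
  unfolding borel_shift_def
  by (rule space_measure_of) (use openin_subset topspace_shift_topology in fast)

text \<open>There are only countably many words, so every open set is a countable union of
  cylinders.\<close>

lemma sets_borel_shift: "sets (borel_shift t) = sigma_sets (shift_space t) (range (cylinder t))"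
proof -
  have sub: "{U. openin (shift_topology t) U} \<subseteq> Pow (shift_space t)"
    using openin_subset topspace_shift_topology by fast
  have "sets (borel_shift t) = sigma_sets (shift_space t) {U. openin (shift_topology t) U}"
    unfolding borel_shift_def using sub by (rule sets_measure_of)
  also have "\<dots> = sigma_sets (shift_space t) (range (cylinder t))"
  proof (rule sigma_sets_eqI)
    fix U assume "U \<in> {U. openin (shift_topology t) U}"
    then have U: "openin (shift_topology t) U" by simp
    have "U = \<Union> (cylinder t ` {w. cylinder t w \<subseteq> U})"
    proof safe
      fix x assume "x \<in> U"
      moreover then have "x \<in> shift_space t" using sub U by auto
      ultimately show "x \<in> \<Union> (cylinder t ` {w. cylinder t w \<subseteq> U})"
        using openin_shift_topology_prefix[OF U, of x] in_cylinder_prefix[of x t] by blast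
    qed auto
    also have "\<dots> \<in> sigma_sets (shift_space t) (range (cylinder t))"
      by (intro sigma_sets_UNION) auto
    finally show "U \<in> sigma_sets (shift_space t) (range (cylinder t))" .
  qed (auto intro: openin_cylinder)
  finally show ?thesis .
qed

lemma sets_cylinder[measurable, simp]: "cylinder t w \<in> sets (borel_shift t)"
  by (auto simp: sets_borel_shift)

lemma sets_borel_shift_measure_of: "sets (borel_shift t) = sets (sigma (shift_space t) (range (cylinder t)))"
  using cylinder_subset by (subst sets_measure_of) (auto simp: sets_borel_shift)

lemma measurable_to_borel_shift:
  assumes "\<And>x. x \<in> space M \<Longrightarrow> f x \<in> shift_space t"
    and "\<And>w. f -` cylinder t w \<inter> space M \<in> sets M"
  shows "f \<in> measurable M (borel_shift t)"
proof -
  have "f \<in> measurable M (sigma (shift_space t) (range (cylinder t)))"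
    using assms cylinder_subset by (intro measurable_measure_of) fast+
  then show ?thesis using measurable_cong_sets[OF refl sets_borel_shift_measure_of] by auto
qed

lemma measurable_coordinate[measurable]:
  "(\<lambda>x. x n) \<in> measurable (borel_shift t) (count_space UNIV)"
proof (rule measurable_count_space_eq2_countable[THEN iffD2], intro conjI ballI)
  fix j :: nat
  have "(\<lambda>x. x n) -` {j} \<inter> space (borel_shift t) =
      \<Union> (cylinder t ` {w. length w = Suc n \<and> w ! n = j})"
  proof safe
    fix x assume "x \<in> space (borel_shift t)"
    then have "x \<in> cylinder t (map x [0..<Suc n])" by (intro in_cylinder_prefix) simp
    moreover have "map x [0..<Suc n] ! n = x n" by (simp add: nth_append del: upt_Suc)
    ultimately show "x \<in> \<Union> (cylinder t ` {w. length w = Suc n \<and> w ! n = x n})"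
      by (intro UN_I[of "map x [0..<Suc n]"]) (simp_all del: upt_Suc)
  qed (auto simp: cylinder_def)
  also have "\<dots> \<in> sets (borel_shift t)" by (intro sets.countable_UN') auto
  finally show "(\<lambda>x. x n) -` {j} \<inter> space (borel_shift t) \<in> sets (borel_shift t)" .
qed auto

lemma shift_map_in[simp]: "x \<in> shift_space t \<Longrightarrow> shift_map x \<in> shift_space t"
  by (simp add: shift_space_def shift_map_def)

lemma shift_map_funpow: "(shift_map ^^ n) x = (\<lambda>i. x (n + i))"
  by (induction n) (auto simp: shift_map_def)

lemma shift_map_funpow_in[simp]: "x \<in> shift_space t \<Longrightarrow> (shift_map ^^ n) x \<in> shift_space t"
  by (simp add: shift_map_funpow shift_space_def)

lemma measurable_prefix[measurable]:
  "(\<lambda>x. map x [0..<n]) \<in> measurable (borel_shift t) (count_space UNIV)"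
proof (rule measurable_count_space_eq2_countable[THEN iffD2], intro conjI ballI)
  fix w :: "nat list"
  have "(\<lambda>x. map x [0..<n]) -` {w} \<inter> space (borel_shift t) = (if length w = n then cylinder t w else {})"
    by (auto simp: cylinder_iff_map)
  then show "(\<lambda>x. map x [0..<n]) -` {w} \<inter> space (borel_shift t) \<in> sets (borel_shift t)" by simp
qed auto

lemma measurable_shift_map[measurable]: "shift_map \<in> measurable (borel_shift t) (borel_shift t)"
proof (rule measurable_to_borel_shift)
  fix w
  have "shift_map -` cylinder t w \<inter> space (borel_shift t) =
      {x \<in> space (borel_shift t). \<forall>j\<in>{..<length w}. x (Suc j) = w ! j}"
    by (auto simp: cylinder_def shift_map_def shift_space_def)
  also have "\<dots> \<in> sets (borel_shift t)" by measurable
  finally show "shift_map -` cylinder t w \<inter> space (borel_shift t) \<in> sets (borel_shift t)" .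
qed simp

lemma measurable_shift_funpow[measurable]:
  "shift_map ^^ n \<in> measurable (borel_shift t) (borel_shift t)"
  by (rule measurable_compose_n) simp

text \<open>Two cylinders are nested or disjoint. The empty set is added for the second case, since
  it need not be a cylinder.\<close>

lemma Int_stable_cylinders: "Int_stable (insert {} (range (cylinder t)))"
  unfolding Int_stable_def using cylinder_Int_cases by blast

lemma sets_borel_shift': "sets (borel_shift t) = sigma_sets (shift_space t) (insert {} (range (cylinder t)))"
  unfolding sets_borel_shift
  by (intro sigma_sets_eqI) (auto intro: sigma_sets.Empty)

lemma cylinder_measure_eqI:
  assumes M: "finite_measure M" "sets M = sets (borel_shift t)"
    and N: "sets N = sets (borel_shift t)"
    and eq: "\<And>w. emeasure M (cylinder t w) = emeasure N (cylinder t w)"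
  shows "M = N"
proof (rule measure_eqI_generator_eq[OF Int_stable_cylinders, where A="\<lambda>_. shift_space t" and \<Omega>="shift_space t"])
  show "emeasure M (shift_space t) \<noteq> \<infinity>"
    using M(1) sets_eq_imp_space_eq[OF M(2)] finite_measure.emeasure_finite by auto
  show "insert {} (range (cylinder t)) \<subseteq> Pow (shift_space t)" using cylinder_subset by auto
  show "range (\<lambda>_::nat. shift_space t) \<subseteq> insert {} (range (cylinder t))"
    using cylinder_Nil[of t] by (metis image_subset_iff insertCI range_eqI)
qed (use M N eq sets_borel_shift' in auto)

lemma cylinder_Cons_shift:
  assumes "w \<noteq> []"
  shows "shift_map -` cylinder t w \<inter> shift_space t = (\<Union>i. cylinder t (i # w))"
proof (intro equalityI subsetI; (elim IntE UN_E)?; (intro IntI)?)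
  fix x assume x: "x \<in> shift_map -` cylinder t w" "x \<in> shift_space t"
  then have "x \<in> cylinder t (x 0 # w)"
    by (auto simp: cylinder_def shift_map_def nth_Cons split: nat.split)
  then show "x \<in> (\<Union>i. cylinder t (i # w))" by blast
next
  fix x i assume "x \<in> cylinder t (i # w)"
  then show "x \<in> shift_map -` cylinder t w" "x \<in> shift_space t"
    by (auto simp: cylinder_def shift_map_def shift_space_def)
qed

lemma disjoint_cylinder_Cons: "disjoint_family (\<lambda>i. cylinder t (i # w))"
  by (auto simp: disjoint_family_on_def cylinder_def)

text \<open>Invariance is tested on an intersection-stable generator: the preimage of the cylinder
  of \<open>w\<close> is the disjoint union of the cylinders of \<open>i # w\<close>.\<close>

lemma invariant_measuresI:
  assumes M: "prob_space M" "sets M = sets (borel_shift t)"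
    and inv: "\<And>w. w \<noteq> [] \<Longrightarrow> (\<integral>\<^sup>+i. emeasure M (cylinder t (i # w)) \<partial>count_space UNIV) = emeasure M (cylinder t w)"
  shows "M \<in> invariant_measures t"
proof -
  interpret prob_space M by fact
  note [measurable_cong] = M(2)
  have sp: "space M = shift_space t" using sets_eq_imp_space_eq[OF M(2)] by simp
  have "distr M (borel_shift t) shift_map = M"
  proof (rule cylinder_measure_eqI[where t=t])
    show "finite_measure (distr M (borel_shift t) shift_map)"
      by (intro finite_measure_distr) measurable
    fix w
    have "emeasure (distr M (borel_shift t) shift_map) (cylinder t w) =
        emeasure M (shift_map -` cylinder t w \<inter> shift_space t)"
      by (subst emeasure_distr) (auto simp: sp)
    also have "\<dots> = emeasure M (cylinder t w)"
    proof (cases "w = []")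
      case True
      have "shift_map -` shift_space t \<inter> shift_space t = shift_space t" by auto
      then show ?thesis using True by simp
    next
      case False
      have "emeasure M (\<Union>i. cylinder t (i # w)) = (\<integral>\<^sup>+i. emeasure M (cylinder t (i # w)) \<partial>count_space UNIV)"
        using M(2) by (intro emeasure_UN_countable disjoint_cylinder_Cons) auto
      then show ?thesis using False by (simp add: cylinder_Cons_shift inv)
    qed
    finally show "emeasure (distr M (borel_shift t) shift_map) (cylinder t w) = emeasure M (cylinder t w)" .
  qed (use M in auto)
  then have "emeasure M (shift_map -` E \<inter> space M) = emeasure M E" if "E \<in> sets M" for E
    using that M(2) emeasure_distr[of shift_map M "borel_shift t" E] by simp
  moreover have "shift_map -` E \<inter> space M \<in> sets M" if "E \<in> sets M" for E
  proof -
    have "shift_map \<in> measurable M (borel_shift t)" by measurable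
    from measurable_sets[OF this, of E] show ?thesis using that M(2) by simp
  qed
  ultimately show ?thesis using M by (simp add: invariant_measures_def)
qed

text \<open>An application of the Ionescu-Tulcea theorem, in which the next letter after
  \<open>w\<close> has the conditional law \<open>p (w @ [j]) / p w\<close>.\<close>

theorem kolmogorov_words:
  fixes p :: "nat list \<Rightarrow> ennreal"
  assumes p1: "p [] = 1" and p: "\<And>w. p w = (\<integral>\<^sup>+j. p (w @ [j]) \<partial>count_space UNIV)"
  shows "\<exists>M. prob_space M \<and> sets M = sets (PiM UNIV (\<lambda>_::nat. count_space (UNIV :: nat set))) \<and>
    (\<forall>w. emeasure M {x. map x [0..<length w] = w} = p w)"
proof -
  define C :: "nat measure" where "C = count_space UNIV"
  have p_snoc: "p (w @ [j]) \<le> p w" for w j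
    by (subst p[of w]) (rule nn_integral_ge_point, simp)
  have p_le: "p w \<le> 1" for w
    by (induction w rule: rev_induct) (auto simp: p1 intro: order_trans[OF p_snoc])
  \<comment> \<open>After a word of probability \<open>0\<close> any law will do; a point mass keeps
    \<open>K w\<close> a probability measure.\<close>
  define K :: "nat list \<Rightarrow> nat measure" where
    "K w = (if p w = 0 then return C 0 else density C (\<lambda>j. p (w @ [j]) / p w))" for w
  have sets_K: "sets (K w) = sets C" for w by (simp add: K_def C_def)
  have p_fin: "p w \<noteq> top" for w using p_le[of w] by (metis ennreal_one_less_top leD)
  have prob_K: "prob_space (K w)" for w
  proof (cases "p w = 0")
    case True
    then show ?thesis by (auto simp: K_def C_def intro!: prob_space_return)
  next
    case False
    have "(\<integral>\<^sup>+j. p (w @ [j]) / p w \<partial>C) = p w / p w"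
      unfolding C_def by (subst nn_integral_divide) (auto simp flip: p)
    also have "\<dots> = 1" using False p_fin by (simp add: ennreal_divide_self less_top[symmetric])
    finally have "emeasure (density C (\<lambda>j. p (w @ [j]) / p w)) (space (density C (\<lambda>j. p (w @ [j]) / p w))) = 1"
      by (subst emeasure_density) (auto simp: C_def)
    then show ?thesis using False by (auto simp: K_def intro: prob_spaceI)
  qed
  define P :: "nat \<Rightarrow> (nat \<Rightarrow> nat) \<Rightarrow> nat measure" where "P n x = K (map x [0..<n])" for n x
  have pre_meas[measurable]: "(\<lambda>x. map x [0..<n]) \<in> measurable (PiM {0..<n} (\<lambda>_. C)) (count_space UNIV)" for n
  proof (rule measurable_count_space_eq2_countable[THEN iffD2], intro conjI ballI)
    fix w :: "nat list"
    have "(\<lambda>x. map x [0..<n]) -` {w} \<inter> space (PiM {0..<n} (\<lambda>_. C)) =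
        (if length w = n then {x \<in> space (PiM {0..<n} (\<lambda>_. C)). \<forall>i\<in>{0..<n}. x i = w ! i} else {})"
      by (auto simp: map_upt_eq_iff)
    also have "\<dots> \<in> sets (PiM {0..<n} (\<lambda>_. C))"
    proof -
      have "{x \<in> space (PiM {0..<n} (\<lambda>_. C)). x i = w ! i} \<in> sets (PiM {0..<n} (\<lambda>_. C))" if "i \<in> {0..<n}" for i
        using measurable_sets[OF measurable_component_singleton[OF that, of "\<lambda>_. C"], of "{w ! i}"]
        by (simp add: C_def vimage_def Int_def conj_commute)
      then have "{x \<in> space (PiM {0..<n} (\<lambda>_. C)). \<forall>i\<in>{0..<n}. x i = w ! i} \<in> sets (PiM {0..<n} (\<lambda>_. C))"
        by (rule sets.sets_Collect_finite_All) simp_all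
      then show ?thesis by simp
    qed
    finally show "(\<lambda>x. map x [0..<n]) -` {w} \<inter> space (PiM {0..<n} (\<lambda>_. C)) \<in> sets (PiM {0..<n} (\<lambda>_. C))" .
  qed auto
  have P_meas: "P n \<in> measurable (PiM {0..<n} (\<lambda>_. C)) (subprob_algebra C)" for n
  proof -
    have "K \<in> measurable (count_space UNIV) (subprob_algebra C)"
      using sets_K prob_K by (auto simp: space_subprob_algebra intro: prob_space_imp_subprob_space)
    from measurable_compose[OF pre_meas this] show ?thesis by (simp add: P_def[abs_def])
  qed
  interpret IT: Ionescu_Tulcea P "\<lambda>_. C"
    by (intro Ionescu_Tulcea.intro P_meas) (simp add: P_def prob_K)
  define cyl :: "nat list \<Rightarrow> (nat \<Rightarrow> nat) set" where
    "cyl w = {x \<in> space (PiM {0..<length w} (\<lambda>_. C)). map x [0..<length w] = w}" for w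
  have cyl_sets: "cyl w \<in> sets (PiM {0..<length w} (\<lambda>_. C))" for w
    unfolding cyl_def using pre_meas[of "length w"] by measurable
  have K_pt: "p w * emeasure (K w) {j} = p (w @ [j])" for w j
  proof (cases "p w = 0")
    case True
    then show ?thesis using p_snoc[of w j] by simp
  next
    case False
    have "emeasure (K w) {j} = (\<integral>\<^sup>+x. p (w @ [x]) / p w * indicator {j} x \<partial>C)"
      using False by (simp add: K_def C_def emeasure_density)
    also have "\<dots> = p (w @ [j]) / p w"
      by (subst nn_integral_indicator_singleton) (auto simp: C_def)
    finally show ?thesis
      using False p_fin[of w]
      by (simp add: ennreal_times_divide ennreal_mult_divide_eq mult.commute[of "p w"])
  qed
  have C_cyl: "emeasure (IT.C 0 n (\<lambda>_. undefined)) (cyl w) = p w" if "length w = n" for n w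
    using that
  proof (induction n arbitrary: w)
    case 0
    have "cyl [] \<in> sets (PiM {0..<0} (\<lambda>_. C))" using cyl_sets[of "[]"] by simp
    moreover have "(\<lambda>_. undefined) \<in> cyl []" by (simp add: cyl_def space_PiM)
    ultimately show ?case using 0 by (simp add: p1)
  next
    case (Suc n)
    then obtain w' j where w: "w = w' @ [j]" "length w' = n"
      by (metis length_Suc_conv_rev)
    have "emeasure (IT.C 0 (Suc n) (\<lambda>_. undefined)) (cyl w) =
        (\<integral>\<^sup>+\<omega>. emeasure (IT.eP n \<omega>) (cyl w) \<partial>IT.C 0 n (\<lambda>_. undefined))"
      using cyl_sets[of w] Suc.prems IT.measurable_eP[of n]
      by (simp, subst emeasure_bind[where N="PiM {0..<Suc n} (\<lambda>_. C)"])
        (auto simp: IT.space_C measurable_cong_sets[OF IT.sets_C refl])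
    also have "\<dots> = (\<integral>\<^sup>+\<omega>. emeasure (K w') {j} * indicator (cyl w') \<omega> \<partial>IT.C 0 n (\<lambda>_. undefined))"
    proof (intro nn_integral_cong)
      fix \<omega> assume "\<omega> \<in> space (IT.C 0 n (\<lambda>_. undefined))"
      then have \<omega>: "\<omega> \<in> space (PiM {0..<n} (\<lambda>_. C))" by (simp add: IT.space_C)
      have upd: "(fun_upd \<omega> n) j' \<in> space (PiM {0..<Suc n} (\<lambda>_. C))" for j'
        using \<omega> by (auto simp: space_PiM PiE_iff C_def extensional_def)
      have eq: "(\<lambda>x. fun_upd \<omega> n x) -` cyl w \<inter> space C = (if \<omega> \<in> cyl w' then {j} else {})"
      proof -
        have "map (fun_upd \<omega> n y) [0..<Suc n] = map \<omega> [0..<n] @ [y]" for y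
          by simp
        then show ?thesis using \<omega> upd w Suc.prems unfolding cyl_def by (auto simp: C_def)
      qed
      have "emeasure (IT.eP n \<omega>) (cyl w) = emeasure (P n \<omega>) ((\<lambda>x. fun_upd \<omega> n x) -` cyl w \<inter> space C)"
        using IT.emeasure_eP[OF \<omega>, of "cyl w"] cyl_sets[of w] Suc.prems by simp
      also have "\<dots> = emeasure (K w') {j} * indicator (cyl w') \<omega>"
        unfolding eq using w by (auto simp: P_def cyl_def indicator_def)
      finally show "emeasure (IT.eP n \<omega>) (cyl w) = emeasure (K w') {j} * indicator (cyl w') \<omega>" .
    qed
    also have "\<dots> = emeasure (K w') {j} * p w'"
      using Suc.IH[OF w(2)] cyl_sets[of w'] w(2)
      by (subst nn_integral_cmult_indicator) (auto simp: IT.sets_C)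
    also have "\<dots> = p w" using K_pt[of w' j] w by (simp add: mult.commute)
    finally show ?case .
  qed
  have sets_lim: "sets IT.PF.lim = sets (PiM UNIV (\<lambda>_. C))" by (rule IT.PF.sets_lim)
  have "emeasure IT.PF.lim {x. map x [0..<length w] = w} = p w" for w
  proof -
    let ?J = "{0..<length w}"
    have "IT.PF.emb UNIV ?J (cyl w) = {x. map x [0..<length w] = w}"
      by (auto simp: prod_emb_def cyl_def space_PiM C_def PiE_iff map_upt_eq_iff)
    then have "emeasure IT.PF.lim {x. map x [0..<length w] = w} = emeasure (IT.CI ?J) (cyl w)"
      using IT.lim[of ?J "cyl w"] cyl_sets[of w] by simp
    also have "\<dots> = emeasure (IT.C 0 (length w) (\<lambda>_. undefined)) (IT.PF.emb ?J ?J (cyl w))"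
      using cyl_sets[of w] by (intro IT.emeasure_CI) auto
    also have "IT.PF.emb ?J ?J (cyl w) = cyl w"
      by (rule prod_emb_id) (auto simp: cyl_def space_PiM)
    finally show ?thesis using C_cyl by simp
  qed
  note cyl_lim = this
  have prob_lim: "prob_space IT.PF.lim"
  proof
    have "emeasure IT.PF.lim {x. map x [0..<length ([] :: nat list)] = []} = p []" by (rule cyl_lim)
    then show "emeasure IT.PF.lim (space IT.PF.lim) = 1"
      using sets_eq_imp_space_eq[OF sets_lim] by (simp add: space_PiM C_def p1)
  qed
  have "\<exists>M. prob_space M \<and> sets M = sets (PiM UNIV (\<lambda>_::nat. C)) \<and>
      (\<forall>w. emeasure M {x. map x [0..<length w] = w} = p w)"
    by (rule exI[of _ "IT.PF.lim"]) (intro conjI allI prob_lim sets_lim cyl_lim)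
  then show ?thesis by (simp only: C_def)
qed


section \<open>Invariant measures from hidden Markov chains\<close>

text \<open>Consistency on the right yields a measure on all sequences, consistency on the left its
  shift invariance, and \<open>adm\<close> confines it to the admissible sequences.\<close>

theorem invariant_measure_from_words:
  fixes p :: "nat list \<Rightarrow> ennreal"
  assumes p1: "p [] = 1" and right: "\<And>w. p w = (\<integral>\<^sup>+j. p (w @ [j]) \<partial>count_space UNIV)"
    and left: "\<And>w. p w = (\<integral>\<^sup>+i. p (i # w) \<partial>count_space UNIV)"
    and adm: "\<And>i j. \<not> t i j \<Longrightarrow> p [i, j] = 0"
  shows "\<exists>\<mu>\<in>invariant_measures t. \<forall>w. emeasure \<mu> (cylinder t w) = p w"
proof -
  obtain N where N: "prob_space N" "sets N = sets (PiM UNIV (\<lambda>_::nat. count_space (UNIV :: nat set)))"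
    "\<And>w. emeasure N {x. map x [0..<length w] = w} = p w"
    using kolmogorov_words[OF p1 right] by blast
  interpret N: prob_space N by fact
  have sp: "space N = UNIV" using sets_eq_imp_space_eq[OF N(2)] by (simp add: space_PiM)
  have coord: "(\<lambda>x. x n) \<in> measurable N (count_space UNIV)" for n
    unfolding measurable_cong_sets[OF N(2) refl] by (rule measurable_component_singleton) simp
  have pre[measurable]: "{x. map x [0..<length w] = w} \<in> sets N" for w
  proof -
    have "{x. map x [0..<length w] = w} = {x \<in> space N. \<forall>i\<in>{0..<length w}. x i = w ! i}"
      by (auto simp: map_upt_eq_iff sp)
    also have "\<dots> \<in> sets N"
    proof (rule sets.sets_Collect_finite_All)
      fix i
      show "{x \<in> space N. x i = w ! i} \<in> sets N"
        using measurable_sets[OF coord[of i], of "{w ! i}"] by (simp add: vimage_def Int_def conj_commute)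
    qed simp
    finally show ?thesis .
  qed
  \<comment> \<open>Consistency on the left makes a word at most as likely as each of its suffixes,
    so a forbidden pair at the end of a word makes it null.\<close>
  have p_suffix: "p (w @ z) \<le> p z" for w z
  proof (induction w)
    case (Cons i w)
    have "p (i # (w @ z)) \<le> p (w @ z)"
      by (subst left[of "w @ z"]) (rule nn_integral_ge_point, simp)
    with Cons show ?case by simp
  qed simp
  have "AE x in N. \<forall>n. t (x n) (x (Suc n))"
  proof (subst AE_all_countable, intro allI)
    fix n
    let ?B = "{w. length w = Suc (Suc n) \<and> \<not> t (w ! n) (w ! Suc n)}"
    have null: "(\<Union>w\<in>?B. {x. map x [0..<length w] = w}) \<in> null_sets N"
    proof (rule null_sets_UN')
      fix w assume w: "w \<in> ?B"
      have "drop n w = [w ! n, w ! Suc n]"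
        using w by (simp add: Cons_nth_drop_Suc[symmetric])
      then have "p w \<le> p [w ! n, w ! Suc n]"
        using p_suffix[of "take n w" "drop n w"] by (metis append_take_drop_id)
      then have "p w = 0" using adm w by simp
      then show "{x. map x [0..<length w] = w} \<in> null_sets N" using N(3)[of w] pre by (auto simp: null_sets_def)
    qed auto
    show "AE x in N. t (x n) (x (Suc n))"
    proof (rule AE_I'[OF null], safe)
      fix x assume "\<not> t (x n) (x (Suc n))"
      then show "x \<in> (\<Union>w\<in>?B. {x. map x [0..<length w] = w})"
        by (intro UN_I[of "map x [0..<Suc (Suc n)]"]) (auto simp: nth_append simp del: upt_Suc)
    qed
  qed
  then have AE: "AE x in N. x \<in> shift_space t" by (simp add: shift_space_def)
  then obtain x0 where x0: "x0 \<in> shift_space t"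
    using N.AE_contr by (metis (mono_tags, lifting) AE_mp AE_I2)
  \<comment> \<open>The identity almost everywhere; the null set of inadmissible sequences is sent
    to the admissible point \<open>x0\<close>, so that the image measure lives on the shift
    space.\<close>
  define f where "f x = (if x \<in> shift_space t then x else x0)" for x
  have shift_sets: "shift_space t \<in> sets N"
  proof -
    have "{x \<in> space N. \<forall>n. t (x n) (x (Suc n))} \<in> sets N"
    proof (rule sets.sets_Collect_countable_All)
      fix n
      have "{x \<in> space N. t (x n) (x (Suc n))} =
          (\<Union>w\<in>{w. length w = Suc (Suc n) \<and> t (w ! n) (w ! Suc n)}. {x. map x [0..<length w] = w})"
      proof safe
        fix x assume "t (x n) (x (Suc n))"
        then show "x \<in> (\<Union>w\<in>{w. length w = Suc (Suc n) \<and> t (w ! n) (w ! Suc n)}. {x. map x [0..<length w] = w})"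
          by (intro UN_I[of "map x [0..<Suc (Suc n)]"]) (auto simp: nth_append simp del: upt_Suc)
      next
        fix x w assume "length w = Suc (Suc n)" "t (w ! n) (w ! Suc n)" "map x [0..<length w] = w"
        then show "t (x n) (x (Suc n))" by (simp add: map_upt_eq_iff del: upt_Suc)
      qed (auto simp: sp)
      also have "\<dots> \<in> sets N"
      proof (rule sets.countable_UN')
        show "(\<lambda>w. {x. map x [0..<length w] = w}) ` {w. length w = Suc (Suc n) \<and> t (w ! n) (w ! Suc n)} \<subseteq> sets N"
          using pre by blast
      qed simp
      finally show "{x \<in> space N. t (x n) (x (Suc n))} \<in> sets N" .
    qed
    then show ?thesis by (simp add: sp shift_space_def)
  qed
  have vim: "f -` cylinder t w \<inter> space N \<in> sets N \<and> emeasure N (f -` cylinder t w \<inter> space N) = p w" for w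
  proof -
    have eq: "f -` cylinder t w \<inter> space N =
        ({x. map x [0..<length w] = w} \<inter> shift_space t) \<union> (if x0 \<in> cylinder t w then space N - shift_space t else {})"
      by (auto simp: f_def cylinder_iff_map sp x0 split: if_splits)
    have m: "f -` cylinder t w \<inter> space N \<in> sets N"
      unfolding eq using pre[of w] shift_sets by auto
    moreover have "emeasure N (f -` cylinder t w \<inter> space N) = emeasure N {x. map x [0..<length w] = w}"
    proof (rule emeasure_eq_AE[OF _ m pre])
      show "AE x in N. (x \<in> f -` cylinder t w \<inter> space N) = (x \<in> {x. map x [0..<length w] = w})"
        using AE by eventually_elim (simp add: f_def cylinder_iff_map sp)
    qed
    ultimately show ?thesis using N(3) by simp
  qed
  have fm: "f \<in> measurable N (borel_shift t)"
    using vim by (intro measurable_to_borel_shift) (auto simp: f_def x0)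
  define \<mu> where "\<mu> = distr N (borel_shift t) f"
  have \<mu>_cyl: "emeasure \<mu> (cylinder t w) = p w" for w
    unfolding \<mu>_def using vim fm by (subst emeasure_distr) auto
  have "\<mu> \<in> invariant_measures t"
  proof (rule invariant_measuresI)
    show "prob_space \<mu>" unfolding \<mu>_def by (rule N.prob_space_distr[OF fm])
    show "sets \<mu> = sets (borel_shift t)" by (simp add: \<mu>_def)
  qed (simp add: \<mu>_cyl left[symmetric])
  then show ?thesis using \<mu>_cyl by blast
qed

lemma nn_integral_count_space_swap:
  fixes f :: "'s::countable \<Rightarrow> 't::countable \<Rightarrow> ennreal"
  shows "(\<integral>\<^sup>+s. (\<integral>\<^sup>+t. f s t \<partial>count_space UNIV) \<partial>count_space UNIV) =
    (\<integral>\<^sup>+t. (\<integral>\<^sup>+s. f s t \<partial>count_space UNIV) \<partial>count_space UNIV)"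
proof -
  interpret pair_sigma_finite "count_space (UNIV :: 't set)" "count_space (UNIV :: 's set)"
    by (simp add: pair_sigma_finite_def sigma_finite_measure_count_space_countable)
  have "(\<lambda>(t, s). f s t) \<in> borel_measurable (count_space (UNIV :: 't set) \<Otimes>\<^sub>M count_space (UNIV :: 's set))"
    by (simp add: pair_measure_countable)
  from Fubini'[OF this] show ?thesis .
qed

lemma nn_integral_count_space_select:
  "(\<integral>\<^sup>+j. (if a = j then f j else 0) \<partial>count_space UNIV) = (f a :: ennreal)"
proof -
  have "(\<integral>\<^sup>+j. (if a = j then f j else 0) \<partial>count_space UNIV) = (\<integral>\<^sup>+j. f j * indicator {a} j \<partial>count_space UNIV)"
    by (intro nn_integral_cong) (auto simp: indicator_def)
  then show ?thesis by (simp add: nn_integral_indicator_singleton)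
qed

text \<open>A hidden Markov chain: \<open>G\<close> moves unnormalised row vectors of hidden states, \<open>u\<close> is the harmonic
  weight turning them into probabilities, \<open>v\<close> is stationary and \<open>lab\<close> is the observed letter.\<close>

locale hidden_markov =
  fixes G :: "'s::countable \<Rightarrow> 's \<Rightarrow> ennreal" and u v :: "'s \<Rightarrow> ennreal" and lab :: "'s \<Rightarrow> nat"
  assumes Gu: "(\<integral>\<^sup>+r. G s r * u r \<partial>count_space UNIV) = u s"
    and vG: "(\<integral>\<^sup>+s. v s * G s r \<partial>count_space UNIV) = v r"
    and vu: "(\<integral>\<^sup>+s. v s * u s \<partial>count_space UNIV) = 1"
begin

definition push :: "('s \<Rightarrow> ennreal) \<Rightarrow> 's \<Rightarrow> ennreal" where
  "push x r = (\<integral>\<^sup>+s. x s * G s r \<partial>count_space UNIV)"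

definition observe :: "nat \<Rightarrow> ('s \<Rightarrow> ennreal) \<Rightarrow> 's \<Rightarrow> ennreal" where
  "observe j x r = (if lab r = j then x r else 0)"

text \<open>The forward recursion for hidden Markov models: \<open>run v w\<close> is the
  unnormalised vector of hidden states after observing \<open>w\<close>.\<close>

definition run :: "('s \<Rightarrow> ennreal) \<Rightarrow> nat list \<Rightarrow> 's \<Rightarrow> ennreal" where
  "run = foldl (\<lambda>x j. observe j (push x))"

definition mass :: "('s \<Rightarrow> ennreal) \<Rightarrow> ennreal" where
  "mass x = (\<integral>\<^sup>+s. x s * u s \<partial>count_space UNIV)"

text \<open>\<open>run\<close> pushes before it observes the first letter; since
  \<open>push v = v\<close>, the first letter is nevertheless observed under \<open>v\<close>
  itself.\<close>

definition word_prob :: "nat list \<Rightarrow> ennreal" where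
  "word_prob w = mass (run v w)"

lemma run_simps[simp]: "run x [] = x" "run x (w @ [j]) = observe j (push (run x w))"
    "run x (j # w) = run (observe j (push x)) w"
  by (simp_all add: run_def)

lemma run_append: "run x (w @ z) = run (run x w) z"
  by (simp add: run_def)

lemma push_v[simp]: "push v = v"
  by (simp add: push_def vG fun_eq_iff)

lemma push_funpow_v[simp]: "(push ^^ n) v = v"
  by (induction n) auto

text \<open>Harmonicity of \<open>u\<close> is conservation of probability.\<close>

lemma mass_push: "mass (push x) = mass x"
proof -
  have "mass (push x) = (\<integral>\<^sup>+r. (\<integral>\<^sup>+s. x s * (G s r * u r) \<partial>count_space UNIV) \<partial>count_space UNIV)"
    unfolding mass_def push_def by (subst nn_integral_multc[symmetric]) (auto simp: mult.assoc)
  also have "\<dots> = (\<integral>\<^sup>+s. (\<integral>\<^sup>+r. x s * (G s r * u r) \<partial>count_space UNIV) \<partial>count_space UNIV)"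
    by (rule nn_integral_count_space_swap)
  also have "\<dots> = mass x" by (simp add: mass_def nn_integral_cmult Gu)
  finally show ?thesis .
qed

lemma push_nn_integral:
  fixes x :: "'i::countable \<Rightarrow> 's \<Rightarrow> ennreal"
  shows "push (\<lambda>s. \<integral>\<^sup>+i. x i s \<partial>count_space UNIV) = (\<lambda>r. \<integral>\<^sup>+i. push (x i) r \<partial>count_space UNIV)"
  unfolding push_def
  by (subst nn_integral_multc[symmetric]) (auto intro: nn_integral_count_space_swap)

lemma mass_nn_integral:
  fixes x :: "'i::countable \<Rightarrow> 's \<Rightarrow> ennreal"
  shows "mass (\<lambda>s. \<integral>\<^sup>+i. x i s \<partial>count_space UNIV) = (\<integral>\<^sup>+i. mass (x i) \<partial>count_space UNIV)"
  unfolding mass_def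
  by (subst nn_integral_multc[symmetric]) (auto intro: nn_integral_count_space_swap)

lemma push_funpow_nn_integral:
  fixes x :: "'i::countable \<Rightarrow> 's \<Rightarrow> ennreal"
  shows "(push ^^ n) (\<lambda>s. \<integral>\<^sup>+i. x i s \<partial>count_space UNIV) =
    (\<lambda>r. \<integral>\<^sup>+i. (push ^^ n) (x i) r \<partial>count_space UNIV)"
  by (induction n) (simp_all add: push_nn_integral)

lemma run_nn_integral:
  fixes x :: "'i::countable \<Rightarrow> 's \<Rightarrow> ennreal"
  shows "run (\<lambda>s. \<integral>\<^sup>+i. x i s \<partial>count_space UNIV) w = (\<lambda>r. \<integral>\<^sup>+i. run (x i) w r \<partial>count_space UNIV)"
proof (induction w rule: rev_induct)
  case (snoc j w)
  show ?case by (simp add: snoc push_nn_integral) (simp add: observe_def fun_eq_iff)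
qed simp

lemma sum_observe: "(\<lambda>r. \<integral>\<^sup>+j. observe j x r \<partial>count_space UNIV) = x"
  by (simp add: observe_def nn_integral_count_space_select fun_eq_iff)

lemma word_prob_right: "word_prob w = (\<integral>\<^sup>+j. word_prob (w @ [j]) \<partial>count_space UNIV)"
  unfolding word_prob_def
  by (simp add: mass_nn_integral[symmetric] sum_observe mass_push)

lemma word_prob_left: "word_prob w = (\<integral>\<^sup>+i. word_prob (i # w) \<partial>count_space UNIV)"
  unfolding word_prob_def
  by (simp add: mass_nn_integral[symmetric] run_nn_integral[symmetric] sum_observe)

lemma word_prob_Nil: "word_prob [] = 1"
  by (simp add: word_prob_def mass_def vu)

lemma word_prob_forbidden:
  assumes "\<And>s r. lab s = i \<Longrightarrow> lab r = j \<Longrightarrow> G s r = 0"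
  shows "word_prob [i, j] = 0"
proof -
  have "observe j (push (observe i v)) = (\<lambda>_. 0)"
    using assms by (auto simp: observe_def push_def fun_eq_iff nn_integral_0_iff_AE)
  then show ?thesis by (simp add: word_prob_def mass_def)
qed

theorem exists_invariant_measure:
  assumes "\<And>s r. \<not> t (lab s) (lab r) \<Longrightarrow> G s r = 0"
  shows "\<exists>\<mu>\<in>invariant_measures t. \<forall>w. emeasure \<mu> (cylinder t w) = word_prob w"
  using assms
  by (intro invariant_measure_from_words word_prob_Nil word_prob_right word_prob_left word_prob_forbidden) auto

text \<open>The \<open>n\<close> letters between the two words are summed out; summing over an
  observed letter undoes \<open>observe\<close> and leaves a bare \<open>push\<close>.\<close>

lemma emeasure_cylinder_shift:
  assumes \<mu>: "\<mu> \<in> invariant_measures t" "\<And>w. emeasure \<mu> (cylinder t w) = word_prob w"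
  shows "emeasure \<mu> (cylinder t w \<inter> (shift_map ^^ (length w + n)) -` cylinder t w') =
    mass (run ((push ^^ n) (run v w)) w')"
proof (induction n arbitrary: w)
  case 0
  have "cylinder t w \<inter> (shift_map ^^ length w) -` cylinder t w' = cylinder t (w @ w')"
  proof (intro equalityI subsetI)
    fix x assume "x \<in> cylinder t w \<inter> (shift_map ^^ length w) -` cylinder t w'"
    then have x: "x \<in> shift_space t" "\<And>j. j < length w \<Longrightarrow> x j = w ! j"
        "\<And>j. j < length w' \<Longrightarrow> x (length w + j) = w' ! j"
      by (auto simp: cylinder_def shift_map_funpow)
    have "x j = (w @ w') ! j" if "j < length (w @ w')" for j
      using x(2)[of j] x(3)[of "j - length w"] that by (cases "j < length w") (auto simp: nth_append)
    then show "x \<in> cylinder t (w @ w')" using x(1) by (simp add: cylinder_def)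
  next
    fix x assume "x \<in> cylinder t (w @ w')"
    then have x: "x \<in> shift_space t" "\<And>j. j < length w + length w' \<Longrightarrow> x j = (w @ w') ! j"
      by (auto simp: cylinder_def)
    then show "x \<in> cylinder t w \<inter> (shift_map ^^ length w) -` cylinder t w'"
      using shift_map_funpow_in[of x t "length w"] x(2)
      by (auto simp: cylinder_def shift_map_funpow nth_append)
  qed
  then show ?case using \<mu>(2) by (simp add: word_prob_def run_append)
next
  case (Suc n)
  have sets: "sets \<mu> = sets (borel_shift t)" using \<mu>(1) by (simp add: invariant_measures_def)
  have sets_n: "cylinder t z \<inter> (shift_map ^^ m) -` cylinder t w' \<in> sets (borel_shift t)" for z m
  proof -
    have "(shift_map ^^ m) -` cylinder t w' \<inter> space (borel_shift t) \<in> sets (borel_shift t)" by measurable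
    then have "cylinder t z \<inter> ((shift_map ^^ m) -` cylinder t w' \<inter> space (borel_shift t)) \<in> sets (borel_shift t)"
      by (rule sets.Int[OF sets_cylinder])
    moreover have "cylinder t z \<inter> ((shift_map ^^ m) -` cylinder t w' \<inter> space (borel_shift t)) =
        cylinder t z \<inter> (shift_map ^^ m) -` cylinder t w'"
      using cylinder_subset[of t z] by auto
    ultimately show ?thesis by simp
  qed
  let ?A = "\<lambda>j. cylinder t (w @ [j]) \<inter> (shift_map ^^ (length (w @ [j]) + n)) -` cylinder t w'"
  have cyl_UN: "cylinder t w = (\<Union>j. cylinder t (w @ [j]))"
  proof (intro equalityI subsetI)
    fix x assume "x \<in> cylinder t w"
    then have "x \<in> cylinder t (w @ [x (length w)])" by (auto simp: cylinder_def nth_append less_Suc_eq)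
    then show "x \<in> (\<Union>j. cylinder t (w @ [j]))" by blast
  qed (auto simp: cylinder_def nth_append)
  have "emeasure \<mu> (cylinder t w \<inter> (shift_map ^^ (length w + Suc n)) -` cylinder t w') = emeasure \<mu> (\<Union>j. ?A j)"
    by (subst cyl_UN, rule arg_cong[where f="emeasure \<mu>"]) (auto simp del: funpow.simps)
  also have "emeasure \<mu> (\<Union>j. ?A j) = (\<integral>\<^sup>+j. emeasure \<mu> (?A j) \<partial>count_space UNIV)"
  proof (rule emeasure_UN_countable)
    show "disjoint_family ?A"
      by (auto simp: disjoint_family_on_def cylinder_def nth_append simp del: funpow.simps)
    show "?A j \<in> sets \<mu>" for j unfolding sets by (rule sets_n)
  qed auto
  also have "\<dots> = (\<integral>\<^sup>+j. mass (run ((push ^^ n) (run v (w @ [j]))) w') \<partial>count_space UNIV)"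
    by (simp only: Suc)
  also have "\<dots> = mass (run ((push ^^ Suc n) (run v w)) w')"
    by (simp add: mass_nn_integral[symmetric] run_nn_integral[symmetric] push_funpow_nn_integral[symmetric]
      sum_observe funpow_swap1)
  finally show ?case .
qed

end


section \<open>Mixing\<close>

lemma invariant_measures_sets: "\<mu> \<in> invariant_measures t \<Longrightarrow> sets \<mu> = sets (borel_shift t)"
  by (simp add: invariant_measures_def)

lemma invariant_measures_space: "\<mu> \<in> invariant_measures t \<Longrightarrow> space \<mu> = shift_space t"
  using sets_eq_imp_space_eq[OF invariant_measures_sets] by simp

lemma invariant_measures_prob: "\<mu> \<in> invariant_measures t \<Longrightarrow> prob_space \<mu>"
  by (simp add: invariant_measures_def)

lemma invariant_funpow:
  assumes "\<mu> \<in> invariant_measures t" "E \<in> sets \<mu>"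
  shows "(shift_map ^^ n) -` E \<inter> space \<mu> \<in> sets \<mu> \<and> emeasure \<mu> ((shift_map ^^ n) -` E \<inter> space \<mu>) = emeasure \<mu> E"
proof (induction n)
  case 0
  have "E \<inter> space \<mu> = E" using sets.sets_into_space[OF assms(2)] by blast
  then show ?case using assms by simp
next
  case (Suc n)
  let ?E = "(shift_map ^^ n) -` E \<inter> space \<mu>"
  have "(shift_map ^^ Suc n) -` E \<inter> space \<mu> = shift_map -` ?E \<inter> space \<mu>"
    using invariant_measures_space[OF assms(1)] by (auto simp: funpow_swap1)
  moreover have "shift_map -` ?E \<inter> space \<mu> \<in> sets \<mu> \<and> emeasure \<mu> (shift_map -` ?E \<inter> space \<mu>) = emeasure \<mu> ?E"
    using assms(1) Suc unfolding invariant_measures_def by blast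
  ultimately show ?case using Suc by metis
qed

text \<open>Tannery's theorem, as dominated convergence for counting measure.\<close>

lemma suminf_dominated_tendsto:
  fixes f :: "nat \<Rightarrow> nat \<Rightarrow> real"
  assumes lim: "\<And>i. (\<lambda>n. f n i) \<longlonglongrightarrow> g i" and bd: "\<And>n i. \<bar>f n i\<bar> \<le> b i" and b: "summable b"
  shows "(\<lambda>n. \<Sum>i. f n i) \<longlonglongrightarrow> (\<Sum>i. g i)"
proof -
  have b_int: "integrable (count_space UNIV) b"
  proof -
    have "0 \<le> b i" for i using bd[of 0 i] by linarith
    then show ?thesis using b by (simp add: integrable_count_space_nat_iff)
  qed
  have int: "integrable (count_space UNIV) (f n)" for n
    by (rule Bochner_Integration.integrable_bound[OF b_int]) (auto intro!: AE_I2 order_trans[OF bd])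
  have g_bd: "\<bar>g i\<bar> \<le> b i" for i
    by (rule LIMSEQ_le_const2[OF tendsto_rabs[OF lim]]) (use bd in auto)
  have intg: "integrable (count_space UNIV) g"
    by (rule Bochner_Integration.integrable_bound[OF b_int]) (auto intro!: AE_I2 order_trans[OF g_bd])
  have "(\<lambda>n. integral\<^sup>L (count_space UNIV) (f n)) \<longlonglongrightarrow> integral\<^sup>L (count_space UNIV) g"
    by (rule integral_dominated_convergence[OF _ _ b_int]) (use lim bd in auto)
  moreover have "integral\<^sup>L (count_space UNIV) (f n) = (\<Sum>i. f n i)" for n
    by (rule sums_unique[OF sums_integral_count_space_nat[OF int]])
  moreover have "integral\<^sup>L (count_space UNIV) g = (\<Sum>i. g i)"
    by (rule sums_unique[OF sums_integral_count_space_nat[OF intg]])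
  ultimately show ?thesis by simp
qed

text \<open>Two Dynkin-class arguments, first for the second set, then for the first. Disjoint
  unions need a summable bound uniform in \<open>n\<close>, which is
  \<open>measure \<mu> (X i)\<close> both times: by invariance for the shifted set, by monotonicity
  for the other.\<close>

theorem mixing_from_cylinders:
  assumes \<mu>: "\<mu> \<in> invariant_measures t"
    and cyl: "\<And>w w'. (\<lambda>n. measure \<mu> (cylinder t w \<inter> (shift_map ^^ n) -` cylinder t w'))
      \<longlonglongrightarrow> measure \<mu> (cylinder t w) * measure \<mu> (cylinder t w')"
  shows "mixing \<mu> shift_map"
proof -
  interpret prob_space \<mu> using invariant_measures_prob[OF \<mu>] .
  note sets_eq = invariant_measures_sets[OF \<mu>]
  note sp = invariant_measures_space[OF \<mu>]
  let ?G = "insert {} (range (cylinder t))"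
  have GPow: "?G \<subseteq> Pow (shift_space t)" using cylinder_subset by fast
  have sig: "X \<in> sigma_sets (shift_space t) ?G \<longleftrightarrow> X \<in> sets \<mu>" for X
    unfolding sets_eq sets_borel_shift' ..
  define m where "m n E F = measure \<mu> (E \<inter> (shift_map ^^ n) -` F)" for n E F
  have ms: "E \<inter> (shift_map ^^ n) -` F \<in> sets \<mu>" if "E \<in> sets \<mu>" "F \<in> sets \<mu>" for n E F
  proof -
    have "E \<inter> (shift_map ^^ n) -` F = E \<inter> ((shift_map ^^ n) -` F \<inter> space \<mu>)"
      using sets.sets_into_space[OF that(1)] by auto
    then show ?thesis using invariant_funpow[OF \<mu> that(2), of n] that(1) by auto
  qed
  have m_nonneg: "0 \<le> m n E F" for n E F by (simp add: m_def)
  have mE: "m n E F \<le> measure \<mu> E" if "E \<in> sets \<mu>" for n E F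
    unfolding m_def using that by (intro finite_measure_mono) auto
  have mF: "m n E F \<le> measure \<mu> F" if "E \<in> sets \<mu>" "F \<in> sets \<mu>" for n E F
  proof -
    have "m n E F \<le> measure \<mu> ((shift_map ^^ n) -` F \<inter> space \<mu>)"
      unfolding m_def using that invariant_funpow[OF \<mu> that(2), of n] sets.sets_into_space[OF that(1)]
      by (intro finite_measure_mono) auto
    also have "\<dots> = measure \<mu> F" using invariant_funpow[OF \<mu> that(2), of n] by (simp add: measure_def)
    finally show ?thesis .
  qed
  have meas_sums: "summable (\<lambda>i. measure \<mu> (X i)) \<and> measure \<mu> (\<Union>i. X i) = (\<Sum>i. measure \<mu> (X i))"
    if "disjoint_family X" "range X \<subseteq> sets \<mu>" for X :: "nat \<Rightarrow> _"
    using finite_measure_UNION[OF that(2,1)] by (simp add: sums_iff)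
  have step1: "(\<lambda>n. m n (cylinder t w) F) \<longlonglongrightarrow> measure \<mu> (cylinder t w) * measure \<mu> F" if "F \<in> sets \<mu>" for w F
  proof (rule sigma_sets_induct_disjoint[OF Int_stable_cylinders GPow that[folded sig]])
    have Cw: "cylinder t w \<in> sets \<mu>" by (simp add: sets_eq)
    show "(\<lambda>n. m n (cylinder t w) {}) \<longlonglongrightarrow> measure \<mu> (cylinder t w) * measure \<mu> {}"
      by (simp add: m_def)
    then show "(\<lambda>n. m n (cylinder t w) F) \<longlonglongrightarrow> measure \<mu> (cylinder t w) * measure \<mu> F" if "F \<in> ?G" for F
      using that cyl unfolding m_def by blast
    fix F assume F: "F \<in> sigma_sets (shift_space t) ?G"
      "(\<lambda>n. m n (cylinder t w) F) \<longlonglongrightarrow> measure \<mu> (cylinder t w) * measure \<mu> F"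
    have "m n (cylinder t w) (shift_space t - F) = measure \<mu> (cylinder t w) - m n (cylinder t w) F" for n
    proof -
      have "cylinder t w \<inter> (shift_map ^^ n) -` (shift_space t - F) =
          cylinder t w - (cylinder t w \<inter> (shift_map ^^ n) -` F)"
        using cylinder_subset[of t w] shift_map_funpow_in by blast
      then show ?thesis unfolding m_def using Cw ms[OF Cw F(1)[unfolded sig]]
        by (simp add: finite_measure_Diff)
    qed
    moreover have "measure \<mu> (shift_space t - F) = 1 - measure \<mu> F"
      using prob_compl[OF F(1)[unfolded sig]] by (simp add: sp)
    moreover have "(\<lambda>n. measure \<mu> (cylinder t w) - m n (cylinder t w) F)
        \<longlonglongrightarrow> measure \<mu> (cylinder t w) - measure \<mu> (cylinder t w) * measure \<mu> F"
      by (intro tendsto_diff tendsto_const F)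
    ultimately show "(\<lambda>n. m n (cylinder t w) (shift_space t - F)) \<longlonglongrightarrow> measure \<mu> (cylinder t w) * measure \<mu> (shift_space t - F)"
      by (simp add: right_diff_distrib)
  next
    fix X :: "nat \<Rightarrow> _" assume X: "disjoint_family X" "range X \<subseteq> sigma_sets (shift_space t) ?G"
      "\<And>i. (\<lambda>n. m n (cylinder t w) (X i)) \<longlonglongrightarrow> measure \<mu> (cylinder t w) * measure \<mu> (X i)"
    have Cw: "cylinder t w \<in> sets \<mu>" by (simp add: sets_eq)
    have Xs: "range X \<subseteq> sets \<mu>" using X(2) sig by auto
    note XS = meas_sums[OF X(1) Xs]
    have eq: "m n (cylinder t w) (\<Union>i. X i) = (\<Sum>i. m n (cylinder t w) (X i))" for n
    proof -
      have "disjoint_family (\<lambda>i. cylinder t w \<inter> (shift_map ^^ n) -` X i)"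
        using X(1) unfolding disjoint_family_on_def by blast
      from conjunct2[OF meas_sums[OF this]] ms[OF Cw] Xs show ?thesis
        unfolding m_def by (simp add: vimage_UN image_subset_iff)
    qed
    have "(\<lambda>n. \<Sum>i. m n (cylinder t w) (X i)) \<longlonglongrightarrow> (\<Sum>i. measure \<mu> (cylinder t w) * measure \<mu> (X i))"
    proof (rule suminf_dominated_tendsto[where b="\<lambda>i. measure \<mu> (X i)"])
      show "\<bar>m n (cylinder t w) (X i)\<bar> \<le> measure \<mu> (X i)" for n i
        using mF[OF Cw, of "X i" n] Xs m_nonneg by (auto simp: image_subset_iff)
    qed (use X XS in auto)
    then show "(\<lambda>n. m n (cylinder t w) (\<Union>i. X i)) \<longlonglongrightarrow> measure \<mu> (cylinder t w) * measure \<mu> (\<Union>i. X i)"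
      unfolding eq using XS by (simp add: suminf_mult)
  qed
  have step2: "(\<lambda>n. m n E F) \<longlonglongrightarrow> measure \<mu> E * measure \<mu> F" if "E \<in> sets \<mu>" and F: "F \<in> sets \<mu>" for E F
  proof (rule sigma_sets_induct_disjoint[OF Int_stable_cylinders GPow that(1)[folded sig]])
    show "(\<lambda>n. m n {} F) \<longlonglongrightarrow> measure \<mu> {} * measure \<mu> F"
      by (simp add: m_def)
    then show "(\<lambda>n. m n E F) \<longlonglongrightarrow> measure \<mu> E * measure \<mu> F" if "E \<in> ?G" for E
      using that step1[OF F] by blast
    fix E assume E: "E \<in> sigma_sets (shift_space t) ?G" "(\<lambda>n. m n E F) \<longlonglongrightarrow> measure \<mu> E * measure \<mu> F"
    have "m n (shift_space t - E) F = measure \<mu> F - m n E F" for n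
    proof -
      have "(shift_space t - E) \<inter> (shift_map ^^ n) -` F =
          ((shift_map ^^ n) -` F \<inter> space \<mu>) - (E \<inter> (shift_map ^^ n) -` F)"
        by (auto simp: sp)
      moreover have "E \<inter> (shift_map ^^ n) -` F \<subseteq> (shift_map ^^ n) -` F \<inter> space \<mu>"
        using sets.sets_into_space[OF E(1)[unfolded sig]] by auto
      moreover have "measure \<mu> ((shift_map ^^ n) -` F \<inter> space \<mu>) = measure \<mu> F"
        using invariant_funpow[OF \<mu> F, of n] by (simp add: measure_def)
      ultimately show ?thesis unfolding m_def using ms[OF E(1)[unfolded sig] F] invariant_funpow[OF \<mu> F, of n]
        by (simp add: finite_measure_Diff)
    qed
    moreover have "measure \<mu> (shift_space t - E) = 1 - measure \<mu> E"
      using prob_compl[OF E(1)[unfolded sig]] by (simp add: sp)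
    moreover have "(\<lambda>n. measure \<mu> F - m n E F) \<longlonglongrightarrow> measure \<mu> F - measure \<mu> E * measure \<mu> F"
      by (intro tendsto_diff tendsto_const E)
    ultimately show "(\<lambda>n. m n (shift_space t - E) F) \<longlonglongrightarrow> measure \<mu> (shift_space t - E) * measure \<mu> F"
      by (simp add: left_diff_distrib)
  next
    fix X :: "nat \<Rightarrow> _" assume X: "disjoint_family X" "range X \<subseteq> sigma_sets (shift_space t) ?G"
      "\<And>i. (\<lambda>n. m n (X i) F) \<longlonglongrightarrow> measure \<mu> (X i) * measure \<mu> F"
    have Xs: "range X \<subseteq> sets \<mu>" using X(2) sig by auto
    note XS = meas_sums[OF X(1) Xs]
    have eq: "m n (\<Union>i. X i) F = (\<Sum>i. m n (X i) F)" for n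
    proof -
      have "disjoint_family (\<lambda>i. X i \<inter> (shift_map ^^ n) -` F)"
        using X(1) unfolding disjoint_family_on_def by blast
      from conjunct2[OF meas_sums[OF this]] ms[OF _ F] Xs show ?thesis
        unfolding m_def by (simp add: image_subset_iff)
    qed
    have "(\<lambda>n. \<Sum>i. m n (X i) F) \<longlonglongrightarrow> (\<Sum>i. measure \<mu> (X i) * measure \<mu> F)"
    proof (rule suminf_dominated_tendsto[where b="\<lambda>i. measure \<mu> (X i)"])
      show "\<bar>m n (X i) F\<bar> \<le> measure \<mu> (X i)" for n i
        using mE[of "X i" n F] Xs m_nonneg by (auto simp: image_subset_iff)
    qed (use X XS in auto)
    then show "(\<lambda>n. m n (\<Union>i. X i) F) \<longlonglongrightarrow> measure \<mu> (\<Union>i. X i) * measure \<mu> F"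
      unfolding eq using XS by (simp add: suminf_mult2)
  qed
  show ?thesis unfolding mixing_def using step2 unfolding m_def by blast
qed

section \<open>Exponential loss of memory under a Doeblin condition\<close>

context hidden_markov
begin

lemma push_add: "push (\<lambda>s. x s + y s) = (\<lambda>r. push x r + push y r)"
  by (simp add: push_def distrib_right nn_integral_add fun_eq_iff)

lemma push_cmult: "push (\<lambda>s. c * x s) = (\<lambda>r. c * push x r)"
  by (simp add: push_def mult.assoc nn_integral_cmult fun_eq_iff)

lemma push_funpow_add: "(push ^^ n) (\<lambda>s. x s + y s) = (\<lambda>r. (push ^^ n) x r + (push ^^ n) y r)"
  by (induction n) (simp_all add: push_add)

lemma push_funpow_cmult: "(push ^^ n) (\<lambda>s. c * x s) = (\<lambda>r. c * (push ^^ n) x r)"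
  by (induction n) (simp_all add: push_cmult)

lemma run_add: "run (\<lambda>s. x s + y s) w = (\<lambda>r. run x w r + run y w r)"
proof (induction w rule: rev_induct)
  case (snoc j w)
  show ?case by (simp add: snoc push_add) (simp add: observe_def fun_eq_iff)
qed simp

lemma run_cmult: "run (\<lambda>s. c * x s) w = (\<lambda>r. c * run x w r)"
proof (induction w rule: rev_induct)
  case (snoc j w)
  show ?case by (simp add: snoc push_cmult) (simp add: observe_def fun_eq_iff)
qed simp

lemma mass_add: "mass (\<lambda>s. x s + y s) = mass x + mass y"
  by (simp add: mass_def distrib_right nn_integral_add)

lemma mass_cmult: "mass (\<lambda>s. c * x s) = c * mass x"
  by (simp add: mass_def mult.assoc nn_integral_cmult)

lemma mass_funpow: "mass ((push ^^ n) x) = mass x"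
  by (induction n) (simp_all add: mass_push)

lemma mass_run_le: "mass (run x w) \<le> mass x"
proof (induction w rule: rev_induct)
  case (snoc j w)
  have "mass (observe j (push (run x w))) \<le> mass (push (run x w))"
    unfolding mass_def by (intro nn_integral_mono) (auto simp: observe_def)
  with snoc show ?case by (simp add: mass_push)
qed simp

text \<open>Both \<open>(push ^^ m) x\<close> and \<open>(push ^^ m) y\<close> contain the common part \<open>d * mass x * e\<close>, so only remainders
  of mass \<open>(1 - d) * mass x\<close> still have to be compared.\<close>

lemma doeblin_contraction:
  assumes doeblin: "\<And>x s. d * mass x * e s \<le> (push ^^ m) x s"
    and e: "mass e = 1" and d: "d \<le> 1"
  assumes "mass x = mass y" "mass x < top"
  shows "mass (run ((push ^^ (m * k + j)) x) w) \<le> mass (run ((push ^^ (m * k + j)) y) w) + (1 - d) ^ k * mass x"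
  using assms(4,5)
proof (induction k arbitrary: x y)
  case 0
  have "mass (run ((push ^^ j) x) w) \<le> mass x"
    using mass_run_le[of "(push ^^ j) x" w] by (simp add: mass_funpow)
  then show ?case by (simp add: add_increasing)
next
  case (Suc k)
  \<comment> \<open>The minorisation makes this truncated subtraction in \<open>ennreal\<close>
    exact; finiteness of the masses will allow cancellation.\<close>
  define rest where "rest x s = (push ^^ m) x s - d * mass x * e s" for x s
  define q where "q x = mass (run ((push ^^ (m * k + j)) x) w)" for x
  have split: "(push ^^ m) x = (\<lambda>s. (d * mass x) * e s + rest x s)" for x
    using doeblin unfolding rest_def by (auto simp: fun_eq_iff add_diff_inverse_ennreal)
  have q_split: "mass (run ((push ^^ (m * Suc k + j)) x) w) = (d * mass x) * q e + q (rest x)" for x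
  proof -
    have "m * Suc k + j = (m * k + j) + m" by simp
    then have "(push ^^ (m * Suc k + j)) x = (push ^^ (m * k + j)) ((push ^^ m) x)"
      by (simp only: funpow_add comp_def)
    then have "mass (run ((push ^^ (m * Suc k + j)) x) w) = q (\<lambda>s. (d * mass x) * e s + rest x s)"
      unfolding q_def by (simp only: split)
    also have "\<dots> = (d * mass x) * q e + q (rest x)"
      by (simp only: q_def push_funpow_add run_add mass_add push_funpow_cmult run_cmult mass_cmult)
    finally show ?thesis .
  qed
  have mass_rest: "mass (rest x) = (1 - d) * mass x" if "mass x < top" for x
  proof -
    have "mass x = d * mass x + mass (rest x)"
      using arg_cong[OF split, of mass x] by (simp add: mass_funpow mass_add mass_cmult e)
    moreover have "mass x = d * mass x + (1 - d) * mass x"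
      using d by (simp add: distrib_right[symmetric] add_diff_inverse_ennreal)
    moreover have "d * mass x \<noteq> top"
      using that d by (metis ennreal_mult_less_top ennreal_one_less_top le_less_trans less_irrefl)
    ultimately show ?thesis by (metis ennreal_add_left_cancel infinity_ennreal_def)
  qed
  have fin: "mass (rest x) < top" using mass_rest[OF Suc.prems(2)] Suc.prems(2)
    by (metis diff_le_self_ennreal ennreal_mult_less_top ennreal_one_less_top le_less_trans)
  have eq: "mass (rest x) = mass (rest y)" using mass_rest Suc.prems by simp
  have "q (rest x) \<le> q (rest y) + (1 - d) ^ k * ((1 - d) * mass x)"
    using Suc.IH[OF eq fin] mass_rest[OF Suc.prems(2)] by (simp add: q_def)
  then show ?case
    unfolding q_split using Suc.prems(1) by (simp add: add.assoc add_left_mono mult_ac)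
qed

text \<open>The vector after observing \<open>w\<close> is compared with the stationary vector of
  equal mass. Their futures differ by at most \<open>(1 - d) ^ (n div m)\<close> times that mass,
  which is decorrelation of cylinders.\<close>

theorem mixing_from_doeblin:
  assumes \<mu>: "\<mu> \<in> invariant_measures t" "\<And>w. emeasure \<mu> (cylinder t w) = word_prob w"
    and doeblin: "\<And>x. \<delta> * mass x \<le> (push ^^ m) x r0"
    and u: "u r0 \<noteq> 0" "u r0 \<noteq> top" and \<delta>: "0 < \<delta>" and m: "0 < m"
  shows "mixing \<mu> shift_map"
proof (rule mixing_from_cylinders[OF \<mu>(1)])
  fix w w'
  interpret prob_space \<mu> by (rule invariant_measures_prob[OF \<mu>(1)])
  \<comment> \<open>Concentrated at \<open>r0\<close> and scaled by \<open>1 / u r0\<close> to have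
    \<open>mass\<close> one; this is why \<open>\<delta>\<close> becomes
    \<open>d = \<delta> * u r0\<close> below.\<close>
  define e where "e s = (if r0 = s then 1 / u r0 else 0)" for s
  have e1: "mass e = 1"
  proof -
    have "mass e = (\<integral>\<^sup>+s. (if r0 = s then 1 / u r0 * u s else 0) \<partial>count_space UNIV)"
      unfolding mass_def e_def by (intro nn_integral_cong) auto
    also have "\<dots> = 1 / u r0 * u r0" by (rule nn_integral_count_space_select)
    finally show ?thesis using u by (simp add: ennreal_divide_times ennreal_divide_self less_top)
  qed
  define d where "d = \<delta> * u r0"
  have dm: "d * mass x * e s \<le> (push ^^ m) x s" for x s
  proof (cases "r0 = s")
    case True
    have "d * mass x * e s = \<delta> * mass x * (u r0 * (1 / u r0))" using True by (simp add: d_def e_def mult_ac)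
    also have "u r0 * (1 / u r0) = 1" using u by (simp add: ennreal_times_divide ennreal_divide_self less_top)
    finally show ?thesis using doeblin[of x] True by simp
  qed (simp add: e_def)
  have mv: "mass v = 1" by (simp add: mass_def vu)
  \<comment> \<open>The minorised part cannot exceed the whole; apply the minorisation to
    \<open>v\<close>, which has mass one.\<close>
  have d1: "d \<le> 1"
  proof -
    have "d * mass e = mass (\<lambda>s. d * e s)" by (simp add: mass_cmult)
    also have "\<dots> \<le> mass ((push ^^ m) v)"
      unfolding mass_def using dm[of v] mv by (intro nn_integral_mono mult_right_mono) auto
    finally show ?thesis by (simp add: mv e1)
  qed
  have d0: "0 < d" using \<delta> u by (simp add: d_def zero_less_iff_neq_zero)
  define c where "c = enn2real (1 - d)"
  have c: "1 - d = ennreal c" "0 \<le> c" "c < 1"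
  proof -
    have "1 - d \<le> 1" by simp
    then have "1 - d < top" using ennreal_one_less_top le_less_trans by blast
    then show eq: "1 - d = ennreal c" by (simp add: c_def)
    show "0 \<le> c" by (simp add: c_def)
    have "1 - d < 1" using d0 d1 by (intro ennreal_between) auto
    then show "c < 1" using eq by (metis ennreal_1 ennreal_less_iff \<open>0 \<le> c\<close>)
  qed
  define x where "x = run v w"
  define M where "M = enn2real (mass x)"
  have x_le: "mass x \<le> 1" using mass_run_le[of v w] mv by (simp add: x_def)
  then have x_fin: "mass x < top" using ennreal_one_less_top le_less_trans by blast
  then have M: "mass x = ennreal M" "0 \<le> M" by (simp_all add: M_def)
  have py: "word_prob w' = ennreal (measure \<mu> (cylinder t w'))" by (simp add: \<mu>(2)[symmetric] emeasure_eq_measure)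
  have px: "M = measure \<mu> (cylinder t w)" using \<mu>(2)[of w] by (simp add: M_def x_def word_prob_def[symmetric] measure_def)
  define q where "q n = measure \<mu> (cylinder t w \<inter> (shift_map ^^ (n + length w)) -` cylinder t w')" for n
  have q: "mass (run ((push ^^ n) x) w') = ennreal (q n)" for n
    using emeasure_cylinder_shift[OF \<mu>, of w n w'] by (simp add: q_def x_def emeasure_eq_measure add.commute)
  \<comment> \<open>The stationary vector with the mass of \<open>x\<close>: its predictions do not
    change with time, and they factor into the product of the two cylinder measures.\<close>
  define y where "y = (\<lambda>s. mass x * v s)"
  have my: "mass y = mass x" by (simp add: y_def mass_cmult mv)
  have y: "mass (run ((push ^^ n) y) w') = ennreal (M * measure \<mu> (cylinder t w'))" for n
    unfolding y_def by (simp add: push_funpow_cmult run_cmult mass_cmult word_prob_def[symmetric] py M ennreal_mult)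
  have bound: "\<bar>q n - M * measure \<mu> (cylinder t w')\<bar> \<le> c ^ (n div m) * M" for n
  proof -
    have pc: "(1 - d) ^ (n div m) * mass x = ennreal (c ^ (n div m) * M)"
      using c M by (simp add: ennreal_power ennreal_mult)
    have nn: "0 \<le> c ^ (n div m) * M" "0 \<le> M * measure \<mu> (cylinder t w')" "0 \<le> q n"
      using c M by (simp_all add: q_def)
    have A: "ennreal (q n) \<le> ennreal (M * measure \<mu> (cylinder t w')) + ennreal (c ^ (n div m) * M)"
      using doeblin_contraction[OF dm e1 d1 my[symmetric] x_fin, of "n div m" "n mod m" w'] unfolding pc by (simp add: q y)
    have B: "ennreal (M * measure \<mu> (cylinder t w')) \<le> ennreal (q n) + ennreal (c ^ (n div m) * M)"
      using doeblin_contraction[OF dm e1 d1 my x_fin[folded my], of "n div m" "n mod m" w'] unfolding my pc by (simp add: q y)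
    show ?thesis using A B nn by (auto simp: ennreal_plus[symmetric] abs_le_iff simp del: ennreal_plus)
  qed
  have "filterlim (\<lambda>n. n div m) at_top sequentially"
    using m by (intro filterlim_at_top_div_const_nat)
  then have "(\<lambda>n. c ^ (n div m)) \<longlonglongrightarrow> 0"
    by (rule filterlim_compose[rotated]) (use c in \<open>auto intro: LIMSEQ_realpow_zero\<close>)
  then have "(\<lambda>n. c ^ (n div m) * M) \<longlonglongrightarrow> 0" using tendsto_mult_left_zero by blast
  then have "(\<lambda>n. q n - M * measure \<mu> (cylinder t w')) \<longlonglongrightarrow> 0"
  proof (rule Lim_null_comparison[rotated])
    show "\<forall>\<^sub>F n in sequentially. norm (q n - M * measure \<mu> (cylinder t w')) \<le> c ^ (n div m) * M"
      using bound by simp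
  qed
  then have "q \<longlonglongrightarrow> M * measure \<mu> (cylinder t w')" by (simp add: LIM_zero_iff)
  then show "(\<lambda>n. measure \<mu> (cylinder t w \<inter> (shift_map ^^ n) -` cylinder t w'))
      \<longlonglongrightarrow> measure \<mu> (cylinder t w) * measure \<mu> (cylinder t w')"
    unfolding px q_def by (rule LIMSEQ_offset)
qed

lemma push_funpow_path: "(\<Prod>i<n. G (s i) (s (Suc i))) * x (s 0) \<le> (push ^^ n) x (s n)"
proof (induction n)
  case (Suc n)
  have "(\<Prod>i<n. G (s i) (s (Suc i))) * x (s 0) * G (s n) (s (Suc n)) \<le> (push ^^ n) x (s n) * G (s n) (s (Suc n))"
    using Suc by (rule mult_right_mono) simp
  also have "\<dots> \<le> push ((push ^^ n) x) (s (Suc n))"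
    unfolding push_def by (rule nn_integral_ge_point) simp
  finally show ?case by (simp add: mult_ac)
qed simp

end


section \<open>The matrix-valued transfer operator\<close>

lemma mat_norm_sum: "mat_norm M = (\<Sum>i\<in>UNIV. \<Sum>j\<in>UNIV. M $ i $ j)"
  by (simp add: mat_norm_def Let_def inner_vec_def matrix_vector_mult_def)

lemma mat_potential_sum: "mat_potential A n x = (\<Sum>k\<in>UNIV. (matrix_product A x n *v 1) $ k)"
  by (simp add: mat_potential_def mat_norm_sum matrix_vector_mult_def)

lemma matrix_product_Suc_vec: "matrix_product A x (Suc n) *v y = A (x n) *v (matrix_product A x n *v y)"
  by (simp add: matrix_vector_mul_assoc)

lemma integral_ge_sum:
  fixes f :: "'s::countable \<Rightarrow> real"
  assumes "finite X" "\<And>x. 0 \<le> f x" "integrable (count_space UNIV) f"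
  shows "sum f X \<le> integral\<^sup>L (count_space UNIV) f"
proof -
  have "(\<integral>x. f x * indicator X x \<partial>count_space UNIV) \<le> integral\<^sup>L (count_space UNIV) f"
  proof (rule integral_mono)
    show "integrable (count_space UNIV) (\<lambda>x. f x * indicator X x)"
      by (rule integrable_count_space_bound[OF assms(3), of _ 1]) (auto simp: indicator_def assms(2))
  qed (use assms in \<open>auto simp: indicator_def\<close>)
  moreover have "(\<integral>x. f x * indicator X x \<partial>count_space UNIV) = (\<Sum>x | x \<in> UNIV \<and> f x * indicator X x \<noteq> 0. f x * indicator X x)"
    by (rule lebesgue_integral_count_space_finite_support)
      (rule finite_subset[OF _ assms(1)], auto simp: indicator_def split: if_splits)
  moreover have "\<dots> = sum f X"
    by (rule sum.mono_neutral_cong_left) (use assms in \<open>auto simp: indicator_def\<close>)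
  ultimately show ?thesis by simp
qed

lemma integral_pos_witness:
  fixes f :: "'s::countable \<Rightarrow> real"
  assumes "integral\<^sup>L (count_space UNIV) f \<noteq> 0" shows "\<exists>s. f s \<noteq> 0"
proof (rule ccontr)
  assume "\<not> ?thesis"
  then have "f = (\<lambda>_. 0)" by auto
  with assms show False by simp
qed

lemma sum_row: "sum f ({i} \<times> UNIV) = (\<Sum>k\<in>UNIV. f (i, k))"
proof -
  have "{i} \<times> UNIV = Pair i ` UNIV" by auto
  then have "sum f ({i} \<times> UNIV) = sum f (Pair i ` UNIV)" by (rule arg_cong)
  also have "\<dots> = (\<Sum>k\<in>UNIV. f (i, k))" by (subst sum.reindex) (auto simp: inj_on_def)
  finally show ?thesis .
qed

lemma nn_integral_row:
  fixes f :: "nat \<times> 'd::finite \<Rightarrow> ennreal"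
  assumes "\<And>s. fst s \<noteq> i \<Longrightarrow> f s = 0"
  shows "(\<integral>\<^sup>+s. f s \<partial>count_space UNIV) = (\<Sum>k\<in>UNIV. f (i, k))"
proof -
  have "(\<integral>\<^sup>+s. f s \<partial>count_space UNIV) = sum f ({i} \<times> UNIV)"
    by (rule nn_integral_count_space') (use assms in force)+
  also have "\<dots> = (\<Sum>k\<in>UNIV. f (i, k))"
    by (rule sum_row)
  finally show ?thesis .
qed

text \<open>Serves two cases: \<open>F = UNIV\<close> with the BIP set as \<open>B\<close>, and a
  finite irreducible alphabet with \<open>B = F\<close>.\<close>

locale matrix_subsystem =
  fixes t :: "nat \<Rightarrow> nat \<Rightarrow> bool" and A :: "nat \<Rightarrow> real ^ 'd ^ 'd" and F B :: "nat set"
  assumes A_pos: "0 < A k $ i $ j"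
    and A_summable: "summable (\<lambda>i. mat_norm (A i))"
    and B_fin: "finite B" and B_sub: "B \<subseteq> F" and F_ne: "F \<noteq> {}"
    and B_pre: "a \<in> F \<Longrightarrow> \<exists>b\<in>B. t b a" and B_post: "a \<in> F \<Longrightarrow> \<exists>b\<in>B. t a b"
    and irr: "a \<in> F \<Longrightarrow> b \<in> F \<Longrightarrow> (a, b) \<in> {(i, j). i \<in> F \<and> j \<in> F \<and> t i j}\<^sup>+"
begin

text \<open>The matrix indices are swapped against those of the kernel: moving a row vector over
  states by \<open>ker\<close> multiplies the column vector of its coordinates by the matrix of the
  new letter.\<close>

definition ker :: "nat \<times> 'd \<Rightarrow> nat \<times> 'd \<Rightarrow> real" where
  "ker s r = (if fst s \<in> F \<and> fst r \<in> F \<and> t (fst s) (fst r) then A (fst r) $ snd r $ snd s else 0)"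

definition bnd :: "nat \<times> 'd \<Rightarrow> real" where
  "bnd r = (if fst r \<in> F then mat_norm (A (fst r)) else 0)"

text \<open>An entry of the matrix applied to the all-ones vector. It is sharper than
  \<open>bnd\<close>, and \<open>v\<close> turns out to be comparable to it from both sides on
  \<open>F\<close>.\<close>

definition rowsum :: "nat \<times> 'd \<Rightarrow> real" where
  "rowsum r = (\<Sum>k\<in>UNIV. A (fst r) $ snd r $ k)"

lemma rowsum_pos: "0 < rowsum r"
  unfolding rowsum_def by (rule sum_pos) (auto simp: A_pos)

lemma entry_le_rowsum: "A (fst r) $ snd r $ k \<le> rowsum r"
  unfolding rowsum_def by (rule member_le_sum) (auto simp: A_pos less_imp_le)

lemma rowsum_le_norm: "rowsum r \<le> mat_norm (A (fst r))"
  unfolding rowsum_def mat_norm_sum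
  by (rule member_le_sum[of "snd r" UNIV "\<lambda>i. \<Sum>k\<in>UNIV. A (fst r) $ i $ k"]) (auto intro: sum_nonneg simp: A_pos less_imp_le)

lemma mat_norm_nonneg: "0 \<le> mat_norm (A k)"
  unfolding mat_norm_sum by (intro sum_nonneg) (auto simp: A_pos less_imp_le)

lemma ker_nonneg: "0 \<le> ker s r"
  by (simp add: ker_def A_pos less_imp_le)

lemma ker_le_rowsum: "ker s r \<le> rowsum r"
  using entry_le_rowsum[of r "snd s"] rowsum_pos[of r] by (auto simp: ker_def less_imp_le)

lemma ker_le_bnd: "ker s r \<le> bnd r"
  using entry_le_rowsum[of r "snd s"] rowsum_le_norm[of r] mat_norm_nonneg[of "fst r"] by (auto simp: ker_def bnd_def)

lemma bnd_int: "integrable (count_space UNIV) bnd"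
proof -
  have "Infinite_Set_Sum.abs_summable_on (\<lambda>(x, y). mat_norm (A x) * (\<lambda>_::'d. 1 :: real) y) (UNIV \<times> UNIV)"
    by (rule abs_summable_on_product)
      (use A_summable mat_norm_nonneg in \<open>auto simp: abs_summable_on_def integrable_count_space_nat_iff integrable_count_space\<close>)
  then have "integrable (count_space UNIV) (\<lambda>(x, y::'d). mat_norm (A x))"
    by (simp add: abs_summable_on_def)
  then show ?thesis
    by (rule integrable_count_space_bound[of _ _ 1]) (auto simp: bnd_def mat_norm_nonneg split: prod.split)
qed

sublocale dominated_kernel ker bnd
  by standard (rule ker_nonneg ker_le_bnd bnd_int)+

end

text \<open>On \<open>F\<close> the eigenvectors are pinned from both sides, \<open>u\<close>
  against \<open>1\<close> and \<open>v\<close> against \<open>rowsum\<close>; these constants turn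
  into the Gibbs constant.\<close>

locale matrix_pf = matrix_subsystem t A F B
  for t and A :: "nat \<Rightarrow> real ^ 'd ^ 'd" and F B +
  fixes l c C :: real and u v :: "nat \<times> 'd \<Rightarrow> real"
  assumes l: "0 < l" and c: "0 < c" and C: "0 < C"
    and u_le: "u s \<le> C" and u_nonneg: "0 \<le> u s" and u_ge: "fst s \<in> F \<Longrightarrow> c \<le> u s"
    and v_le: "v s \<le> C * rowsum s" and v_nonneg: "0 \<le> v s"
    and v_ge: "fst s \<in> F \<Longrightarrow> c * rowsum s \<le> v s" and v_zero: "fst s \<notin> F \<Longrightarrow> v s = 0"
    and v_total: "(\<integral>\<^sup>+s. ennreal (v s) \<partial>count_space UNIV) < top"
    and hm: "hidden_markov (\<lambda>s r. ennreal (ker s r / l)) (\<lambda>s. ennreal (u s)) (\<lambda>s. ennreal (v s))"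

context matrix_subsystem
begin

theorem exists_matrix_pf: "\<exists>l c C u v. matrix_pf t A F B l c C u v"
proof -
  have Bne: "B \<noteq> {}" using F_ne B_pre by blast
  have "\<exists>l u v. 0 < l \<and> (\<forall>s. 0 \<le> u s \<and> u s \<le> 1 / l) \<and> (\<forall>s. 0 \<le> v s \<and> v s \<le> bnd s / l) \<and>
    S v = 1 \<and> S (\<lambda>s. bnd s * u s) = 1 \<and>
    (\<forall>s. S (\<lambda>r. ker s r * u r) = l * u s) \<and> (\<forall>r. S (\<lambda>s. v s * ker s r) = l * v r)"
  proof (rule perron_frobenius)
    show "finite (B \<times> (UNIV :: 'd set))" using B_fin by simp
    show "B \<times> (UNIV :: 'd set) \<noteq> {}" using Bne by simp
    fix s assume "s \<in> B \<times> (UNIV :: 'd set)"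
    then have "fst s \<in> B" by auto
    then obtain b where "b \<in> B" "t (fst s) b" using B_post B_sub by blast
    then show "\<exists>r\<in>B \<times> UNIV. 0 < ker s r"
      using \<open>fst s \<in> B\<close> B_sub by (intro bexI[of _ "(b, undefined)"]) (auto simp: ker_def A_pos)
  qed
  then obtain l u v where H: "0 < l \<and> (\<forall>s. 0 \<le> u s \<and> u s \<le> 1 / l) \<and> (\<forall>s. 0 \<le> v s \<and> v s \<le> bnd s / l) \<and>
    S v = 1 \<and> S (\<lambda>s. bnd s * u s) = 1 \<and>
    (\<forall>s. S (\<lambda>r. ker s r * u r) = l * u s) \<and> (\<forall>r. S (\<lambda>s. v s * ker s r) = l * v r)"
    by (elim exE)
  note l = H[THEN conjunct1] and H1 = H[THEN conjunct2]
  note uu = H1[THEN conjunct1] and H2 = H1[THEN conjunct2]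
  note vv = H2[THEN conjunct1] and H3 = H2[THEN conjunct2]
  note Sv = H3[THEN conjunct1] and H4 = H3[THEN conjunct2]
  note Sbu = H4[THEN conjunct1] and H5 = H4[THEN conjunct2]
  note eu' = H5[THEN conjunct1] and ev' = H5[THEN conjunct2]
  note u = uu[THEN spec, THEN conjunct1] uu[THEN spec, THEN conjunct2]
  note v = vv[THEN spec, THEN conjunct1] vv[THEN spec, THEN conjunct2]
  note eu = eu'[THEN spec] and ev = ev'[THEN spec]
  have bnd0: "0 \<le> bnd s" for s by (rule a_nonneg)
  have int_v: "integrable (count_space UNIV) v"
    using v by (intro integrable_dom[where K="1 / l"]) auto
  have int_ku: "integrable (count_space UNIV) (\<lambda>r. ker s r * u r)" for s
  proof (rule integrable_dom[where K="1 / l"])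
    show "\<bar>ker s r * u r\<bar> \<le> 1 / l * bnd r" for r
      using mult_mono[OF ker_le_bnd[of s r] u(2)[of r] bnd0 u(1)] u(1)[of r] ker_nonneg[of s r] by simp
  qed
  have int_vk: "integrable (count_space UNIV) (\<lambda>s. v s * ker s r)" for r
  proof (rule integrable_count_space_bound[OF int_v, of _ "bnd r"])
    show "\<bar>v s * ker s r\<bar> \<le> bnd r * v s" for s
      using mult_left_mono[OF ker_le_bnd[of s r] v(1)[of s]] v(1)[of s] ker_nonneg[of s r] by (simp add: mult.commute)
  qed
  have int_vu: "integrable (count_space UNIV) (\<lambda>s. v s * u s)"
  proof (rule integrable_count_space_bound[OF int_v, of _ "1 / l"])
    show "\<bar>v s * u s\<bar> \<le> 1 / l * v s" for s
      using mult_left_mono[OF u(2)[of s] v(1)[of s]] v(1)[of s] u(1)[of s] by simp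
  qed
  note ge1 = integral_ge_sum[of "{_}", simplified]
  have ku_le: "ker s r * u r \<le> l * u s" for s r
    using ge1[of "\<lambda>r. ker s r * u r" r] int_ku eu ker_nonneg u by simp
  have vk_le: "v s * ker s r \<le> l * v r" for s r
    using ge1[of "\<lambda>s. v s * ker s r" s] int_vk ev ker_nonneg v by simp
  let ?R = "{(i, j). i \<in> F \<and> j \<in> F \<and> t i j}"
  have ker_pos: "0 < ker (i, k) (j, k')" if "(i, j) \<in> ?R" for i j k k'
    using that by (simp add: ker_def A_pos)
  \<comment> \<open>Positivity travels backwards along transitions for \<open>u\<close> and forwards
    for \<open>v\<close>, starting from a state where the normalisation forces it.\<close>
  have u_pos: "0 < u (i, k)" if "i \<in> F" for i k
  proof -
    obtain s where s: "bnd s * u s \<noteq> 0" using integral_pos_witness[of "\<lambda>s. bnd s * u s"] Sbu by auto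
    obtain j k0 where jk: "s = (j, k0)" by (cases s)
    have j: "j \<in> F" "0 < u (j, k0)" using s u(1)[of s] jk by (auto simp: bnd_def less_le split: if_splits)
    have bwd: "0 < u (i, k)" if "(i, j') \<in> ?R" "0 < u (j', k')" for i j' k k'
    proof -
      have "0 < ker (i, k) (j', k') * u (j', k')" using that ker_pos by (intro mult_pos_pos) auto
      then have "0 < l * u (i, k)" using ku_le less_le_trans by blast
      then show ?thesis using l by (simp add: zero_less_mult_iff)
    qed
    have "(i, j) \<in> ?R\<^sup>+" using irr that j by simp
    then have "\<forall>k. 0 < u (i, k)"
    proof (induction rule: converse_trancl_induct)
      case (base y)
      then show ?case using bwd j by blast
    next
      case (step y z)
      then show ?case using bwd by blast
    qed
    then show ?thesis by simp
  qed
  have v_pos: "0 < v (j, k)" if "j \<in> F" for j k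
  proof -
    obtain s where s: "v s \<noteq> 0" using integral_pos_witness[of v] Sv by auto
    obtain i k0 where ik: "s = (i, k0)" by (cases s)
    have i: "i \<in> F" "0 < v (i, k0)" using s v[of s] ik l by (auto simp: bnd_def less_le split: if_splits)
    have fwd: "0 < v (j', k')" if "(i', j') \<in> ?R" "0 < v (i', k)" for i' j' k k'
    proof -
      have "0 < v (i', k) * ker (i', k) (j', k')" using that ker_pos by (intro mult_pos_pos) auto
      then have "0 < l * v (j', k')" using vk_le less_le_trans by blast
      then show ?thesis using l by (simp add: zero_less_mult_iff)
    qed
    have "(i, j) \<in> ?R\<^sup>+" using irr that i by simp
    then have "\<forall>k. 0 < v (j, k)"
    proof (induction rule: trancl_induct)
      case (base y)
      then show ?case using fwd i by blast
    next
      case (step y z)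
      then show ?case using fwd by blast
    qed
    then show ?thesis by simp
  qed
  define cu where "cu = Min (u ` (B \<times> UNIV))"
  define cv where "cv = Min (v ` (B \<times> UNIV))"
  define cA where "cA = Min ((\<lambda>(b, i, j). A b $ i $ j) ` (B \<times> UNIV))"
  have fB: "finite (B \<times> (UNIV :: 'd set))" "B \<times> (UNIV :: 'd set) \<noteq> {}" "finite (B \<times> (UNIV :: ('d \<times> 'd) set))"
      "B \<times> (UNIV :: ('d \<times> 'd) set) \<noteq> {}"
    using B_fin Bne by auto
  have cu: "0 < cu" "\<And>b k. b \<in> B \<Longrightarrow> cu \<le> u (b, k)"
    unfolding cu_def using fB B_sub u_pos by (auto intro!: Min_le)
  have cv: "0 < cv" "\<And>b k. b \<in> B \<Longrightarrow> cv \<le> v (b, k)"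
    unfolding cv_def using fB B_sub v_pos by (auto intro!: Min_le)
  have cA: "0 < cA" "\<And>b i j. b \<in> B \<Longrightarrow> cA \<le> A b $ i $ j"
  proof -
    show "0 < cA" unfolding cA_def using fB A_pos by auto
    fix b i j assume "b \<in> B"
    then have "A b $ i $ j \<in> (\<lambda>(b, i, j). A b $ i $ j) ` (B \<times> UNIV)"
      by (intro image_eqI[of _ _ "(b, i, j)"]) auto
    then show "cA \<le> A b $ i $ j" unfolding cA_def using fB by (intro Min_le) auto
  qed
  \<comment> \<open>Only \<open>v\<close> is rescaled by \<open>Z\<close>, to make the total
    probability, the sum of \<open>v s * u s\<close>, equal to one.\<close>
  define Z where "Z = S (\<lambda>s. v s * u s)"
  have Z: "0 < Z"
  proof -
    obtain i where "i \<in> F" using F_ne by blast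
    then have "0 < v (i, undefined) * u (i, undefined)" using u_pos v_pos by simp
    also have "\<dots> \<le> Z" unfolding Z_def using ge1[of "\<lambda>s. v s * u s" "(i, undefined)"] int_vu u v by simp
    finally show ?thesis .
  qed
  define c where "c = min (cA * cu / l) (cv / l / Z)"
  define C where "C = max (1 / l) (1 / l / Z)"
  have rs0: "0 \<le> rowsum s" for s using rowsum_pos[of s] by simp
  have "matrix_pf t A F B l c C u (\<lambda>s. v s / Z)"
  proof (intro matrix_pf.intro matrix_pf_axioms.intro)
    show "matrix_subsystem t A F B" by (rule matrix_subsystem_axioms)
    show "0 < l" by (rule l)
    show "0 < c" using cA cu cv l Z by (simp add: c_def)
    show "0 < C" using l by (simp add: C_def less_max_iff_disj)
    show "u s \<le> C" "0 \<le> u s" "0 \<le> v s / Z" for s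
      using u[of s] v[of s] Z by (simp_all add: C_def le_max_iff_disj)
    \<comment> \<open>One step into \<open>B\<close>, where \<open>u\<close> and the matrix entries
      have positive minima.\<close>
    show "c \<le> u s" if "fst s \<in> F" for s
    proof -
      obtain b where b: "b \<in> B" "t (fst s) b" using B_post[OF \<open>fst s \<in> F\<close>] by blast
      have "cA * cu \<le> ker s (b, undefined) * u (b, undefined)"
        using b cA(2)[OF b(1), of undefined "snd s"] cu(2)[OF b(1), of undefined] cu(1) cA(1) B_sub that
        by (intro mult_mono) (auto simp: ker_def)
      also have "\<dots> \<le> l * u s" by (rule ku_le)
      finally have "cA * cu / l \<le> u s" using l by (simp add: field_simps)
      then show ?thesis by (simp add: c_def min.coboundedI1)
    qed
    \<comment> \<open>Improves the bound \<open>bnd s / l\<close> from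
      \<open>perron_frobenius\<close>: one more use of the eigenvalue equation replaces the norm by
      \<open>rowsum s\<close>.\<close>
    have v_up: "l * v s \<le> rowsum s" for s
    proof -
      have "S (\<lambda>s'. v s' * ker s' s) \<le> S (\<lambda>s'. rowsum s * v s')"
        using int_vk int_v v ker_le_rowsum
        by (intro integral_mono) (simp_all add: mult.commute[of "rowsum s"] mult_left_mono)
      then show ?thesis by (simp add: ev Sv)
    qed
    show "v s / Z \<le> C * rowsum s" for s
    proof -
      have "v s / Z \<le> (1 / l / Z) * rowsum s"
        using v_up[of s] l Z by (simp add: field_simps)
      also have "\<dots> \<le> C * rowsum s" unfolding C_def using rs0 by (intro mult_right_mono) auto
      finally show ?thesis .
    qed
    \<comment> \<open>One step out of \<open>B\<close>: summing over the coordinates attached to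
      \<open>b\<close> collects the matrix entries into \<open>rowsum s\<close>.\<close>
    show "c * rowsum s \<le> v s / Z" if "fst s \<in> F" for s
    proof -
      obtain b where b: "b \<in> B" "t b (fst s)" using B_pre[OF \<open>fst s \<in> F\<close>] by blast
      have "cv * rowsum s = (\<Sum>k\<in>UNIV. cv * ker (b, k) s)"
        using b B_sub that by (auto simp: rowsum_def sum_distrib_left ker_def)
      also have "\<dots> \<le> (\<Sum>k\<in>UNIV. v (b, k) * ker (b, k) s)"
        using cv(2)[OF b(1)] ker_nonneg by (intro sum_mono mult_right_mono) auto
      also have "\<dots> = (\<Sum>r\<in>{b} \<times> UNIV. v r * ker r s)"
        by (simp add: sum_row)
      also have "\<dots> \<le> l * v s"
        using integral_ge_sum[of "{b} \<times> UNIV" "\<lambda>r. v r * ker r s"] int_vk ev v ker_nonneg by simp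
      finally have "(cv / l / Z) * rowsum s \<le> v s / Z" using l Z by (simp add: field_simps)
      moreover have "c * rowsum s \<le> (cv / l / Z) * rowsum s" unfolding c_def using rs0 by (intro mult_right_mono) auto
      ultimately show ?thesis by linarith
    qed
    show "v s / Z = 0" if "fst s \<notin> F" for s
      using v[of s] that by (simp add: bnd_def)
    have nn: "(\<integral>\<^sup>+s. ennreal (f s) \<partial>count_space UNIV) = ennreal (S f)"
      if "integrable (count_space UNIV) f" "\<And>s. 0 \<le> f s" for f
      using that by (intro nn_integral_eq_integral) auto
    show "(\<integral>\<^sup>+s. ennreal (v s / Z) \<partial>count_space UNIV) < top"
      using nn[of "\<lambda>s. v s / Z"] int_v v Z by simp
    show "hidden_markov (\<lambda>s r. ennreal (ker s r / l)) (\<lambda>s. ennreal (u s)) (\<lambda>s. ennreal (v s / Z))"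
    proof
      fix s
      have "(\<integral>\<^sup>+r. ennreal (ker s r / l) * ennreal (u r) \<partial>count_space UNIV) =
          (\<integral>\<^sup>+r. ennreal (ker s r * u r / l) \<partial>count_space UNIV)"
        using ker_nonneg u l by (simp add: ennreal_mult[symmetric])
      also have "\<dots> = ennreal (u s)"
        using nn[of "\<lambda>r. ker s r * u r / l"] int_ku ker_nonneg u l eu[of s] by simp
      finally show "(\<integral>\<^sup>+r. ennreal (ker s r / l) * ennreal (u r) \<partial>count_space UNIV) = ennreal (u s)" .
    next
      fix r
      have "(\<integral>\<^sup>+s. ennreal (v s / Z) * ennreal (ker s r / l) \<partial>count_space UNIV) =
          (\<integral>\<^sup>+s. ennreal (v s * ker s r / Z / l) \<partial>count_space UNIV)"
        using ker_nonneg v l Z by (simp add: ennreal_mult[symmetric])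
      also have "\<dots> = ennreal (v r / Z)"
        using nn[of "\<lambda>s. v s * ker s r / Z / l"] int_vk ker_nonneg v l Z ev[of r] by simp
      finally show "(\<integral>\<^sup>+s. ennreal (v s / Z) * ennreal (ker s r / l) \<partial>count_space UNIV) = ennreal (v r / Z)" .
    next
      have "(\<integral>\<^sup>+s. ennreal (v s / Z) * ennreal (u s) \<partial>count_space UNIV) =
          (\<integral>\<^sup>+s. ennreal (v s * u s / Z) \<partial>count_space UNIV)"
        using u v Z by (simp add: ennreal_mult[symmetric])
      also have "\<dots> = 1"
        using nn[of "\<lambda>s. v s * u s / Z"] int_vu u v Z by (simp add: Z_def[symmetric])
      finally show "(\<integral>\<^sup>+s. ennreal (v s / Z) * ennreal (u s) \<partial>count_space UNIV) = 1" .
    qed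
  qed
  then show ?thesis by metis
qed

end


section \<open>Gibbs bounds and mixing for the hidden Markov measure\<close>

context matrix_pf
begin

sublocale hidden_markov "\<lambda>s r. ennreal (ker s r / l)" "\<lambda>s. ennreal (u s)" "\<lambda>s. ennreal (v s)" fst
  by (rule hm)

definition mu :: "(nat \<Rightarrow> nat) measure" where
  "mu = (SOME \<mu>. \<mu> \<in> invariant_measures t \<and> (\<forall>w. emeasure \<mu> (cylinder t w) = word_prob w))"

lemma mu: "mu \<in> invariant_measures t" "emeasure mu (cylinder t w) = word_prob w"
proof -
  have "\<exists>\<mu>. \<mu> \<in> invariant_measures t \<and> (\<forall>w. emeasure \<mu> (cylinder t w) = word_prob w)"
    using exists_invariant_measure[of t] by (auto simp: ker_def)
  from someI_ex[OF this] show "mu \<in> invariant_measures t" "emeasure mu (cylinder t w) = word_prob w"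
    unfolding mu_def by auto
qed

definition vec :: "(nat \<Rightarrow> nat) \<Rightarrow> nat \<Rightarrow> real ^ 'd" where
  "vec x n = matrix_product A x n *v 1"

lemma vec_Suc: "vec x (Suc n) $ k = (\<Sum>k'\<in>UNIV. A (x n) $ k $ k' * vec x n $ k')"
  unfolding vec_def matrix_product_Suc_vec by (simp add: matrix_vector_mult_def)

lemma vec_pos: "0 < vec x n $ k"
proof (induction n arbitrary: k)
  case 0
  then show ?case by (simp add: vec_def)
next
  case (Suc n)
  show ?case unfolding vec_Suc by (rule sum_pos) (auto simp: A_pos Suc)
qed

lemma mat_potential_vec: "mat_potential A n x = (\<Sum>k\<in>UNIV. vec x n $ k)"
  by (simp add: mat_potential_sum vec_def)

lemma mat_potential_pos: "0 < mat_potential A n x"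
  unfolding mat_potential_vec by (rule sum_pos) (auto simp: vec_pos)

lemma run_off: "run (\<lambda>s. ennreal (v s)) (w @ [j]) (i, k) = (if i = j then push (run (\<lambda>s. ennreal (v s)) w) (j, k) else 0)"
  by (auto simp: observe_def)

text \<open>Each further letter multiplies by its matrix, as in \<open>vec\<close>, and divides by
  \<open>l\<close>, so the bounds on \<open>v\<close> propagate with unchanged constants. The first
  letter is already contained in \<open>v\<close> and costs no factor \<open>l\<close>, hence
  \<open>l ^ n\<close> for \<open>n + 1\<close> letters.\<close>

lemma run_bounds:
  assumes x: "x \<in> shift_space t" "\<And>i. i \<le> n \<Longrightarrow> x i \<in> F"
  shows "ennreal (c * vec x (Suc n) $ k / l ^ n) \<le> run (\<lambda>s. ennreal (v s)) (map x [0..<Suc n]) (x n, k) \<and>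
    run (\<lambda>s. ennreal (v s)) (map x [0..<Suc n]) (x n, k) \<le> ennreal (C * vec x (Suc n) $ k / l ^ n)"
  using assms(2)
proof (induction n arbitrary: k)
  case 0
  have "vec x (Suc 0) $ k = rowsum (x 0, k)" by (simp add: vec_Suc rowsum_def) (simp add: vec_def)
  moreover have "run (\<lambda>s. ennreal (v s)) (map x [0..<Suc 0]) (x 0, k) = ennreal (v (x 0, k))"
    by (simp add: observe_def)
  ultimately show ?case using v_le[of "(x 0, k)"] v_ge[of "(x 0, k)"] 0 by (simp add: ennreal_leI)
next
  case (Suc n)
  let ?r = "run (\<lambda>s. ennreal (v s)) (map x [0..<Suc n])"
  have split: "map x [0..<Suc (Suc n)] = map x [0..<Suc n] @ [x (Suc n)]" by simp
  have off: "?r s = 0" if "fst s \<noteq> x n" for s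
    using that run_off[of "map x [0..<n]" "x n" "fst s" "snd s"] by simp
  have k_eq: "ker (x n, k') (x (Suc n), k) = A (x (Suc n)) $ k $ k'" for k'
    using x(1) Suc.prems[of n] Suc.prems[of "Suc n"] by (simp add: ker_def shift_space_def)
  have "run (\<lambda>s. ennreal (v s)) (map x [0..<Suc (Suc n)]) (x (Suc n), k) = push ?r (x (Suc n), k)"
    unfolding split run_off by simp
  also have "\<dots> = (\<Sum>k'\<in>UNIV. ?r (x n, k') * ennreal (A (x (Suc n)) $ k $ k' / l))"
    unfolding push_def by (subst nn_integral_row[of "x n"]) (simp_all only: off mult_zero_left k_eq not_False_eq_True)
  finally have eq: "run (\<lambda>s. ennreal (v s)) (map x [0..<Suc (Suc n)]) (x (Suc n), k) =
      (\<Sum>k'\<in>UNIV. ?r (x n, k') * ennreal (A (x (Suc n)) $ k $ k' / l))" .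
  have sum_eq: "(\<Sum>k'\<in>UNIV. ennreal (q * vec x (Suc n) $ k' / l ^ n) * ennreal (A (x (Suc n)) $ k $ k' / l)) =
      ennreal (q * vec x (Suc (Suc n)) $ k / l ^ Suc n)" if "0 < q" for q
  proof -
    have nn: "0 \<le> q * vec x (Suc n) $ k' / l ^ n" "0 \<le> A (x (Suc n)) $ k $ k' / l" for k'
      using that vec_pos[of x "Suc n" k'] A_pos[of "x (Suc n)" k k'] l by simp_all
    have "(\<Sum>k'\<in>UNIV. ennreal (q * vec x (Suc n) $ k' / l ^ n) * ennreal (A (x (Suc n)) $ k $ k' / l)) =
        ennreal (\<Sum>k'\<in>UNIV. (q * vec x (Suc n) $ k' / l ^ n) * (A (x (Suc n)) $ k $ k' / l))"
      by (subst sum_ennreal[symmetric], intro mult_nonneg_nonneg nn,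
          intro sum.cong refl ennreal_mult[symmetric] nn)
    also have "(\<Sum>k'\<in>UNIV. (q * vec x (Suc n) $ k' / l ^ n) * (A (x (Suc n)) $ k $ k' / l)) =
        q * vec x (Suc (Suc n)) $ k / l ^ Suc n"
      unfolding vec_Suc[of x "Suc n"] by (simp add: sum_distrib_left sum_divide_distrib mult_ac)
    finally show ?thesis .
  qed
  have IH: "ennreal (c * vec x (Suc n) $ k' / l ^ n) \<le> ?r (x n, k')" "?r (x n, k') \<le> ennreal (C * vec x (Suc n) $ k' / l ^ n)" for k'
    using Suc.IH[of k'] Suc.prems by simp_all
  show ?case
    unfolding eq sum_eq[OF c, symmetric] sum_eq[OF C, symmetric]
    using IH by (intro conjI sum_mono mult_right_mono) auto
qed

text \<open>One factor \<open>C\<close> or \<open>c\<close> comes from \<open>v\<close>, the other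
  from \<open>u\<close>; \<open>l\<close> corrects the exponent, which in \<open>run_bounds\<close>
  is one less than the number of letters.\<close>

definition K where "K = max (C * C * l) (1 / (c * c * l))"

lemma K: "0 < K" using C c l by (simp add: K_def less_max_iff_disj)

text \<open>The upper bound covers words that leave \<open>F\<close>, because these are null; for
  the same reason the lower bound can hold only inside \<open>F\<close>.\<close>

theorem gibbs_bounds:
  assumes x: "x \<in> shift_space t" and n: "1 \<le> n"
  shows "measure mu (cylinder t (map x [0..<n])) \<le> K * mat_potential A n x / l ^ n"
    and "(\<And>i. i < n \<Longrightarrow> x i \<in> F) \<Longrightarrow> mat_potential A n x / l ^ n \<le> K * measure mu (cylinder t (map x [0..<n]))"
    and "i < n \<Longrightarrow> x i \<notin> F \<Longrightarrow> measure mu (cylinder t (map x [0..<n])) = 0"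
proof -
  interpret M: prob_space mu by (rule invariant_measures_prob[OF mu(1)])
  obtain m where m: "n = Suc m" using n by (cases n) auto
  let ?r = "run (\<lambda>s. ennreal (v s)) (map x [0..<n])"
  have wp: "ennreal (measure mu (cylinder t (map x [0..<n]))) = (\<Sum>k\<in>UNIV. ?r (x m, k) * ennreal (u (x m, k)))"
  proof -
    have off: "?r s = 0" if "fst s \<noteq> x m" for s
      using that run_off[of "map x [0..<m]" "x m" "fst s" "snd s"] m by simp
    have "ennreal (measure mu (cylinder t (map x [0..<n]))) = mass ?r"
      using mu(2) by (simp add: M.emeasure_eq_measure[symmetric] word_prob_def)
    also have "\<dots> = (\<Sum>k\<in>UNIV. ?r (x m, k) * ennreal (u (x m, k)))"
      unfolding mass_def by (subst nn_integral_row[of "x m"]) (simp_all only: off mult_zero_left not_False_eq_True)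
    finally show ?thesis .
  qed
  have l0: "0 < l ^ m" using l by simp
  have nn: "0 \<le> q * vec x n $ k / l ^ m" if "0 < q" for q k
    using that vec_pos[of x n k] l0 by simp
  have sums: "(\<Sum>k\<in>UNIV. ennreal (q * vec x n $ k / l ^ m) * ennreal q) = ennreal (q * q * l * mat_potential A n x / l ^ n)"
    if "0 < q" for q
  proof -
    have "(\<Sum>k\<in>UNIV. ennreal (q * vec x n $ k / l ^ m) * ennreal q) = ennreal (\<Sum>k\<in>UNIV. (q * vec x n $ k / l ^ m) * q)"
      by (subst sum_ennreal[symmetric], intro mult_nonneg_nonneg nn[OF that] less_imp_le[OF that],
          intro sum.cong refl ennreal_mult[symmetric] nn[OF that] less_imp_le[OF that])
    also have "(\<Sum>k\<in>UNIV. (q * vec x n $ k / l ^ m) * q) = q * q * l * mat_potential A n x / l ^ n"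
      using l unfolding mat_potential_vec m by (simp add: sum_distrib_left sum_divide_distrib mult_ac)
    finally show ?thesis .
  qed
  have pp: "0 < mat_potential A n x" by (rule mat_potential_pos)
  show zero: "measure mu (cylinder t (map x [0..<n])) = 0" if i: "i < n" "x i \<notin> F" for i
  proof -
    define w1 where "w1 = map x [0..<i]"
    define w2 where "w2 = map x [Suc i..<n]"
    have w: "map x [0..<n] = (w1 @ [x i]) @ w2"
    proof -
      have "[0..<n] = [0..<i] @ [i..<n]" using upt_add_eq_append[of 0 i "n - i"] i by simp
      also have "[i..<n] = i # [Suc i..<n]" using i by (simp add: upt_conv_Cons)
      finally show ?thesis by (simp add: w1_def w2_def)
    qed
    have "run (\<lambda>s. ennreal (v s)) (w1 @ [x i]) = (\<lambda>_. 0)"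
    proof
      fix s :: "nat \<times> 'd"
      have "ker z (x i, k) = 0" for z k using i(2) by (simp add: ker_def)
      then show "run (\<lambda>s. ennreal (v s)) (w1 @ [x i]) s = 0"
        by (cases s) (simp add: observe_def push_def)
    qed
    moreover have "run (\<lambda>_. 0) w2 = (\<lambda>_. 0)"
      using run_cmult[of 0 "\<lambda>_. 0" w2] by simp
    ultimately have "?r = (\<lambda>_. 0)" unfolding w run_append by simp
    then show ?thesis using wp by simp
  qed
  show "measure mu (cylinder t (map x [0..<n])) \<le> K * mat_potential A n x / l ^ n"
  proof (cases "\<forall>i<n. x i \<in> F")
    case False
    then have "measure mu (cylinder t (map x [0..<n])) = 0" using zero by blast
    then show ?thesis using K pp l by simp
  next
    case True
    have "ennreal (measure mu (cylinder t (map x [0..<n]))) \<le> (\<Sum>k\<in>UNIV. ennreal (C * vec x n $ k / l ^ m) * ennreal C)"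
      unfolding wp using run_bounds[OF x, of m] True u_le m by (intro sum_mono mult_mono ennreal_leI) auto
    then have "measure mu (cylinder t (map x [0..<n])) \<le> C * C * l * mat_potential A n x / l ^ n"
      unfolding sums[OF C] using C l pp by (subst (asm) ennreal_le_iff) auto
    also have "\<dots> \<le> K * mat_potential A n x / l ^ n"
      unfolding K_def using pp l by (intro divide_right_mono mult_right_mono) auto
    finally show ?thesis .
  qed
  show "mat_potential A n x / l ^ n \<le> K * measure mu (cylinder t (map x [0..<n]))" if "\<And>i. i < n \<Longrightarrow> x i \<in> F"
  proof -
    have "(\<Sum>k\<in>UNIV. ennreal (c * vec x n $ k / l ^ m) * ennreal c) \<le> ennreal (measure mu (cylinder t (map x [0..<n])))"
      unfolding wp using run_bounds[OF x, of m] that u_ge m by (intro sum_mono mult_mono ennreal_leI) auto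
    then have "c * c * l * mat_potential A n x / l ^ n \<le> measure mu (cylinder t (map x [0..<n]))"
      unfolding sums[OF c] by (subst (asm) ennreal_le_iff) auto
    then have "1 / (c * c * l) * (c * c * l * mat_potential A n x / l ^ n) \<le> 1 / (c * c * l) * measure mu (cylinder t (map x [0..<n]))"
      using c l by (intro mult_left_mono) auto
    also have "\<dots> \<le> K * measure mu (cylinder t (map x [0..<n]))"
      unfolding K_def by (intro mult_right_mono) auto
    finally show ?thesis using c l by simp
  qed
qed

lemma mass_le_C: "mass x \<le> ennreal C * (\<integral>\<^sup>+s. x s \<partial>count_space UNIV)"
proof -
  have "mass x \<le> (\<integral>\<^sup>+s. x s * ennreal C \<partial>count_space UNIV)"
    unfolding mass_def using u_le by (intro nn_integral_mono mult_left_mono ennreal_leI) auto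
  also have "\<dots> = ennreal C * (\<integral>\<^sup>+s. x s \<partial>count_space UNIV)"
    by (subst nn_integral_cmult[symmetric]) (auto simp: mult.commute)
  finally show ?thesis .
qed

text \<open>Doeblin's condition at the state \<open>(b0, k0)\<close>: one step takes every state
  into the finite set \<open>B\<close>, and topological mixing supplies paths of one common length
  \<open>m\<close> from all letters of \<open>B\<close> to \<open>b0\<close>. Positive entries allow
  the coordinate \<open>k0\<close> to be kept along these paths.\<close>

theorem mu_mixing:
  assumes F: "F = UNIV" and mix: "topologically_mixing t"
  shows "mixing mu shift_map"
proof -
  have inF: "i \<in> F" for i using F by simp
  have Bne: "B \<noteq> {}" using B_pre inF by blast
  then obtain b0 where b0: "b0 \<in> B" by blast
  obtain N where N: "\<And>a b n. N a b < n \<Longrightarrow> cylinder t [a] \<inter> (shift_map ^^ n) -` cylinder t [b] \<noteq> {}"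
    using mix unfolding topologically_mixing_def by metis
  define m where "m = Suc (Max ((\<lambda>b. N b b0) ` B))"
  have m: "N b b0 < m" if "b \<in> B" for b
    using that B_fin by (simp add: m_def less_Suc_eq_le)
  have "\<exists>s. s 0 = b \<and> s m = b0 \<and> (\<forall>i. t (s i) (s (Suc i)))" if b: "b \<in> B" for b
  proof -
    obtain y where "y \<in> cylinder t [b]" "(shift_map ^^ m) y \<in> cylinder t [b0]"
      using N[OF m[OF b]] by blast
    then show ?thesis by (auto simp: cylinder_def shift_map_funpow shift_space_def)
  qed
  then obtain s where s: "\<And>b. b \<in> B \<Longrightarrow> s b 0 = b \<and> s b m = b0 \<and> (\<forall>i. t (s b i) (s b (Suc i)))" by metis
  define k0 :: 'd where "k0 = undefined"
  define pr where "pr b = (\<Prod>i<m. ker (s b i, k0) (s b (Suc i), k0) / l)" for b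
  have pr: "0 < pr b" if "b \<in> B" for b
    unfolding pr_def using s[OF that] l by (intro prod_pos) (auto simp: ker_def inF A_pos)
  define \<kappa> where "\<kappa> = Min (pr ` B)"
  have \<kappa>: "0 < \<kappa>" "\<And>b. b \<in> B \<Longrightarrow> \<kappa> \<le> pr b"
    unfolding \<kappa>_def using B_fin Bne pr by auto
  define cA where "cA = Min ((\<lambda>(b, i). A b $ k0 $ i) ` (B \<times> UNIV))"
  have cA: "0 < cA" "\<And>b i. b \<in> B \<Longrightarrow> cA \<le> A b $ k0 $ i"
  proof -
    show "0 < cA" unfolding cA_def using B_fin Bne A_pos by auto
    fix b i assume "b \<in> B"
    then have "A b $ k0 $ i \<in> (\<lambda>(b, i). A b $ k0 $ i) ` (B \<times> UNIV)"
      by (intro image_eqI[of _ _ "(b, i)"]) auto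
    then show "cA \<le> A b $ k0 $ i" unfolding cA_def using B_fin by (intro Min_le) auto
  qed
  have path: "ennreal \<kappa> * y (b, k0) \<le> (push ^^ m) y (b0, k0)" if b: "b \<in> B" for b y
  proof -
    have "(\<Prod>i<m. ennreal (ker (s b i, k0) (s b (Suc i), k0) / l)) * y (s b 0, k0) \<le> (push ^^ m) y (s b m, k0)"
      by (rule push_funpow_path[of "\<lambda>i. (s b i, k0)"])
    moreover have "(\<Prod>i<m. ennreal (ker (s b i, k0) (s b (Suc i), k0) / l)) = ennreal (pr b)"
      unfolding pr_def using ker_nonneg l by (intro prod_ennreal) auto
    ultimately have "ennreal (pr b) * y (b, k0) \<le> (push ^^ m) y (b0, k0)" using s[OF b] by simp
    moreover have "ennreal \<kappa> * y (b, k0) \<le> ennreal (pr b) * y (b, k0)"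
      using \<kappa>(2)[OF b] by (intro mult_right_mono ennreal_leI) auto
    ultimately show ?thesis by (rule order_trans[rotated])
  qed
  \<comment> \<open>Which letter of \<open>B\<close> is reached depends on the state, so only the
    sum over \<open>B\<close> is bounded below; this costs the factor \<open>card B\<close> in
    \<open>\<delta>\<close>.\<close>
  have step: "ennreal (cA / l) * (\<integral>\<^sup>+s. x s \<partial>count_space UNIV) \<le> (\<Sum>b\<in>B. push x (b, k0))" for x
  proof -
    have "ennreal (cA / l) * (\<integral>\<^sup>+s. x s \<partial>count_space UNIV) = (\<integral>\<^sup>+s. x s * ennreal (cA / l) \<partial>count_space UNIV)"
      by (subst nn_integral_cmult[symmetric]) (auto simp: mult.commute)
    also have "\<dots> \<le> (\<integral>\<^sup>+s. (\<Sum>b\<in>B. x s * ennreal (ker s (b, k0) / l)) \<partial>count_space UNIV)"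
    proof (rule nn_integral_mono)
      fix z :: "nat \<times> 'd"
      obtain b where b: "b \<in> B" "t (fst z) b" using B_post[OF inF] by blast
      have "x z * ennreal (cA / l) \<le> x z * ennreal (ker z (b, k0) / l)"
        using b cA(2)[OF b(1), of "snd z"] l inF by (intro mult_left_mono ennreal_leI) (auto simp: ker_def divide_right_mono)
      also have "\<dots> \<le> (\<Sum>b\<in>B. x z * ennreal (ker z (b, k0) / l))"
        by (rule member_le_sum[of b B "\<lambda>b. x z * ennreal (ker z (b, k0) / l)"]) (use b B_fin in auto)
      finally show "x z * ennreal (cA / l) \<le> (\<Sum>b\<in>B. x z * ennreal (ker z (b, k0) / l))" .
    qed
    also have "\<dots> = (\<Sum>b\<in>B. push x (b, k0))"
      unfolding push_def by (rule nn_integral_sum) simp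
    finally show ?thesis .
  qed
  define \<delta> where "\<delta> = \<kappa> * cA / l / C / real (card B)"
  have cardB: "0 < card B" using B_fin Bne by (simp add: card_gt_0_iff)
  have \<delta>0: "0 < \<delta>" using \<kappa> cA l C cardB by (simp add: \<delta>_def)
  have "ennreal \<delta> * mass x \<le> (push ^^ Suc m) x (b0, k0)" for x
  proof -
    have "ennreal (real (card B)) * (ennreal \<delta> * mass x) \<le> ennreal (real (card B)) * (ennreal \<delta> * (ennreal C * (\<integral>\<^sup>+s. x s \<partial>count_space UNIV)))"
      by (intro mult_left_mono mass_le_C) auto
    also have "\<dots> = ennreal \<kappa> * (ennreal (cA / l) * (\<integral>\<^sup>+s. x s \<partial>count_space UNIV))"
    proof -
      have "real (card B) * (\<delta> * C) = \<kappa> * (cA / l)" using cardB C by (simp add: \<delta>_def)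
      then have "ennreal (real (card B)) * (ennreal \<delta> * ennreal C) = ennreal \<kappa> * ennreal (cA / l)"
        using \<delta>0 C \<kappa> cA l by (simp add: ennreal_mult[symmetric])
      then show ?thesis by (simp only: mult.assoc[symmetric])
    qed
    also have "\<dots> \<le> ennreal \<kappa> * (\<Sum>b\<in>B. push x (b, k0))"
      by (intro mult_left_mono step) simp
    also have "\<dots> = (\<Sum>b\<in>B. ennreal \<kappa> * push x (b, k0))" by (simp add: sum_distrib_left)
    also have "\<dots> \<le> (\<Sum>b\<in>B. (push ^^ m) (push x) (b0, k0))"
      by (intro sum_mono path)
    also have "\<dots> = ennreal (real (card B)) * (push ^^ Suc m) x (b0, k0)"
      by (simp add: funpow_swap1 ennreal_of_nat_eq_real_of_nat)
    finally show ?thesis using cardB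
      by (subst (asm) ennreal_mult_le_mult_iff) auto
  qed
  then show ?thesis
    by (rule mixing_from_doeblin[OF mu])
      (use \<delta>0 u_ge[of "(b0, k0)"] c inF in auto)
qed

end


section \<open>Gibbs states and the Gurevich pressure\<close>

text \<open>Isolates the Gibbs property with \<open>P = ln l\<close> from its matrix origin; the
  pressure of a mixing state and the upper bound for entropy plus energy are derived from
  it.\<close>

locale gibbs_state =
  fixes t :: "nat \<Rightarrow> nat \<Rightarrow> bool" and \<phi> :: "nat \<Rightarrow> (nat \<Rightarrow> nat) \<Rightarrow> real"
    and \<mu> :: "(nat \<Rightarrow> nat) measure" and K l :: real
  assumes inv: "\<mu> \<in> invariant_measures t" and K: "0 < K" and l: "0 < l"
    and phi_pos: "x \<in> shift_space t \<Longrightarrow> 1 \<le> n \<Longrightarrow> 0 < \<phi> n x"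
    and upper: "x \<in> shift_space t \<Longrightarrow> 1 \<le> n \<Longrightarrow> measure \<mu> (cylinder t (map x [0..<n])) \<le> K * \<phi> n x / l ^ n"
    and lower: "x \<in> shift_space t \<Longrightarrow> 1 \<le> n \<Longrightarrow> \<phi> n x / l ^ n \<le> K * measure \<mu> (cylinder t (map x [0..<n]))"
begin

sublocale prob_space \<mu> by (rule invariant_measures_prob[OF inv])

lemmas sets_mu = invariant_measures_sets[OF inv] and space_mu = invariant_measures_space[OF inv]

lemma cyl_sets[simp, measurable]: "cylinder t w \<in> sets \<mu>"
  by (simp add: sets_mu)

lemma cyl_pos: "x \<in> shift_space t \<Longrightarrow> 0 < measure \<mu> (cylinder t (map x [0..<n]))"
proof (cases "n = 0")
  case True
  then show ?thesis using prob_space space_mu by simp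
next
  case False
  assume x: "x \<in> shift_space t"
  have "0 < \<phi> n x / l ^ n" using phi_pos[OF x, of n] False l by simp
  also have "\<dots> \<le> K * measure \<mu> (cylinder t (map x [0..<n]))" using lower[OF x, of n] False by simp
  finally show ?thesis using K by (simp add: zero_less_mult_iff)
qed

lemma phi_le: "x \<in> shift_space t \<Longrightarrow> 1 \<le> n \<Longrightarrow> \<phi> n x \<le> K * l ^ n"
proof -
  assume x: "x \<in> shift_space t" "1 \<le> n"
  have "\<phi> n x / l ^ n \<le> K * measure \<mu> (cylinder t (map x [0..<n]))" by (rule lower[OF x])
  also have "\<dots> \<le> K * 1" using K by (intro mult_left_mono) auto
  finally show ?thesis using l by (simp add: field_simps)
qed

lemma is_gibbs_measure: "gibbs_measure t \<phi> \<mu>"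
  unfolding gibbs_measure_def
proof (rule conjI[OF inv], rule exI[of _ K], rule conjI[OF K], rule exI[of _ "ln l"], intro allI impI ballI conjI)
  fix w :: "nat list" and x assume w: "w \<noteq> []" and xw: "x \<in> cylinder t w"
  define n where "n = length w"
  have n: "1 \<le> n" using w by (simp add: n_def Suc_le_eq)
  have x: "x \<in> shift_space t" and wx: "w = map x [0..<n]" using xw by (auto simp: cylinder_iff_map n_def)
  have e: "exp (- real (length w) * ln l) = 1 / l ^ n"
    using l by (simp add: n_def exp_minus exp_of_nat_mult inverse_eq_divide)
  have p: "0 < \<phi> n x / l ^ n" using phi_pos[OF x n] l by simp
  have "1 / K \<le> measure \<mu> (cylinder t w) / (\<phi> n x / l ^ n)"
  proof -
    have "1 / K \<le> m / q" if "q \<le> K * m" "0 < q" for q m using that K by (simp add: field_simps)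
    from this[OF lower[OF x n] p] show ?thesis unfolding wx[symmetric] .
  qed
  then show "1 / K \<le> measure \<mu> (cylinder t w) / (exp (- real (length w) * ln l) * \<phi> (length w) x)"
    unfolding e by (simp add: n_def)
  have "measure \<mu> (cylinder t w) / (\<phi> n x / l ^ n) \<le> K"
    using upper[OF x n] K p by (subst pos_divide_le_eq) (auto simp: wx[symmetric])
  then show "measure \<mu> (cylinder t w) / (exp (- real (length w) * ln l) * \<phi> (length w) x) \<le> K"
    unfolding e by (simp add: n_def)
qed

definition loop_sum :: "nat \<Rightarrow> nat \<Rightarrow> ennreal" where
  "loop_sum a n = (\<Sum>\<^sub>\<infinity>x\<in>{x \<in> shift_space t. (shift_map ^^ n) x = x}. ennreal (\<phi> n x) * indicator (cylinder t [a]) x)"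

lemma periodic_eqI:
  assumes "(shift_map ^^ n) x = x" "(shift_map ^^ n) y = y" "map x [0..<n] = map y [0..<n]" "1 \<le> n"
  shows "x = y"
proof
  fix i
  show "x i = y i"
  proof (induction i rule: less_induct)
    case (less i)
    show ?case
    proof (cases "i < n")
      case True
      then show ?thesis using assms(3) by simp
    next
      case False
      have "x i = x (i - n)" "y i = y (i - n)"
        using fun_cong[OF assms(1), of "i - n"] fun_cong[OF assms(2), of "i - n"] False
        by (auto simp: shift_map_funpow)
      then show ?thesis using less[of "i - n"] False assms(4) by simp
    qed
  qed
qed

text \<open>Distinct points of period \<open>n\<close> have distinct prefixes of length
  \<open>n\<close>, so their cylinders are disjoint, and the Gibbs lower bound is summed against
  total measure one.\<close>

lemma loop_sum_le:
  assumes n: "1 \<le> n" shows "loop_sum a n \<le> ennreal (K * l ^ n)"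
proof -
  let ?P = "{x \<in> shift_space t. (shift_map ^^ n) x = x}"
  have "sum (\<lambda>x. ennreal (\<phi> n x) * indicator (cylinder t [a]) x) Q \<le> ennreal (K * l ^ n)"
    if Q: "finite Q" "Q \<subseteq> ?P" for Q
  proof -
    have "sum (\<lambda>x. ennreal (\<phi> n x) * indicator (cylinder t [a]) x) Q \<le> (\<Sum>x\<in>Q. ennreal (\<phi> n x))"
      by (intro sum_mono) (auto simp: indicator_def)
    also have "\<dots> = ennreal (\<Sum>x\<in>Q. \<phi> n x)"
      using phi_pos[OF _ n] Q by (intro sum_ennreal) (auto simp: less_imp_le)
    also have "(\<Sum>x\<in>Q. \<phi> n x) \<le> (\<Sum>x\<in>Q. K * l ^ n * measure \<mu> (cylinder t (map x [0..<n])))"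
      using lower[OF _ n] Q l by (intro sum_mono) (auto simp: field_simps)
    also have "\<dots> = K * l ^ n * (\<Sum>x\<in>Q. measure \<mu> (cylinder t (map x [0..<n])))"
      by (simp add: sum_distrib_left)
    also have "(\<Sum>x\<in>Q. measure \<mu> (cylinder t (map x [0..<n]))) = measure \<mu> (\<Union>x\<in>Q. cylinder t (map x [0..<n]))"
    proof (rule finite_measure_finite_Union[symmetric])
      show "disjoint_family_on (\<lambda>x. cylinder t (map x [0..<n])) Q"
        unfolding disjoint_family_on_def
      proof (intro ballI impI)
        fix x y assume "x \<in> Q" "y \<in> Q" "x \<noteq> y"
        then have "map x [0..<n] \<noteq> map y [0..<n]" using periodic_eqI[of n x y] Q n by auto
        then show "cylinder t (map x [0..<n]) \<inter> cylinder t (map y [0..<n]) = {}"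
          by (auto simp: cylinder_iff_map)
      qed
    qed (use Q in auto)
    also have "K * l ^ n * \<dots> \<le> K * l ^ n * 1"
      using K l by (intro mult_left_mono) auto
    finally show ?thesis by (simp add: ennreal_leI)
  qed
  then show ?thesis
    unfolding loop_sum_def by (subst nonneg_infsum_complete) (auto intro!: SUP_least)
qed

text \<open>The prefix of a point that starts at \<open>a\<close> and is back at \<open>a\<close> at
  time \<open>n\<close> closes up to a periodic point, so the cylinders of the loops at
  \<open>a\<close> cover the return set.\<close>

lemma loop_sum_ge:
  assumes n: "1 \<le> n"
  shows "ennreal (measure \<mu> (cylinder t [a] \<inter> (shift_map ^^ n) -` cylinder t [a])) \<le> ennreal (K / l ^ n) * loop_sum a n"
proof -
  let ?P = "{x \<in> shift_space t. (shift_map ^^ n) x = x}"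
  define Q where "Q = ?P \<inter> cylinder t [a]"
  define E where "E = cylinder t [a] \<inter> (shift_map ^^ n) -` cylinder t [a]"
  have Kl: "0 \<le> K / l ^ n" using K l by simp
  have bound: "emeasure \<mu> (\<Union>x\<in>R. cylinder t (map x [0..<n])) \<le> ennreal (K / l ^ n) * loop_sum a n"
    if R: "finite R" "R \<subseteq> Q" for R
  proof -
    have "emeasure \<mu> (\<Union>x\<in>R. cylinder t (map x [0..<n])) \<le> (\<Sum>x\<in>R. emeasure \<mu> (cylinder t (map x [0..<n])))"
      using R by (intro emeasure_subadditive_finite) auto
    also have "\<dots> \<le> (\<Sum>x\<in>R. ennreal (K / l ^ n) * (ennreal (\<phi> n x) * indicator (cylinder t [a]) x))"
    proof (rule sum_mono)
      fix x assume "x \<in> R"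
      then have x: "x \<in> shift_space t" "x \<in> cylinder t [a]" using R by (auto simp: Q_def)
      have "emeasure \<mu> (cylinder t (map x [0..<n])) \<le> ennreal (K / l ^ n * \<phi> n x)"
        using upper[OF x(1) n] by (simp add: emeasure_eq_measure ennreal_leI)
      then show "emeasure \<mu> (cylinder t (map x [0..<n])) \<le> ennreal (K / l ^ n) * (ennreal (\<phi> n x) * indicator (cylinder t [a]) x)"
        using x ennreal_mult[OF Kl less_imp_le[OF phi_pos[OF x(1) n]]] by simp
    qed
    also have "\<dots> = ennreal (K / l ^ n) * sum (\<lambda>x. ennreal (\<phi> n x) * indicator (cylinder t [a]) x) R"
      by (simp add: sum_distrib_left)
    also have "\<dots> \<le> ennreal (K / l ^ n) * loop_sum a n"
      unfolding loop_sum_def using R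
      by (subst nonneg_infsum_complete) (auto intro!: mult_left_mono SUP_upper simp: Q_def)
    finally show ?thesis .
  qed
  have cov: "E \<subseteq> (\<Union>x\<in>Q. cylinder t (map x [0..<n]))"
  proof
    fix x assume "x \<in> E"
    then have x: "x \<in> shift_space t" "x 0 = a" "x n = a"
      by (auto simp: E_def cylinder_def shift_map_funpow)
    define y where "y i = x (i mod n)" for i
    have "t (y i) (y (Suc i))" for i
    proof -
      have "t (x (i mod n)) (x (Suc (i mod n)))" using x(1) by (simp add: shift_space_def)
      then show ?thesis
        unfolding y_def using x n by (auto simp: mod_Suc)
    qed
    then have "y \<in> shift_space t" by (simp add: shift_space_def)
    moreover have "(shift_map ^^ n) y = y" by (rule ext) (simp add: shift_map_funpow y_def)
    moreover have "y 0 = a" using x by (simp add: y_def)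
    ultimately have "y \<in> Q" by (simp add: Q_def cylinder_def)
    moreover have "map y [0..<n] = map x [0..<n]" by (simp add: y_def)
    moreover have "x \<in> cylinder t (map x [0..<n])" by (rule in_cylinder_prefix[OF x(1)])
    ultimately show "x \<in> (\<Union>x\<in>Q. cylinder t (map x [0..<n]))" by (metis UN_I)
  qed
  have "emeasure \<mu> (\<Union>x\<in>Q. cylinder t (map x [0..<n])) \<le> ennreal (K / l ^ n) * loop_sum a n"
  proof (cases "Q = {}")
    case False
    \<comment> \<open>Injecting the loops into words makes them countable, so that their union is an
      increasing limit of finite unions.\<close>
    have "inj_on (\<lambda>x. map x [0..<n]) Q"
      using periodic_eqI[OF _ _ _ n] by (auto simp: inj_on_def Q_def)
    then have cQ: "countable Q" by (rule countableI')
    define e where "e = from_nat_into Q"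
    have e: "range e = Q" unfolding e_def by (rule range_from_nat_into[OF False cQ])
    define X where "X m = (\<Union>x\<in>e ` {..m}. cylinder t (map x [0..<n]))" for m :: nat
    have "(\<Union>x\<in>Q. cylinder t (map x [0..<n])) = (\<Union>m. X m)"
      unfolding X_def e[symmetric] by auto
    moreover have "emeasure \<mu> (\<Union>m. X m) = (SUP m. emeasure \<mu> (X m))"
    proof (rule SUP_emeasure_incseq[symmetric])
      show "range X \<subseteq> sets \<mu>" unfolding X_def by (auto intro!: sets.finite_UN)
      show "incseq X" unfolding X_def incseq_def by fastforce
    qed
    moreover have "(SUP m. emeasure \<mu> (X m)) \<le> ennreal (K / l ^ n) * loop_sum a n"
      unfolding X_def by (intro SUP_least bound) (use e in auto)
    ultimately show ?thesis by simp
  qed simp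
  moreover have "emeasure \<mu> E \<le> emeasure \<mu> (\<Union>x\<in>Q. cylinder t (map x [0..<n]))"
  proof (rule emeasure_mono[OF cov])
    have "(\<Union>x\<in>Q. cylinder t (map x [0..<n])) = (\<Union>w\<in>(\<lambda>x. map x [0..<n]) ` Q. cylinder t w)" by simp
    also have "\<dots> \<in> sets \<mu>" by (intro sets.countable_UN') auto
    finally show "(\<Union>x\<in>Q. cylinder t (map x [0..<n])) \<in> sets \<mu>" .
  qed
  ultimately show ?thesis by (simp add: E_def emeasure_eq_measure[symmetric] order_trans)
qed

theorem gurevich_limit:
  assumes mix: "mixing \<mu> shift_map" and a: "cylinder t [a] \<noteq> {}"
  shows "gurevich_seq t \<phi> a \<longlonglongrightarrow> ereal (ln l)"
proof -
  define p where "p = measure \<mu> (cylinder t [a])"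
  obtain x0 where x0: "x0 \<in> cylinder t [a]" using a by blast
  have p: "0 < p"
  proof -
    have "map x0 [0..<1] = [a]" "x0 \<in> shift_space t" using x0 by (auto simp: cylinder_def)
    then show ?thesis using cyl_pos[of x0 1] by (simp add: p_def)
  qed
  have "(\<lambda>n. measure \<mu> (cylinder t [a] \<inter> (shift_map ^^ n) -` cylinder t [a])) \<longlonglongrightarrow> p * p"
    using mix unfolding mixing_def p_def by simp
  then have "\<forall>\<^sub>F n in sequentially. p * p / 2 < measure \<mu> (cylinder t [a] \<inter> (shift_map ^^ n) -` cylinder t [a])"
    by (rule order_tendstoD(1)) (use p in simp)
  then have ev: "\<forall>\<^sub>F n in sequentially. p * p / 2 < measure \<mu> (cylinder t [a] \<inter> (shift_map ^^ n) -` cylinder t [a]) \<and> 1 \<le> n"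
    using eventually_ge_at_top[of 1] by eventually_elim simp
  define w where "w n = enn2real (loop_sum a n)" for n
  have ev2: "\<forall>\<^sub>F n in sequentially. 1 \<le> n \<and> gurevich_seq t \<phi> a n = ereal (ln (w n) / real n) \<and>
      ln (p * p / 2 / K) + real n * ln l \<le> ln (w n) \<and> ln (w n) \<le> ln K + real n * ln l"
    using ev
  proof eventually_elim
    case (elim n)
    then have n: "1 \<le> n" by simp
    have up: "loop_sum a n \<le> ennreal (K * l ^ n)" by (rule loop_sum_le[OF n])
    then have fin: "loop_sum a n < top" by (metis ennreal_less_top le_less_trans)
    then have W: "loop_sum a n = ennreal (w n)" "0 \<le> w n" by (simp_all add: w_def)
    have w_up: "w n \<le> K * l ^ n" using up K l unfolding W(1) by (simp add: ennreal_le_iff)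
    have "ennreal (p * p / 2) \<le> ennreal (K / l ^ n) * loop_sum a n"
      using elim loop_sum_ge[OF n, of a] by (meson ennreal_leI less_imp_le order_trans)
    also have "\<dots> = ennreal (K / l ^ n * w n)"
      unfolding W(1) by (rule ennreal_mult[symmetric]) (use W K l in auto)
    finally have "p * p / 2 \<le> K / l ^ n * w n" using W K l by (simp add: ennreal_le_iff)
    then have w_low: "p * p / 2 / K * l ^ n \<le> w n" using K l by (simp add: field_simps)
    have pl: "0 < p * p / 2 / K * l ^ n" using p K l by simp
    then have w0: "0 < w n" using w_low by linarith
    have "gurevich_seq t \<phi> a n = ereal (ln (w n)) / ereal (real n)"
      using W w0 fin unfolding gurevich_seq_def loop_sum_def[symmetric] ennreal_log_def by auto
    then have "gurevich_seq t \<phi> a n = ereal (ln (w n) / real n)" using n by simp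
    moreover have "ln (p * p / 2 / K * l ^ n) \<le> ln (w n)" using w_low pl w0 by simp
    moreover have "ln (p * p / 2 / K * l ^ n) = ln (p * p / 2 / K) + real n * ln l"
      using p K l by (subst ln_mult_pos) (auto simp: ln_realpow)
    moreover have "ln (w n) \<le> ln (K * l ^ n)" using w_up w0 K l by simp
    moreover have "ln (K * l ^ n) = ln K + real n * ln l"
      using K l by (subst ln_mult_pos) (auto simp: ln_realpow)
    ultimately show ?case using n by simp
  qed
  have lim: "(\<lambda>n. c / real n + ln l) \<longlonglongrightarrow> ln l" for c
    using tendsto_add[OF lim_const_over_n[of c] tendsto_const[of "ln l"]] by simp
  have "(\<lambda>n. ln (w n) / real n) \<longlonglongrightarrow> ln l"
  proof (rule tendsto_sandwich[OF _ _ lim lim])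
    show "\<forall>\<^sub>F n in sequentially. ln (p * p / 2 / K) / real n + ln l \<le> ln (w n) / real n"
      using ev2
    proof eventually_elim
      case (elim n)
      then have "(ln (p * p / 2 / K) + real n * ln l) / real n \<le> ln (w n) / real n" by (intro divide_right_mono) auto
      then show ?case using elim by (simp add: add_divide_distrib)
    qed
    show "\<forall>\<^sub>F n in sequentially. ln (w n) / real n \<le> ln K / real n + ln l"
      using ev2
    proof eventually_elim
      case (elim n)
      then have "ln (w n) / real n \<le> (ln K + real n * ln l) / real n" by (intro divide_right_mono) auto
      then show ?case using elim by (simp add: add_divide_distrib)
    qed
  qed
  then have "(\<lambda>n. ereal (ln (w n) / real n)) \<longlonglongrightarrow> ereal (ln l)" by simp
  then show ?thesis
    by (rule Lim_transform_eventually) (use ev2 in \<open>auto elim: eventually_mono\<close>)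
qed

end


section \<open>Entropy\<close>

context prob_space
begin

definition pr :: "('a \<Rightarrow> 'c) \<Rightarrow> 'c \<Rightarrow> real" where
  "pr X z = prob {x \<in> space M. X x = z}"

text \<open>Entropy as the integral of the information function rather than a sum over cells;
  invariance and Gibbs' inequality can then be applied under the integral.\<close>

definition ent :: "('a \<Rightarrow> 'c) \<Rightarrow> real" where
  "ent X = - (\<integral>x. ln (pr X (X x)) \<partial>M)"

lemma label_sets:
  assumes "X \<in> measurable M (count_space UNIV)"
  shows "{x \<in> space M. X x = z} \<in> sets M"
  using measurable_sets[OF assms, of "{z}"] by (simp add: vimage_def Int_def conj_commute)

lemma pr_bounds: "0 \<le> pr X z" "pr X z \<le> 1"
  by (simp_all add: pr_def)

lemma nn_integral_discrete:
  fixes X :: "'a \<Rightarrow> 'c::countable"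
  assumes X: "X \<in> measurable M (count_space UNIV)"
  shows "(\<integral>\<^sup>+x. F (X x) \<partial>M) = (\<integral>\<^sup>+c. F c * ennreal (pr X c) \<partial>count_space UNIV)"
proof -
  have "(\<integral>\<^sup>+x. F (X x) \<partial>M) = (\<integral>\<^sup>+x. (\<integral>\<^sup>+c. F c * indicator {y \<in> space M. X y = c} x \<partial>count_space UNIV) \<partial>M)"
  proof (rule nn_integral_cong)
    fix x assume x: "x \<in> space M"
    have "(\<integral>\<^sup>+c. F c * indicator {y \<in> space M. X y = c} x \<partial>count_space UNIV) = (\<integral>\<^sup>+c. (if X x = c then F c else 0) \<partial>count_space UNIV)"
      using x by (intro nn_integral_cong) (auto simp: indicator_def)
    then show "F (X x) = (\<integral>\<^sup>+c. F c * indicator {y \<in> space M. X y = c} x \<partial>count_space UNIV)"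
      by (simp only: nn_integral_count_space_select)
  qed
  also have "\<dots> = (\<integral>\<^sup>+c. (\<integral>\<^sup>+x. F c * indicator {y \<in> space M. X y = c} x \<partial>M) \<partial>count_space UNIV)"
    using label_sets[OF X] by (intro nn_integral_count_space_nn_integral) auto
  also have "\<dots> = (\<integral>\<^sup>+c. F c * ennreal (pr X c) \<partial>count_space UNIV)"
    using label_sets[OF X] by (intro nn_integral_cong) (simp add: nn_integral_cmult_indicator pr_def emeasure_eq_measure)
  finally show ?thesis .
qed

lemma pr_total:
  fixes X :: "'a \<Rightarrow> 'c::countable"
  assumes X: "X \<in> measurable M (count_space UNIV)"
  shows "(\<integral>\<^sup>+c. ennreal (pr X c) \<partial>count_space UNIV) = 1"
  using nn_integral_discrete[OF X, of "\<lambda>_. 1"] by (simp add: emeasure_space_1)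

lemma AE_pr_pos:
  fixes X :: "'a \<Rightarrow> 'c::countable"
  assumes X: "X \<in> measurable M (count_space UNIV)"
  shows "AE x in M. 0 < pr X (X x)"
proof -
  have "(\<Union>c\<in>{c. pr X c = 0}. {x \<in> space M. X x = c}) \<in> null_sets M"
    using label_sets[OF X] by (intro null_sets_UN') (auto simp: null_sets_def pr_def emeasure_eq_measure)
  then show ?thesis
    by (rule AE_I') (use pr_bounds(1)[of X] in \<open>auto simp: less_le\<close>)
qed

text \<open>This is \<open>ln h \<le> h - 1\<close> for the likelihood ratio \<open>h\<close>. The
  integrable minorant \<open>g\<close> stands in for \<open>ln h\<close>, which itself may fail to
  be integrable.\<close>

theorem gibbs_inequality:
  fixes X :: "'a \<Rightarrow> 'c::countable"
  assumes X: "X \<in> measurable M (count_space UNIV)"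
    and q: "\<And>c. 0 \<le> q c" "(\<integral>\<^sup>+c. ennreal (q c) \<partial>count_space UNIV) \<le> 1"
    and g: "integrable M g" "AE x in M. 0 < q (X x) \<and> g x \<le> ln (q (X x) / pr X (X x))"
  shows "integral\<^sup>L M g \<le> 0"
proof -
  define h where "h x = q (X x) / pr X (X x)" for x
  have h0: "0 \<le> h x" for x unfolding h_def using q(1) by (simp add: pr_bounds)
  have hm: "h \<in> borel_measurable M"
    unfolding h_def by (rule measurable_compose[OF X]) simp
  have "(\<integral>\<^sup>+x. ennreal (h x) \<partial>M) = (\<integral>\<^sup>+c. ennreal (q c / pr X c) * ennreal (pr X c) \<partial>count_space UNIV)"
    unfolding h_def by (rule nn_integral_discrete[OF X])
  also have "\<dots> \<le> (\<integral>\<^sup>+c. ennreal (q c) \<partial>count_space UNIV)"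
    using q(1) pr_bounds(1)[of X] by (intro nn_integral_mono) (auto simp: ennreal_mult[symmetric] intro!: ennreal_leI)
  also have "\<dots> \<le> 1" by (rule q(2))
  finally have hi: "(\<integral>\<^sup>+x. ennreal (h x) \<partial>M) \<le> 1" .
  then have fin: "(\<integral>\<^sup>+x. ennreal (h x) \<partial>M) < \<infinity>"
    by (metis ennreal_one_less_top infinity_ennreal_def le_less_trans)
  have h_int: "integrable M h"
    by (rule integrableI_nonneg[OF hm _ fin]) (simp add: h0)
  have "ennreal (integral\<^sup>L M h) \<le> 1"
    using hi nn_integral_eq_integral[OF h_int] h0 by simp
  then have "integral\<^sup>L M h \<le> 1" by (simp add: ennreal_le_1)
  moreover have "integral\<^sup>L M g \<le> integral\<^sup>L M (\<lambda>x. h x - 1)"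
  proof (rule integral_mono_AE[OF g(1)])
    show "integrable M (\<lambda>x. h x - 1)" using h_int by simp
    show "AE x in M. g x \<le> h x - 1"
      using g(2) AE_pr_pos[OF X]
    proof eventually_elim
      case (elim x)
      then have "0 < h x" by (simp add: h_def)
      then have "ln (h x) \<le> h x - 1" by (rule ln_le_minus_one)
      then show ?case using elim by (simp add: h_def)
    qed
  qed
  moreover have "integral\<^sup>L M (\<lambda>x. h x - 1) = integral\<^sup>L M h - 1"
    using h_int by (simp add: prob_space)
  ultimately show ?thesis by linarith
qed

lemma integrable_finite_label:
  fixes f :: "'c \<Rightarrow> real"
  assumes X: "X \<in> measurable M (count_space UNIV)" and fin: "finite (X ` space M)"
  shows "integrable M (\<lambda>x. f (X x))"
proof (rule integrable_const_bound[where B="Max ((\<lambda>c. \<bar>f c\<bar>) ` (X ` space M))"])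
  show "AE x in M. norm (f (X x)) \<le> Max ((\<lambda>c. \<bar>f c\<bar>) ` (X ` space M))"
    using fin by (intro AE_I2) (auto intro!: Max_ge)
  show "(\<lambda>x. f (X x)) \<in> borel_measurable M" by (rule measurable_compose[OF X]) simp
qed

lemma ent_sum:
  assumes X: "X \<in> measurable M (count_space UNIV)" and fin: "finite (X ` space M)"
  shows "ent X = - (\<Sum>z\<in>X ` space M. pr X z * ln (pr X z))"
proof -
  have "(\<integral>x. ln (pr X (X x)) \<partial>M) = (\<integral>x. (\<Sum>z\<in>X ` space M. ln (pr X z) * indicator {y \<in> space M. X y = z} x) \<partial>M)"
  proof (rule Bochner_Integration.integral_cong[OF refl])
    fix x assume x: "x \<in> space M"
    have "(\<Sum>z\<in>X ` space M. ln (pr X z) * indicator {y \<in> space M. X y = z} x) = (\<Sum>z\<in>X ` space M. if X x = z then ln (pr X z) else 0)"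
      using x by (intro sum.cong) (auto simp: indicator_def)
    also have "\<dots> = ln (pr X (X x))" using x fin by (simp add: sum.delta)
    finally show "ln (pr X (X x)) = (\<Sum>z\<in>X ` space M. ln (pr X z) * indicator {y \<in> space M. X y = z} x)" by simp
  qed
  also have "\<dots> = (\<Sum>z\<in>X ` space M. ln (pr X z) * pr X z)"
    using label_sets[OF X] by (subst Bochner_Integration.integral_sum) (auto simp: pr_def emeasure_eq_measure)
  finally show ?thesis by (simp add: ent_def mult.commute)
qed

lemma ent_nonneg: "0 \<le> ent X"
proof -
  have "(\<integral>x. ln (pr X (X x)) \<partial>M) \<le> 0"
  proof (cases "integrable M (\<lambda>x. ln (pr X (X x)))")
    case True
    have "ln (pr X z) \<le> 0" for z using pr_bounds[of X z] by (cases "pr X z = 0") auto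
    then have "(\<integral>x. ln (pr X (X x)) \<partial>M) \<le> (\<integral>x. 0 \<partial>M)" using True by (intro integral_mono) auto
    then show ?thesis by simp
  qed (simp add: not_integrable_integral_eq)
  then show ?thesis by (simp add: ent_def)
qed

end

text \<open>A finite measurable partition coded by a label map, so that the cells of its iterated
  joins become lists of labels.\<close>

locale labelled_system =
  fixes t :: "nat \<Rightarrow> nat \<Rightarrow> bool" and \<mu> :: "(nat \<Rightarrow> nat) measure" and lab :: "(nat \<Rightarrow> nat) \<Rightarrow> nat"
  assumes inv: "\<mu> \<in> invariant_measures t"
    and lab_meas: "lab \<in> measurable (borel_shift t) (count_space UNIV)"
    and lab_fin: "finite (lab ` shift_space t)"
begin

sublocale prob_space \<mu> by (rule invariant_measures_prob[OF inv])

lemmas sets_mu[measurable_cong] = invariant_measures_sets[OF inv] and space_mu = invariant_measures_space[OF inv]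

definition name :: "nat \<Rightarrow> (nat \<Rightarrow> nat) \<Rightarrow> nat list" where
  "name n x = map (\<lambda>i. lab ((shift_map ^^ i) x)) [0..<n]"

lemma length_name[simp]: "length (name n x) = n"
  by (simp add: name_def)

lemma name_add: "name (n + m) x = name n x @ name m ((shift_map ^^ n) x)"
  by (rule nth_equalityI) (auto simp: name_def nth_append shift_map_funpow algebra_simps)

lemma lab_shift_meas: "(\<lambda>x. lab ((shift_map ^^ i) x)) \<in> measurable \<mu> (count_space UNIV)"
  unfolding measurable_cong_sets[OF sets_mu refl]
  by (rule measurable_compose[OF measurable_shift_funpow lab_meas])

lemma name_meas: "name n \<in> measurable \<mu> (count_space UNIV)"
proof (rule measurable_count_space_eq2_countable[THEN iffD2], intro conjI ballI)
  fix z :: "nat list"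
  have "name n -` {z} \<inter> space \<mu> =
      (if length z = n then {x \<in> space \<mu>. \<forall>i\<in>{..<n}. lab ((shift_map ^^ i) x) = z ! i} else {})"
    by (auto simp: name_def map_upt_eq_iff)
  moreover have "{x \<in> space \<mu>. \<forall>i\<in>{..<n}. lab ((shift_map ^^ i) x) = z ! i} \<in> sets \<mu>"
    by (rule sets.sets_Collect_finite_All) (auto intro: label_sets lab_shift_meas)
  ultimately show "name n -` {z} \<inter> space \<mu> \<in> sets \<mu>" by simp
qed auto

lemma name_range: "name n ` space \<mu> \<subseteq> {z. set z \<subseteq> lab ` shift_space t \<and> length z = n}"
  by (auto simp: name_def space_mu)

lemma name_fin: "finite (name n ` space \<mu>)"
  by (rule finite_subset[OF name_range finite_lists_length_eq[OF lab_fin]])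

lemma integral_shift:
  fixes f :: "(nat \<Rightarrow> nat) \<Rightarrow> real"
  assumes f: "f \<in> borel_measurable \<mu>"
  shows "(\<integral>x. f ((shift_map ^^ n) x) \<partial>\<mu>) = (\<integral>x. f x \<partial>\<mu>)"
    and "integrable \<mu> f \<Longrightarrow> integrable \<mu> (\<lambda>x. f ((shift_map ^^ n) x))"
proof -
  have m: "shift_map ^^ n \<in> measurable \<mu> \<mu>"
    unfolding measurable_cong_sets[OF sets_mu sets_mu] by (rule measurable_shift_funpow)
  have d: "distr \<mu> \<mu> (shift_map ^^ n) = \<mu>"
    using invariant_funpow[OF inv] by (intro measure_eqI) (auto simp: emeasure_distr[OF m])
  show "(\<integral>x. f ((shift_map ^^ n) x) \<partial>\<mu>) = (\<integral>x. f x \<partial>\<mu>)"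
    using integral_distr[OF m f] d by simp
  show "integrable \<mu> (\<lambda>x. f ((shift_map ^^ n) x))" if "integrable \<mu> f"
    using integrable_distr[OF m, of f] d that by simp
qed

text \<open>Gibbs' inequality for the pair of names, with the product of the two marginal laws as
  competitor.\<close>

lemma ent_name_subadd: "ent (name (n + m)) \<le> ent (name n) + ent (name m)"
proof -
  define X where "X x = (name n x, name m ((shift_map ^^ n) x))" for x
  have nm: "(\<lambda>x. name m ((shift_map ^^ n) x)) \<in> measurable \<mu> (count_space UNIV)"
  proof -
    have "shift_map ^^ n \<in> measurable \<mu> \<mu>"
      unfolding measurable_cong_sets[OF sets_mu sets_mu] by (rule measurable_shift_funpow)
    from measurable_compose[OF this name_meas] show ?thesis .
  qed
  have X: "X \<in> measurable \<mu> (count_space UNIV)"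
    using measurable_Pair[OF name_meas[of n] nm] unfolding X_def[abs_def]
    by (simp add: pair_measure_countable)
  define q where "q = (\<lambda>(a, b). pr (name n) a * pr (name m) b)"
  define g where "g x = ln (pr (name n) (name n x)) + ln (pr (name m) (name m ((shift_map ^^ n) x))) - ln (pr (name (n + m)) (name (n + m) x))" for x
  have i1: "integrable \<mu> (\<lambda>x. ln (pr (name k) (name k x)))" for k
    by (rule integrable_finite_label[OF name_meas name_fin])
  have b1: "(\<lambda>x. ln (pr (name k) (name k x))) \<in> borel_measurable \<mu>" for k
    using i1 by (rule borel_measurable_integrable)
  have i2: "integrable \<mu> (\<lambda>x. ln (pr (name m) (name m ((shift_map ^^ n) x))))"
    using integral_shift(2)[OF b1 i1] .
  have prX: "pr X (X x) = pr (name (n + m)) (name (n + m) x)" for x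
    unfolding pr_def X_def by (rule arg_cong[where f=prob]) (auto simp: name_add)
  have "integral\<^sup>L \<mu> g \<le> 0"
  proof (rule gibbs_inequality[OF X])
    show "0 \<le> q c" for c by (auto simp: q_def pr_bounds split: prod.split)
    have "(\<integral>\<^sup>+c. ennreal (q c) \<partial>count_space UNIV) = (\<integral>\<^sup>+a. (\<integral>\<^sup>+b. ennreal (pr (name n) a) * ennreal (pr (name m) b) \<partial>count_space UNIV) \<partial>count_space UNIV)"
      by (subst nn_integral_fst_count_space[symmetric]) (simp add: q_def ennreal_mult pr_bounds)
    also have "\<dots> = 1"
      by (simp add: nn_integral_cmult pr_total[OF name_meas])
    finally show "(\<integral>\<^sup>+c. ennreal (q c) \<partial>count_space UNIV) \<le> 1" by simp
    show "integrable \<mu> g" unfolding g_def using i1 i2 by auto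
    have "AE x in \<mu>. 0 < pr (name m) (name m ((shift_map ^^ n) x))"
    proof -
      have d: "distr \<mu> \<mu> (shift_map ^^ n) = \<mu>" and ms: "shift_map ^^ n \<in> measurable \<mu> \<mu>"
        using invariant_funpow[OF inv] measurable_shift_funpow measurable_cong_sets[OF sets_mu sets_mu]
        by (auto intro!: measure_eqI simp: emeasure_distr)
      have P: "{x \<in> space \<mu>. 0 < pr (name m) (name m x)} \<in> sets \<mu>"
        using measurable_sets[OF name_meas, of "{z. 0 < pr (name m) z}" m] by (simp add: vimage_def Int_def conj_commute)
      have "AE x in distr \<mu> \<mu> (shift_map ^^ n). 0 < pr (name m) (name m x)"
        unfolding d by (rule AE_pr_pos[OF name_meas])
      then show ?thesis by (subst (asm) AE_distr_iff[OF ms P])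
    qed
    with AE_pr_pos[OF name_meas[of n]] AE_pr_pos[OF name_meas[of "n + m"]]
    show "AE x in \<mu>. 0 < q (X x) \<and> g x \<le> ln (q (X x) / pr X (X x))"
    proof eventually_elim
      case (elim x)
      have q: "q (X x) = pr (name n) (name n x) * pr (name m) (name m ((shift_map ^^ n) x))" by (simp add: q_def X_def)
      show ?case unfolding prX q g_def using elim by (simp add: ln_div ln_mult_pos)
    qed
  qed
  moreover have "integral\<^sup>L \<mu> g = - ent (name n) - ent (name m) + ent (name (n + m))"
    unfolding g_def ent_def using i1 i2 integral_shift(1)[OF b1, of m n] by simp
  ultimately show ?thesis by linarith
qed

lemma ent_name_limit: "\<exists>h. (\<lambda>n. ent (name n) / real n) \<longlonglongrightarrow> h"
  using fekete[of "\<lambda>n. ent (name n)" 0] ent_name_subadd ent_nonneg by auto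

definition rate :: real where "rate = lim (\<lambda>n. ent (name n) / real n)"

lemma rate: "(\<lambda>n. ent (name n) / real n) \<longlonglongrightarrow> rate"
  unfolding rate_def using ent_name_limit by (simp add: convergent_LIMSEQ_iff[symmetric] convergent_def)

definition cells :: "(nat \<Rightarrow> nat) set set" where
  "cells = (\<lambda>z. {x \<in> space \<mu>. lab x = z}) ` (lab ` space \<mu>)"

lemma cells_partition: "finite_measurable_partition \<mu> cells"
  unfolding finite_measurable_partition_def
proof (intro conjI)
  show "finite cells" unfolding cells_def using lab_fin by (simp add: space_mu)
  have "lab \<in> measurable \<mu> (count_space UNIV)" using lab_shift_meas[of 0] by simp
  then show "cells \<subseteq> sets \<mu>" unfolding cells_def using label_sets[of lab] by blast
  show "partition_on (space \<mu>) cells"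
    unfolding cells_def by (rule partition_onI) (auto simp: disjnt_iff)
qed

text \<open>For \<open>n = 0\<close> the intersection over an empty family is \<open>UNIV\<close>,
  in general not \<open>space \<mu>\<close>. Different times may give the same partition, so the
  choice functions are indexed by partitions and not by times; uniqueness of the cell containing a
  point (\<open>D_un\<close>) bridges the two.\<close>

lemma iterated_cells:
  assumes n: "1 \<le> n"
  shows "iterated_partition \<mu> shift_map cells n = (\<lambda>z. {x \<in> space \<mu>. name n x = z}) ` (name n ` space \<mu>)"
proof -
  define P where "P i = (\<lambda>B. (shift_map ^^ i) -` B \<inter> space \<mu>) ` cells" for i
  have it: "iterated_partition \<mu> shift_map cells n = (\<Union>f\<in>(\<Pi> Q\<in>P ` {..<n}. Q). {\<Inter> (f ` (P ` {..<n}))}) - {{}}"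
    unfolding iterated_partition_def common_refinement P_def by simp
  define D where "D i x = {y \<in> space \<mu>. lab ((shift_map ^^ i) y) = lab ((shift_map ^^ i) x)}" for i x
  have D_in: "D i x \<in> P i" if "x \<in> space \<mu>" for i x
  proof -
    have xi: "(shift_map ^^ i) x \<in> space \<mu>" using that by (simp add: space_mu)
    have eq: "D i x = (shift_map ^^ i) -` {y \<in> space \<mu>. lab y = lab ((shift_map ^^ i) x)} \<inter> space \<mu>"
      using shift_map_funpow_in by (auto simp: D_def space_mu)
    have "{y \<in> space \<mu>. lab y = lab ((shift_map ^^ i) x)} \<in> cells"
      unfolding cells_def by (rule imageI, rule imageI, rule xi)
    then show ?thesis unfolding P_def eq by (rule imageI)
  qed
  have D_un: "B = D i x" if "B \<in> P i" "x \<in> B" for B i x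
    using that shift_map_funpow_in by (auto simp: P_def cells_def D_def space_mu)
  have name_eq: "{y \<in> space \<mu>. name n y = name n x} = (\<Inter>i<n. D i x)" if "x \<in> space \<mu>" for x
  proof -
    have "0 \<in> {..<n}" using n by simp
    then show ?thesis using that unfolding name_def D_def by auto
  qed
  show ?thesis
  proof (intro equalityI subsetI)
    fix B assume "B \<in> iterated_partition \<mu> shift_map cells n"
    then obtain f where f: "f \<in> (\<Pi> Q\<in>P ` {..<n}. Q)" "B = \<Inter> (f ` (P ` {..<n}))" "B \<noteq> {}"
      unfolding it by blast
    obtain x where x: "x \<in> B" using f(3) by blast
    have fP: "f (P i) = D i x" if "i < n" for i
      using f x that by (intro D_un) auto
    then have xs: "x \<in> space \<mu>" using x n f(2) unfolding D_def by fastforce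
    have "B = (\<Inter>i<n. D i x)" using f(2) fP by auto
    then show "B \<in> (\<lambda>z. {x \<in> space \<mu>. name n x = z}) ` (name n ` space \<mu>)"
      using name_eq[OF xs] xs by blast
  next
    fix B assume "B \<in> (\<lambda>z. {x \<in> space \<mu>. name n x = z}) ` (name n ` space \<mu>)"
    then obtain x where x: "x \<in> space \<mu>" "B = {y \<in> space \<mu>. name n y = name n x}" by auto
    define f where "f Q = (SOME R. R \<in> Q \<and> x \<in> R)" for Q :: "(nat \<Rightarrow> nat) set set"
    have fP: "f (P i) \<in> P i \<and> x \<in> f (P i)" for i
      unfolding f_def by (rule someI[of _ "D i x"]) (use D_in[OF x(1)] x(1) in \<open>auto simp: D_def\<close>)
    then have "f (P i) = D i x" for i using D_un by blast
    then have "B = \<Inter> (f ` (P ` {..<n}))" using x name_eq by auto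
    moreover have "B \<noteq> {}" using x by auto
    moreover have "f \<in> (\<Pi> Q\<in>P ` {..<n}. Q)" using fP by auto
    ultimately show "B \<in> iterated_partition \<mu> shift_map cells n" unfolding it by blast
  qed
qed

lemma partition_entropy_cells:
  assumes n: "1 \<le> n"
  shows "partition_entropy \<mu> (iterated_partition \<mu> shift_map cells n) = ent (name n)"
proof -
  have "inj_on (\<lambda>z. {x \<in> space \<mu>. name n x = z}) (name n ` space \<mu>)"
    by (auto simp: inj_on_def)
  then show ?thesis
    unfolding partition_entropy_def iterated_cells[OF n]
    by (simp add: sum.reindex ent_sum[OF name_meas name_fin] pr_def)
qed

lemma lim_partition_entropy:
  "lim (\<lambda>n. partition_entropy \<mu> (iterated_partition \<mu> shift_map cells n) / real n) = rate"
proof (rule limI)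
  have "\<forall>\<^sub>F n in sequentially. ent (name n) / real n = partition_entropy \<mu> (iterated_partition \<mu> shift_map cells n) / real n"
    using eventually_ge_at_top[of 1] by eventually_elim (simp add: partition_entropy_cells)
  then show "(\<lambda>n. partition_entropy \<mu> (iterated_partition \<mu> shift_map cells n) / real n) \<longlonglongrightarrow> rate"
    by (rule Lim_transform_eventually[OF rate])
qed

lemma rate_le_entropy: "ereal rate \<le> measure_entropy \<mu> shift_map"
  unfolding measure_entropy_def lim_partition_entropy[symmetric]
  by (rule SUP_upper) (simp add: cells_partition)

end

text \<open>Numbering its cells turns any finite partition into the level sets of a label
  map.\<close>

lemma measure_entropy_le:
  assumes inv: "\<mu> \<in> invariant_measures t"
    and le: "\<And>lab. labelled_system t \<mu> lab \<Longrightarrow> ereal (labelled_system.rate \<mu> lab) \<le> c"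
  shows "measure_entropy \<mu> shift_map \<le> c"
  unfolding measure_entropy_def
proof (rule SUP_least)
  note sp = invariant_measures_space[OF inv]
  fix \<alpha> assume "\<alpha> \<in> {\<alpha>. finite_measurable_partition \<mu> \<alpha>}"
  then have a: "finite \<alpha>" "\<alpha> \<subseteq> sets \<mu>" "partition_on (space \<mu>) \<alpha>" by (auto simp: finite_measurable_partition_def)
  define cell where "cell x = (THE B. B \<in> \<alpha> \<and> x \<in> B)" for x
  have cell: "cell x = B" if "B \<in> \<alpha>" "x \<in> B" for x B
    unfolding cell_def using that a(3) by (intro the_equality) (auto simp: partition_on_def disjoint_def)
  have cell_in: "cell x \<in> \<alpha> \<and> x \<in> cell x" if "x \<in> space \<mu>" for x
    using that a(3) cell by (metis UnionE partition_on_def)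
  define lab where "lab x = to_nat_on \<alpha> (cell x)" for x
  have inj: "inj_on (to_nat_on \<alpha>) \<alpha>" using a(1) by (intro inj_on_to_nat_on countable_finite)
  have lab_iff: "lab x = to_nat_on \<alpha> B \<longleftrightarrow> x \<in> B" if "x \<in> space \<mu>" "B \<in> \<alpha>" for x B
    using cell_in[OF that(1)] that inj cell unfolding lab_def by (metis inj_on_eq_iff)
  have lab_ran: "lab ` space \<mu> \<subseteq> to_nat_on \<alpha> ` \<alpha>" using cell_in by (auto simp: lab_def)
  have "labelled_system t \<mu> lab"
  proof
    show "\<mu> \<in> invariant_measures t" by (rule inv)
    show "finite (lab ` shift_space t)" using finite_subset[OF lab_ran] a(1) sp by simp
    show "lab \<in> measurable (borel_shift t) (count_space UNIV)"
    proof (rule measurable_count_space_eq2_countable[THEN iffD2], intro conjI ballI)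
      fix z :: nat
      have "lab -` {z} \<inter> space \<mu> = (if \<exists>B\<in>\<alpha>. z = to_nat_on \<alpha> B then (THE B. B \<in> \<alpha> \<and> z = to_nat_on \<alpha> B) else {})"
      proof (cases "\<exists>B\<in>\<alpha>. z = to_nat_on \<alpha> B")
        case True
        then obtain B where B: "B \<in> \<alpha>" "z = to_nat_on \<alpha> B" by blast
        have "(THE B. B \<in> \<alpha> \<and> z = to_nat_on \<alpha> B) = B"
          using B inj by (intro the_equality) (auto simp: inj_on_eq_iff)
        moreover have "lab -` {z} \<inter> space \<mu> = B"
          using lab_iff B a(2) sets.sets_into_space[of B \<mu>] by auto
        ultimately show ?thesis using True by simp
      next
        case False
        then show ?thesis using lab_ran by auto
      qed
      moreover have "(THE B. B \<in> \<alpha> \<and> z = to_nat_on \<alpha> B) \<in> sets \<mu>" if ex: "\<exists>B\<in>\<alpha>. z = to_nat_on \<alpha> B"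
      proof -
        obtain B where B: "B \<in> \<alpha>" "z = to_nat_on \<alpha> B" using ex by blast
        have "(THE B. B \<in> \<alpha> \<and> z = to_nat_on \<alpha> B) = B"
          using B inj by (intro the_equality) (auto simp: inj_on_eq_iff)
        then show ?thesis using B a(2) by auto
      qed
      ultimately show "lab -` {z} \<inter> space (borel_shift t) \<in> sets (borel_shift t)"
        using sp invariant_measures_sets[OF inv] by simp
    qed auto
  qed
  then interpret L: labelled_system t \<mu> lab .
  have "L.cells = \<alpha>"
  proof (intro equalityI subsetI)
    fix B assume "B \<in> L.cells"
    then obtain x where x: "x \<in> space \<mu>" "B = {y \<in> space \<mu>. lab y = lab x}" by (auto simp: L.cells_def)
    have "B = cell x" using x lab_iff[of _ "cell x"] cell_in[OF x(1)] a(2) sets.sets_into_space[of "cell x" \<mu>]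
      by (auto simp: lab_def)
    then show "B \<in> \<alpha>" using cell_in x by simp
  next
    fix B assume B: "B \<in> \<alpha>"
    then have "B \<noteq> {}" using a(3) by (auto simp: partition_on_def)
    then obtain x where x: "x \<in> B" by blast
    have Bsp: "B \<subseteq> space \<mu>" using B a(2) sets.sets_into_space[of B \<mu>] by auto
    then have xs: "x \<in> space \<mu>" using x by auto
    have lx: "lab x = to_nat_on \<alpha> B" using lab_iff[OF xs B] x by simp
    have "B = {y \<in> space \<mu>. lab y = lab x}"
      unfolding lx using lab_iff[OF _ B] Bsp by auto
    moreover have "{y \<in> space \<mu>. lab y = lab x} \<in> L.cells"
      unfolding L.cells_def by (rule imageI, rule imageI, rule xs)
    ultimately show "B \<in> L.cells" by simp
  qed
  then show "ereal (lim (\<lambda>n. partition_entropy \<mu> (iterated_partition \<mu> shift_map \<alpha> n) / real n)) \<le> c"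
    using L.lim_partition_entropy le[OF L.labelled_system_axioms] by simp
qed


section \<open>The upper bound in the variational principle\<close>

text \<open>The sets with this approximation property form a sigma-algebra that contains the
  cylinders.\<close>

lemma approx_by_prefix_sets:
  assumes inv: "\<mu> \<in> invariant_measures t" and E: "E \<in> sets \<mu>" and e: "0 < e"
  shows "\<exists>N W. measure \<mu> (sym_diff E {x \<in> shift_space t. map x [0..<N] \<in> W}) < e"
proof -
  interpret prob_space \<mu> by (rule invariant_measures_prob[OF inv])
  note sets_eq = invariant_measures_sets[OF inv] and sp = invariant_measures_space[OF inv]
  define C where "C N W = {x \<in> shift_space t. map x [0..<N] \<in> W}" for N :: nat and W
  have C_sets: "C N W \<in> sets \<mu>" for N W
    using measurable_sets[OF measurable_prefix[of N t], of W]
    by (simp add: C_def sets_eq vimage_def Int_def conj_commute)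
  have "E \<in> sigma_sets (shift_space t) (range (cylinder t))" using E sets_eq sets_borel_shift by auto
  then have "E \<in> sets \<mu> \<and> (\<forall>e>0. \<exists>N W. measure \<mu> (sym_diff E (C N W)) < e)"
  proof (induction rule: sigma_sets.induct)
    case (Basic a)
    then obtain w where w: "a = cylinder t w" by blast
    have "C (length w) {w} = a" by (auto simp: C_def w cylinder_iff_map)
    then have "measure \<mu> (sym_diff a (C (length w) {w})) = 0" by simp
    then show ?case using w sets_eq by (metis sets_cylinder)
  next
    case Empty
    have "C 0 {} = {}" by (simp add: C_def)
    then have "measure \<mu> (sym_diff {} (C 0 {})) = 0" by simp
    then show ?case by (metis sets.empty_sets)
  next
    case (Compl a)
    have sd: "sym_diff (shift_space t - a) (C N (- W)) = sym_diff a (C N W)" if "a \<subseteq> shift_space t" for N W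
      using that by (auto simp: C_def)
    have "a \<subseteq> shift_space t" using Compl.IH sets.sets_into_space[of a \<mu>] sp by auto
    then show ?case using Compl.IH sd sp by (metis sets.compl_sets)
  next
    case (Union a)
    have a: "a i \<in> sets \<mu>" for i using Union.IH by blast
    show ?case
    proof (intro conjI allI impI)
      show "(\<Union>i. a i) \<in> sets \<mu>" using a by auto
      fix e :: real assume e: "0 < e"
      have "(\<lambda>k. measure \<mu> (\<Union>i<k. a i)) \<longlonglongrightarrow> measure \<mu> (\<Union>k. \<Union>i<k. a i)"
      proof (rule finite_Lim_measure_incseq)
        show "range (\<lambda>k. \<Union>i<k. a i) \<subseteq> sets \<mu>" using a by (auto intro!: sets.finite_UN)
        show "incseq (\<lambda>k. \<Union>i<k. a i)"
          unfolding incseq_def by (intro allI impI UN_mono) auto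
      qed
      moreover have "(\<Union>k. \<Union>i<k. a i) = (\<Union>i. a i)" by auto
      ultimately have "(\<lambda>k. measure \<mu> (\<Union>i<k. a i)) \<longlonglongrightarrow> measure \<mu> (\<Union>i. a i)" by simp
      then have "\<forall>\<^sub>F k in sequentially. measure \<mu> (\<Union>i. a i) - e / 2 < measure \<mu> (\<Union>i<k. a i)"
        by (rule order_tendstoD(1)) (use e in simp)
      then obtain k where k: "measure \<mu> (\<Union>i. a i) - e / 2 < measure \<mu> (\<Union>i<k. a i)"
        by (auto simp: eventually_sequentially)
      have ek: "0 < e / (2 * (real k + 1))" using e by simp
      have "\<forall>i. \<exists>N W. measure \<mu> (sym_diff (a i) (C N W)) < e / (2 * (real k + 1))"
        using Union.IH ek by blast
      then obtain N W where NW: "\<And>i. measure \<mu> (sym_diff (a i) (C (N i) (W i))) < e / (2 * (real k + 1))" by metis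
      \<comment> \<open>A common prefix length for the first \<open>k\<close> approximants; the sum
        dominates each of the lengths.\<close>
      define N' where "N' = (\<Sum>i<k. N i)"
      have N': "N i \<le> N'" if "i < k" for i
        unfolding N'_def using that by (intro member_le_sum) auto
      define W' where "W' = {w. \<exists>i<k. take (N i) w \<in> W i}"
      have tk: "take (N i) (map x [0..<N']) = map x [0..<N i]" if "i < k" for i and x :: "nat \<Rightarrow> nat"
        using N'[OF that] by (simp add: take_map)
      have C': "C N' W' = (\<Union>i<k. C (N i) (W i))"
        using tk by (auto simp: C_def W'_def)
      have "sym_diff (\<Union>i. a i) (C N' W') \<subseteq> ((\<Union>i. a i) - (\<Union>i<k. a i)) \<union> (\<Union>i<k. sym_diff (a i) (C (N i) (W i)))"
        unfolding C' by blast
      then have "measure \<mu> (sym_diff (\<Union>i. a i) (C N' W')) \<le>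
          measure \<mu> (((\<Union>i. a i) - (\<Union>i<k. a i)) \<union> (\<Union>i<k. sym_diff (a i) (C (N i) (W i))))"
        using a C_sets by (intro finite_measure_mono) auto
      also have "\<dots> \<le> measure \<mu> ((\<Union>i. a i) - (\<Union>i<k. a i)) + measure \<mu> (\<Union>i<k. sym_diff (a i) (C (N i) (W i)))"
        using a C_sets by (intro measure_Un_le) auto
      also have "measure \<mu> ((\<Union>i. a i) - (\<Union>i<k. a i)) = measure \<mu> (\<Union>i. a i) - measure \<mu> (\<Union>i<k. a i)"
        using a by (intro finite_measure_Diff) auto
      also have "measure \<mu> (\<Union>i<k. sym_diff (a i) (C (N i) (W i))) \<le> (\<Sum>i<k. measure \<mu> (sym_diff (a i) (C (N i) (W i))))"
        using a C_sets by (intro finite_measure_subadditive_finite) auto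
      also have "\<dots> \<le> (\<Sum>i<k. e / (2 * (real k + 1)))" using NW by (intro sum_mono) (auto simp: less_imp_le)
      also have "\<dots> \<le> e / 2" using e by (simp add: field_simps)
      finally have "measure \<mu> (sym_diff (\<Union>i. a i) (C N' W')) < e" using k by linarith
      then show "\<exists>N W. measure \<mu> (sym_diff (\<Union>i. a i) (C N W)) < e" by (intro exI)
    qed
  qed
  then show ?thesis using e unfolding C_def by simp
qed

text \<open>Given the word, the weights of names used in \<open>entropy_upper_step\<close> are
  products of substochastic kernels; this bounds their total.\<close>

lemma sum_lists_prod_le_one:
  fixes \<kappa> :: "'a \<Rightarrow> 'b \<Rightarrow> real"
  assumes R: "finite R" and nn: "\<And>b b'. b \<in> R \<Longrightarrow> 0 \<le> \<kappa> b b'" and le: "\<And>b'. (\<Sum>b\<in>R. \<kappa> b b') \<le> 1"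
  shows "(\<Sum>z | set z \<subseteq> R \<and> length z = n. \<Prod>i<n. \<kappa> (z ! i) (b i)) \<le> 1"
proof (induction n arbitrary: b)
  case 0
  have "{z. set z \<subseteq> R \<and> length z = 0} = {[]}" by auto
  then show ?case by simp
next
  case (Suc n)
  let ?L = "{z. set z \<subseteq> R \<and> length z = n}"
  have set: "{z. set z \<subseteq> R \<and> length z = Suc n} = (\<lambda>(y, ys). y # ys) ` (R \<times> ?L)"
    by (auto simp: length_Suc_conv image_iff)
  have inj: "inj_on (\<lambda>(y, ys). y # ys) (R \<times> ?L)" by (auto simp: inj_on_def)
  have "(\<Sum>z | set z \<subseteq> R \<and> length z = Suc n. \<Prod>i<Suc n. \<kappa> (z ! i) (b i)) =
      (\<Sum>(y, ys)\<in>R \<times> ?L. \<kappa> y (b 0) * (\<Prod>i<n. \<kappa> (ys ! i) (b (Suc i))))"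
    unfolding set by (subst sum.reindex[OF inj]) (simp add: case_prod_unfold prod.lessThan_Suc_shift del: prod.lessThan_Suc)
  also have "\<dots> = (\<Sum>y\<in>R. \<kappa> y (b 0)) * (\<Sum>ys\<in>?L. \<Prod>i<n. \<kappa> (ys ! i) (b (Suc i)))"
    by (simp add: sum_product sum.cartesian_product)
  also have "\<dots> \<le> 1 * 1"
    using Suc.IH[of "\<lambda>i. b (Suc i)"] le[of "b 0"] nn
    by (intro mult_mono sum_nonneg prod_nonneg) (auto simp: subset_iff)
  finally show ?case by simp
qed

section \<open>Predicting labels from words, and the resulting entropy bound\<close>

context labelled_system
begin

text \<open>Each of the finitely many level sets is close to a prefix set, and off the union of the
  errors exactly one of these prefix sets contains the point; its index is the prediction
  \<open>a\<close>.\<close>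

lemma lab_approx:
  assumes d: "0 < d"
  shows "\<exists>N a. measure \<mu> {x \<in> space \<mu>. lab x \<noteq> a (map x [0..<N])} \<le> d"
proof -
  define R where "R = lab ` shift_space t"
  have R: "finite R" using lab_fin by (simp add: R_def)
  define E where "E b = {x \<in> space \<mu>. lab x = b}" for b
  have E: "E b \<in> sets \<mu>" for b
    unfolding E_def using lab_shift_meas[of 0] by (intro label_sets) simp
  have d': "0 < d / (real (card R) + 1)" using d by simp
  have "\<forall>b. \<exists>N W. measure \<mu> (sym_diff (E b) {x \<in> shift_space t. map x [0..<N] \<in> W}) < d / (real (card R) + 1)"
    using approx_by_prefix_sets[OF inv E d'] by blast
  from choice[OF this] obtain N where
    "\<forall>b. \<exists>W. measure \<mu> (sym_diff (E b) {x \<in> shift_space t. map x [0..<N b] \<in> W}) < d / (real (card R) + 1)" ..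
  from choice[OF this] obtain W where
    NW: "\<forall>b. measure \<mu> (sym_diff (E b) {x \<in> shift_space t. map x [0..<N b] \<in> W b}) < d / (real (card R) + 1)" ..
  define D where "D b = sym_diff (E b) {x \<in> shift_space t. map x [0..<N b] \<in> W b}" for b
  have D: "D b \<in> sets \<mu>" for b
    using E measurable_sets[OF measurable_prefix[of "N b" t], of "W b"] unfolding D_def
    by (auto simp: sets_mu vimage_def Int_def conj_commute)
  define N' where "N' = (\<Sum>b\<in>R. N b)"
  have N': "N b \<le> N'" if "b \<in> R" for b
    unfolding N'_def using that R by (intro member_le_sum) auto
  define a where "a w = (THE b. b \<in> R \<and> take (N b) w \<in> W b)" for w
  have tk: "take (N b) (map x [0..<N']) = map x [0..<N b]" if "b \<in> R" for b and x :: "nat \<Rightarrow> nat"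
    using N'[OF that] by (simp add: take_map)
  have "{x \<in> space \<mu>. lab x \<noteq> a (map x [0..<N'])} \<subseteq> (\<Union>b\<in>R. D b)"
  proof (rule subsetI, rule ccontr)
    fix x assume x: "x \<in> {x \<in> space \<mu>. lab x \<noteq> a (map x [0..<N'])}" and nx: "x \<notin> (\<Union>b\<in>R. D b)"
    have xs: "x \<in> shift_space t" using x by (simp add: space_mu)
    have iff: "map x [0..<N b] \<in> W b \<longleftrightarrow> lab x = b" if "b \<in> R" for b
    proof -
      have "x \<notin> D b" using nx that by simp
      then show ?thesis using xs unfolding D_def E_def space_mu by simp blast
    qed
    have inR: "lab x \<in> R" using xs by (simp add: R_def)
    have "a (map x [0..<N']) = lab x"
      unfolding a_def
    proof (rule the_equality)
      show "lab x \<in> R \<and> take (N (lab x)) (map x [0..<N']) \<in> W (lab x)"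
        using inR iff[OF inR] by (simp add: tk)
      fix b assume b: "b \<in> R \<and> take (N b) (map x [0..<N']) \<in> W b"
      then have "map x [0..<N b] \<in> W b" using tk[of b x] by simp
      then show "b = lab x" using iff b by simp
    qed
    with x show False by simp
  qed
  then have "measure \<mu> {x \<in> space \<mu>. lab x \<noteq> a (map x [0..<N'])} \<le> measure \<mu> (\<Union>b\<in>R. D b)"
    using D R by (intro finite_measure_mono) auto
  also have "\<dots> \<le> (\<Sum>b\<in>R. measure \<mu> (D b))"
    using D R by (intro finite_measure_subadditive_finite) auto
  also have "\<dots> \<le> (\<Sum>b\<in>R. d / (real (card R) + 1))"
    using NW unfolding D_def by (intro sum_mono less_imp_le) (rule spec)
  also have "\<dots> \<le> d" using d by (simp add: field_simps)
  finally show ?thesis by blast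
qed

lemma prefix_meas: "(\<lambda>x. map x [0..<n]) \<in> measurable \<mu> (count_space UNIV)"
  unfolding measurable_cong_sets[OF sets_mu refl] by (rule measurable_prefix)

text \<open>Gibbs' inequality for the joint label (partition name, word). The competing weight of a name given a
  word is the product of kernels putting mass \<open>1 - e\<close> on the letter predicted by \<open>a\<close> and \<open>e\<close> on the
  uniform distribution; this replaces the usual conditional entropy estimates.\<close>

lemma entropy_upper_step:
  assumes gs: "gibbs_state t \<phi> \<eta> K l"
    and int: "integrable \<mu> (\<lambda>x. ln (\<phi> (n + N) x))"
    and n: "1 \<le> n" and e: "0 < e" "e < 1"
    and a: "measure \<mu> {x \<in> space \<mu>. lab x \<noteq> a (map x [0..<N])} \<le> d"
  shows "ent (name n) + (\<integral>x. ln (\<phi> (n + N) x) \<partial>\<mu>) \<le>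
    ln K + real (n + N) * ln l + real n * (d * ln (real (card (lab ` shift_space t)) / e) - ln (1 - e))"
proof -
  interpret G: gibbs_state t \<phi> \<eta> K l by (rule gs)
  define R where "R = lab ` shift_space t"
  define k where "k = card R"
  \<comment> \<open>Predicting the label at time \<open>i < n\<close> reads the \<open>N\<close>
    letters from position \<open>i\<close> on, so words of length \<open>n + N\<close> are
    required.\<close>
  define m where "m = n + N"
  have R: "finite R" "R \<noteq> {}" using lab_fin not_empty by (auto simp: R_def space_mu)
  then have k: "1 \<le> real k" by (simp add: k_def Suc_le_eq card_gt_0_iff)
  \<comment> \<open>The uniform part keeps all weights positive, so a wrong prediction costs only
    \<open>ln (real k / e)\<close>. The sum over \<open>R\<close> drops below one when
    \<open>a\<close> predicts a value outside \<open>R\<close>.\<close>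
  define \<kappa> where "\<kappa> b b' = (if b = b' then 1 - e else 0) + e / real k" for b b' :: nat
  have \<kappa>0: "0 < \<kappa> b b'" for b b' using e k by (simp add: \<kappa>_def add_nonneg_pos)
  have \<kappa>_sum: "(\<Sum>b\<in>R. \<kappa> b b') \<le> 1" for b'
  proof -
    have "(\<Sum>b\<in>R. \<kappa> b b') = (\<Sum>b\<in>R. if b = b' then 1 - e else 0) + real k * (e / real k)"
      by (simp add: \<kappa>_def sum.distrib k_def)
    also have "\<dots> \<le> (1 - e) + e" using R e k by (intro add_mono) (auto simp: sum.delta)
    finally show ?thesis by simp
  qed
  define f where "f x = ln (\<kappa> (lab x) (a (map x [0..<N])))" for x
  define B where "B x \<longleftrightarrow> lab x = a (map x [0..<N])" for x
  have B_meas: "B \<in> measurable \<mu> (count_space UNIV)"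
  proof -
    have "(\<lambda>x. (lab x, map x [0..<N])) \<in> measurable \<mu> (count_space UNIV)"
      using measurable_Pair[OF lab_shift_meas[of 0] prefix_meas[of N]] by (simp add: pair_measure_countable)
    then have "(\<lambda>x. (\<lambda>(b, w). b = a w) (lab x, map x [0..<N])) \<in> measurable \<mu> (count_space UNIV)"
      by (rule measurable_compose) simp
    then show ?thesis by (simp add: B_def[abs_def])
  qed
  \<comment> \<open>\<open>f\<close> depends only on whether the prediction is right, so it is a
    function of a two-valued label and integrable.\<close>
  have f_eq: "f x = ln (if B x then 1 - e + e / real k else e / real k)" for x
    by (simp add: f_def \<kappa>_def B_def)
  have B_fin: "finite (B ` space \<mu>)" by (rule finite_subset[OF subset_UNIV]) simp
  have f_int: "integrable \<mu> f"
    unfolding f_eq[abs_def] by (rule integrable_finite_label[OF B_meas B_fin])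
  define c where "c = ln (real k / e)"
  have c: "0 \<le> c" using k e by (simp add: c_def)
  have f_low: "ln (1 - e) - d * c \<le> (\<integral>x. f x \<partial>\<mu>)"
  proof -
    define Q where "Q = {x \<in> space \<mu>. lab x \<noteq> a (map x [0..<N])}"
    have Q: "Q \<in> sets \<mu>"
    proof -
      have "Q = {x \<in> space \<mu>. B x = False}" by (auto simp: Q_def B_def)
      then show ?thesis using label_sets[OF B_meas, of False] by simp
    qed
    have "(\<integral>x. ln (1 - e) - c * indicator Q x \<partial>\<mu>) \<le> (\<integral>x. f x \<partial>\<mu>)"
    proof (rule integral_mono[OF _ f_int])
      show "integrable \<mu> (\<lambda>x. ln (1 - e) - c * indicator Q x)"
        by (intro Bochner_Integration.integrable_diff integrable_const integrable_mult_right integrable_real_indicator Q)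
          (simp add: emeasure_eq_measure)
      fix x assume x: "x \<in> space \<mu>"
      show "ln (1 - e) - c * indicator Q x \<le> f x"
      proof (cases "B x")
        case True
        have "0 < 1 - e" "0 \<le> e / real k" using e k by auto
        then have "ln (1 - e) \<le> ln (1 - e + e / real k)" by (subst ln_le_cancel_iff) linarith+
        then show ?thesis using True x by (simp add: f_eq Q_def B_def indicator_def)
      next
        case False
        have "- c = ln (e / real k)" using e k by (simp add: c_def ln_div)
        moreover have "ln (1 - e) \<le> 0" using e by simp
        ultimately show ?thesis using False x by (simp add: f_eq Q_def B_def indicator_def)
      qed
    qed
    also have "(\<integral>x. ln (1 - e) - c * indicator Q x \<partial>\<mu>) = ln (1 - e) - c * measure \<mu> Q"
    proof -
      have "integrable \<mu> (\<lambda>x. c * indicator Q x)"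
        by (intro integrable_mult_right integrable_real_indicator Q) (simp add: emeasure_eq_measure)
      then show ?thesis using Q by (simp add: prob_space)
    qed
    finally have "ln (1 - e) - c * measure \<mu> Q \<le> (\<integral>x. f x \<partial>\<mu>)" .
    moreover have "c * measure \<mu> Q \<le> c * d" using c a by (intro mult_left_mono) (auto simp: Q_def)
    ultimately show ?thesis by (simp add: mult.commute)
  qed
  define X where "X x = (name n x, map x [0..<m])" for x
  have X: "X \<in> measurable \<mu> (count_space UNIV)"
    using measurable_Pair[OF name_meas[of n] prefix_meas[of m]] unfolding X_def[abs_def]
    by (simp add: pair_measure_countable)
  define q where "q = (\<lambda>(z, w). if set z \<subseteq> R \<and> length z = n \<and> length w = m
      then measure \<eta> (cylinder t w) * (\<Prod>i<n. \<kappa> (z ! i) (a (take N (drop i w)))) else 0)"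
  \<comment> \<open>A minorant of \<open>ln (q / pr X)\<close>: the Gibbs bound trades the measure
    of the word for \<open>\<phi> m\<close>, and the joint probability is replaced by the larger
    probability of the name alone.\<close>
  define g where "g x = ln (\<phi> m x) - ln K - real m * ln l + (\<Sum>i<n. f ((shift_map ^^ i) x)) - ln (pr (name n) (name n x))" for x
  have i1: "integrable \<mu> (\<lambda>x. ln (pr (name n) (name n x)))"
    by (rule integrable_finite_label[OF name_meas name_fin])
  have i2: "integrable \<mu> (\<lambda>x. f ((shift_map ^^ i) x))" for i
    by (rule integral_shift(2)[OF borel_measurable_integrable[OF f_int] f_int])
  have intm: "integrable \<mu> (\<lambda>x. ln (\<phi> m x))" using int by (simp add: m_def)
  have "integral\<^sup>L \<mu> g \<le> 0"
  proof (rule gibbs_inequality[OF X])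
    show "0 \<le> q c" for c
      using \<kappa>0 by (auto simp: q_def less_imp_le intro!: mult_nonneg_nonneg prod_nonneg split: prod.split)
    have inner: "(\<integral>\<^sup>+z. ennreal (q (z, w)) \<partial>count_space UNIV) \<le> ennreal (G.pr (\<lambda>x. map x [0..<m]) w)" for w
    proof (cases "length w = m")
      case True
      let ?L = "{z. set z \<subseteq> R \<and> length z = n}"
      have fL: "finite ?L" by (rule finite_lists_length_eq[OF R(1)])
      have qn: "0 \<le> q (z, w)" for z
        using \<kappa>0 by (auto simp: q_def less_imp_le intro!: mult_nonneg_nonneg prod_nonneg)
      have "(\<integral>\<^sup>+z. ennreal (q (z, w)) \<partial>count_space UNIV) = (\<Sum>z\<in>?L. ennreal (q (z, w)))"
        by (rule nn_integral_count_space'[OF fL]) (auto simp: q_def)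
      also have "\<dots> = ennreal (\<Sum>z\<in>?L. q (z, w))" by (rule sum_ennreal) (rule qn)
      also have "(\<Sum>z\<in>?L. q (z, w)) = measure \<eta> (cylinder t w) * (\<Sum>z\<in>?L. \<Prod>i<n. \<kappa> (z ! i) (a (take N (drop i w))))"
        using True by (simp add: q_def sum_distrib_left)
      also have "\<dots> \<le> measure \<eta> (cylinder t w) * 1"
        using \<kappa>0 by (intro mult_left_mono sum_lists_prod_le_one R \<kappa>_sum) (auto simp: less_imp_le)
      also have "\<dots> = G.pr (\<lambda>x. map x [0..<m]) w"
        unfolding G.pr_def using True by (auto simp: cylinder_iff_map G.space_mu intro!: arg_cong[where f="measure \<eta>"])
      finally show ?thesis by (simp add: ennreal_leI)
    next
      case False
      then show ?thesis by (simp add: q_def)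
    qed
    have "(\<integral>\<^sup>+c. ennreal (q c) \<partial>count_space UNIV) = (\<integral>\<^sup>+z. (\<integral>\<^sup>+w. ennreal (q (z, w)) \<partial>count_space UNIV) \<partial>count_space UNIV)"
      by (rule nn_integral_fst_count_space[symmetric])
    also have "\<dots> = (\<integral>\<^sup>+w. (\<integral>\<^sup>+z. ennreal (q (z, w)) \<partial>count_space UNIV) \<partial>count_space UNIV)"
      by (rule nn_integral_count_space_swap)
    also have "\<dots> \<le> (\<integral>\<^sup>+w. ennreal (G.pr (\<lambda>x. map x [0..<m]) w) \<partial>count_space UNIV)"
      by (intro nn_integral_mono inner)
    also have "\<dots> = 1"
    proof (rule G.pr_total)
      show "(\<lambda>x. map x [0..<m]) \<in> measurable \<eta> (count_space UNIV)"
        unfolding measurable_cong_sets[OF G.sets_mu refl] by (rule measurable_prefix)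
    qed
    finally show "(\<integral>\<^sup>+c. ennreal (q c) \<partial>count_space UNIV) \<le> 1" .
    show "integrable \<mu> g" unfolding g_def using i1 i2 intm by auto
    show "AE x in \<mu>. 0 < q (X x) \<and> g x \<le> ln (q (X x) / pr X (X x))"
      using AE_pr_pos[OF X] AE_space
    proof eventually_elim
      case (elim x)
      have xs: "x \<in> shift_space t" using elim by (simp add: space_mu)
      have m1: "1 \<le> m" using n by (simp add: m_def)
      have cyl: "0 < measure \<eta> (cylinder t (map x [0..<m]))" by (rule G.cyl_pos[OF xs])
      have tk: "take N (drop i (map x [0..<m])) = map ((shift_map ^^ i) x) [0..<N]" if "i < n" for i
      proof (rule nth_equalityI)
        show "length (take N (drop i (map x [0..<m]))) = length (map ((shift_map ^^ i) x) [0..<N])"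
          using that by (simp add: m_def)
      qed (use that in \<open>auto simp: m_def shift_map_funpow\<close>)
      have nm: "set (name n x) \<subseteq> R" using xs by (auto simp: name_def R_def)
      have qX: "q (X x) = measure \<eta> (cylinder t (map x [0..<m])) * (\<Prod>i<n. \<kappa> (lab ((shift_map ^^ i) x)) (a (map ((shift_map ^^ i) x) [0..<N])))"
        using nm tk by (simp add: q_def X_def) (simp add: name_def)
      have prodpos: "0 < (\<Prod>i<n. \<kappa> (lab ((shift_map ^^ i) x)) (a (map ((shift_map ^^ i) x) [0..<N])))"
        using \<kappa>0 by (intro prod_pos) auto
      have qpos: "0 < q (X x)" unfolding qX using cyl prodpos by simp
      have lnq: "ln (q (X x)) = ln (measure \<eta> (cylinder t (map x [0..<m]))) + (\<Sum>i<n. f ((shift_map ^^ i) x))"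
        unfolding qX using cyl prodpos \<kappa>0 by (simp add: ln_mult_pos f_def) (subst ln_prod, auto simp: less_imp_neq[symmetric])
      have "\<phi> m x / l ^ m / K \<le> measure \<eta> (cylinder t (map x [0..<m]))"
        using G.lower[OF xs m1] by (subst pos_divide_le_eq[OF G.K]) (simp add: mult.commute)
      then have "ln (\<phi> m x / l ^ m / K) \<le> ln (measure \<eta> (cylinder t (map x [0..<m])))"
        using G.phi_pos[OF xs m1] G.K G.l cyl by (subst ln_le_cancel_iff) auto
      moreover have "ln (\<phi> m x / l ^ m / K) = ln (\<phi> m x) - real m * ln l - ln K"
        using G.phi_pos[OF xs m1] G.K G.l by (simp add: ln_div ln_realpow ln_mult_pos)
      moreover have "ln (pr X (X x)) \<le> ln (pr (name n) (name n x))"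
      proof -
        have "pr X (X x) \<le> pr (name n) (name n x)"
          unfolding pr_def X_def using label_sets[OF name_meas] by (intro finite_measure_mono) auto
        then show ?thesis using elim by simp
      qed
      ultimately have "g x \<le> ln (q (X x)) - ln (pr X (X x))" unfolding g_def lnq by linarith
      then show ?case using qpos elim by (simp add: ln_div)
    qed
  qed
  moreover have "integral\<^sup>L \<mu> g = (\<integral>x. ln (\<phi> m x) \<partial>\<mu>) - ln K - real m * ln l + real n * (\<integral>x. f x \<partial>\<mu>) + ent (name n)"
  proof -
    have "(\<integral>x. (\<Sum>i<n. f ((shift_map ^^ i) x)) \<partial>\<mu>) = real n * (\<integral>x. f x \<partial>\<mu>)"
      using i2 integral_shift(1)[OF borel_measurable_integrable[OF f_int]] by simp
    then show ?thesis unfolding g_def ent_def using i1 i2 intm by (simp add: prob_space)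
  qed
  moreover have "real n * (ln (1 - e) - d * c) \<le> real n * (\<integral>x. f x \<partial>\<mu>)"
    using f_low by (intro mult_left_mono) auto
  moreover have "real n * (d * c - ln (1 - e)) = - (real n * (ln (1 - e) - d * c))"
    by (simp add: algebra_simps)
  ultimately show ?thesis unfolding c_def k_def R_def m_def by linarith
qed

lemma extended_integral_eq:
  assumes "integrable \<mu> g" shows "extended_integral \<mu> g = ereal (\<integral>x. g x \<partial>\<mu>)"
proof -
  have fin: "(\<integral>\<^sup>+x. ennreal (g x) \<partial>\<mu>) \<noteq> \<infinity>" "(\<integral>\<^sup>+x. ennreal (- g x) \<partial>\<mu>) \<noteq> \<infinity>"
    using assms by (auto simp: real_integrable_def)
  have e: "enn2ereal z = ereal (enn2real z)" if "z \<noteq> \<infinity>" for z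
    using that by (cases z) auto
  show ?thesis
    unfolding extended_integral_def real_lebesgue_integral_def[OF assms] using fin by (simp add: e)
qed

text \<open>The upper bound makes the integral of the positive part finite; an infinite negative
  part would therefore force the extended integral to be \<open>-\<infinity>\<close>.\<close>

lemma integrable_from_extended:
  assumes m: "g \<in> borel_measurable \<mu>" and le: "\<And>x. x \<in> space \<mu> \<Longrightarrow> g x \<le> c"
    and ne: "extended_integral \<mu> g \<noteq> - \<infinity>"
  shows "integrable \<mu> g"
proof -
  have "(\<integral>\<^sup>+x. ennreal (g x) \<partial>\<mu>) \<le> (\<integral>\<^sup>+x. ennreal c \<partial>\<mu>)"
    using le by (intro nn_integral_mono ennreal_leI) auto
  also have "\<dots> < \<infinity>" by (simp add: emeasure_space_1)
  finally have p: "(\<integral>\<^sup>+x. ennreal (g x) \<partial>\<mu>) \<noteq> \<infinity>" by simp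
  have "(\<integral>\<^sup>+x. ennreal (- g x) \<partial>\<mu>) \<noteq> \<infinity>"
  proof
    assume "(\<integral>\<^sup>+x. ennreal (- g x) \<partial>\<mu>) = \<infinity>"
    then have "extended_integral \<mu> g = enn2ereal (\<integral>\<^sup>+x. ennreal (g x) \<partial>\<mu>) - \<infinity>"
      by (simp add: extended_integral_def)
    also have "\<dots> = - \<infinity>" using p by (cases "\<integral>\<^sup>+x. ennreal (g x) \<partial>\<mu>") auto
    finally show False using ne by simp
  qed
  then show ?thesis using m p by (simp add: real_integrable_def)
qed

text \<open>Dividing \<open>entropy_upper_step\<close> by \<open>n\<close> removes the constant
  \<open>K\<close> and the overhang \<open>N\<close> in the limit; what remains is the error per
  letter, which is made at most an arbitrary \<open>\<epsilon>\<close>.\<close>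

theorem rate_plus_energy_le:
  assumes gs: "gibbs_state t \<phi> \<eta> K l"
    and meas: "\<And>n. \<phi> n \<in> borel_measurable \<mu>"
    and L: "(\<lambda>n. extended_integral \<mu> (\<lambda>x. ln (\<phi> n x)) / ereal (real n)) \<longlonglongrightarrow> L" "L \<noteq> - \<infinity>"
  shows "ereal rate + L \<le> ereal (ln l)"
proof -
  interpret G: gibbs_state t \<phi> \<eta> K l by (rule gs)
  have ln_le: "ln (\<phi> n x) \<le> ln K + real n * ln l" if "x \<in> space \<mu>" "1 \<le> n" for n x
  proof -
    have "ln (\<phi> n x) \<le> ln (K * l ^ n)"
      using G.phi_le[of x n] G.phi_pos[of x n] that G.K G.l by (subst ln_le_cancel_iff) (auto simp: space_mu)
    then show ?thesis using G.K G.l by (simp add: ln_mult_pos ln_realpow)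
  qed
  have lm: "(\<lambda>x. ln (\<phi> n x)) \<in> borel_measurable \<mu>" for n using meas by simp
  define I where "I n = (\<integral>x. ln (\<phi> n x) \<partial>\<mu>)" for n
  have "\<forall>\<^sub>F n in sequentially. - \<infinity> < extended_integral \<mu> (\<lambda>x. ln (\<phi> n x)) / ereal (real n)"
    by (rule order_tendstoD(1)[OF L(1)]) (use L(2) in \<open>simp add: less_le\<close>)
  then have ev: "\<forall>\<^sub>F n in sequentially. integrable \<mu> (\<lambda>x. ln (\<phi> n x)) \<and> 1 \<le> n"
    using eventually_ge_at_top[of 1]
  proof eventually_elim
    case (elim n)
    then have "extended_integral \<mu> (\<lambda>x. ln (\<phi> n x)) \<noteq> - \<infinity>" by auto
    then show ?case using integrable_from_extended[OF lm, of n "ln K + real n * ln l"] ln_le elim by auto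
  qed
  then obtain n0 where n0: "\<And>n. n0 \<le> n \<Longrightarrow> integrable \<mu> (\<lambda>x. ln (\<phi> n x)) \<and> 1 \<le> n"
    by (auto simp: eventually_sequentially)
  have "(\<lambda>n. ereal (I n / real n)) \<longlonglongrightarrow> L"
  proof (rule Lim_transform_eventually[OF L(1)])
    show "\<forall>\<^sub>F n in sequentially. extended_integral \<mu> (\<lambda>x. ln (\<phi> n x)) / ereal (real n) = ereal (I n / real n)"
      using ev by eventually_elim (simp add: extended_integral_eq I_def)
  qed
  note IL = this
  have I_le: "I n / real n \<le> ln K / real n + ln l" if "n0 \<le> n" for n
  proof -
    have "I n \<le> (\<integral>x. ln K + real n * ln l \<partial>\<mu>)"
      unfolding I_def using n0[OF that] ln_le by (intro integral_mono) auto
    then have "I n \<le> ln K + real n * ln l" by (simp add: prob_space)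
    then have "I n / real n \<le> (ln K + real n * ln l) / real n" by (intro divide_right_mono) auto
    then show ?thesis using n0[OF that] by (simp add: add_divide_distrib)
  qed
  have "(\<lambda>n. ereal (ln K / real n + ln l)) \<longlonglongrightarrow> ereal (0 + ln l)"
    by (intro tendsto_ereal tendsto_add tendsto_const lim_const_over_n)
  then have "L \<le> ereal (0 + ln l)"
    by (rule LIMSEQ_le[OF IL]) (use I_le in auto)
  then obtain r where r: "L = ereal r" using L(2) by (cases L) auto
  have Ir: "(\<lambda>n. I n / real n) \<longlonglongrightarrow> r" using IL unfolding r by simp
  have key: "rate + r \<le> ln l + \<epsilon>" if \<epsilon>: "0 < \<epsilon>" for \<epsilon> :: real
  proof -
    \<comment> \<open>\<open>\<epsilon>\<close> is split in two: \<open>- ln (1 - e)\<close> is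
      exactly \<open>\<epsilon> / 2\<close>, and \<open>d\<close> below makes the cost of wrong
      predictions at most \<open>\<epsilon> / 2\<close>.\<close>
    define e where "e = 1 - exp (- (\<epsilon> / 2))"
    have e: "0 < e" "e < 1" "- ln (1 - e) = \<epsilon> / 2" using \<epsilon> by (simp_all add: e_def)
    define c where "c = \<bar>ln (real (card (lab ` shift_space t)) / e)\<bar>"
    define d where "d = \<epsilon> / 2 / (c + 1)"
    have d: "0 < d" using \<epsilon> by (simp add: d_def c_def)
    have dc: "d * ln (real (card (lab ` shift_space t)) / e) \<le> \<epsilon> / 2"
    proof -
      have "d * ln (real (card (lab ` shift_space t)) / e) \<le> d * (c + 1)"
        using d by (intro mult_left_mono) (auto simp: c_def)
      also have "\<dots> = \<epsilon> / 2"
      proof -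
        have "0 < c + 1" by (simp add: c_def add_nonneg_pos)
        then have "c + 1 \<noteq> 0" by simp
        then show ?thesis by (metis d_def nonzero_divide_eq_eq)
      qed
      finally show ?thesis .
    qed
    obtain N a where a: "measure \<mu> {x \<in> space \<mu>. lab x \<noteq> a (map x [0..<N])} \<le> d" using lab_approx[OF d] by blast
    have step: "ent (name n) / real n + I (n + N) / real (n + N) * (1 + real N / real n) \<le>
        ln K / real n + (1 + real N / real n) * ln l + \<epsilon>" if n: "max 1 n0 \<le> n" for n
    proof -
      have n1: "0 < real n" using n by simp
      have "ent (name n) + I (n + N) \<le> ln K + real (n + N) * ln l + real n * (d * ln (real (card (lab ` shift_space t)) / e) - ln (1 - e))"
        unfolding I_def using n n0[of "n + N"] e a by (intro entropy_upper_step[OF gs]) auto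
      also have "\<dots> \<le> ln K + real (n + N) * ln l + real n * \<epsilon>"
        using dc e(3) by (intro add_left_mono mult_left_mono) auto
      finally have "(ent (name n) + I (n + N)) / real n \<le> (ln K + real (n + N) * ln l + real n * \<epsilon>) / real n"
        by (intro divide_right_mono) auto
      moreover have "(ent (name n) + I (n + N)) / real n = ent (name n) / real n + I (n + N) / real (n + N) * (1 + real N / real n)"
      proof -
        have "1 + real N / real n = real (n + N) / real n" using n1 by (simp add: field_simps)
        moreover have "real (n + N) \<noteq> 0" using n1 by simp
        ultimately show ?thesis by (simp add: add_divide_distrib del: of_nat_add)
      qed
      moreover have "(ln K + real (n + N) * ln l + real n * \<epsilon>) / real n = ln K / real n + (1 + real N / real n) * ln l + \<epsilon>"
        using n1 by (simp add: field_simps)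
      ultimately show ?thesis by linarith
    qed
    have l1: "(\<lambda>n. 1 + real N / real n) \<longlonglongrightarrow> 1 + 0"
      by (intro tendsto_add tendsto_const lim_const_over_n)
    have l2: "(\<lambda>n. I (n + N) / real (n + N)) \<longlonglongrightarrow> r" by (rule LIMSEQ_ignore_initial_segment[OF Ir])
    have A: "(\<lambda>n. ent (name n) / real n + I (n + N) / real (n + N) * (1 + real N / real n)) \<longlonglongrightarrow> rate + r * (1 + 0)"
      by (intro tendsto_add[OF rate] tendsto_mult[OF l2] l1)
    have B: "(\<lambda>n. ln K / real n + (1 + real N / real n) * ln l + \<epsilon>) \<longlonglongrightarrow> 0 + (1 + 0) * ln l + \<epsilon>"
      by (intro tendsto_add tendsto_mult tendsto_const lim_const_over_n)
    have "rate + r * (1 + 0) \<le> 0 + (1 + 0) * ln l + \<epsilon>"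
      by (rule LIMSEQ_le[OF A B]) (use step in blast)
    then show ?thesis by simp
  qed
  then have "rate + r \<le> ln l" by (rule field_le_epsilon)
  then show ?thesis by (simp add: r)
qed

end


section \<open>Finite subsystems and the lower bound\<close>

lemma matrix_product_cong: "(\<And>i. i < n \<Longrightarrow> x i = y i) \<Longrightarrow> matrix_product A x n = matrix_product A y n"
  by (induction n) auto

text \<open>Makes the potential a function of a word, which yields measurability through the
  discrete space of words.\<close>

lemma mat_potential_prefix: "mat_potential A n x = mat_potential A n (\<lambda>i. map x [0..<n] ! i)"
  unfolding mat_potential_def by (subst matrix_product_cong[of n x "\<lambda>i. map x [0..<n] ! i"]) auto

lemma mat_potential_measurable:
  assumes "\<mu> \<in> invariant_measures t"
  shows "mat_potential A n \<in> borel_measurable \<mu>"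
proof -
  have "(\<lambda>x. (\<lambda>w. mat_potential A n (\<lambda>i. w ! i)) (map x [0..<n])) \<in> borel_measurable \<mu>"
    unfolding measurable_cong_sets[OF invariant_measures_sets[OF assms] refl]
    by (rule measurable_compose[OF measurable_prefix]) simp
  then show ?thesis unfolding mat_potential_prefix[symmetric] by simp
qed

context matrix_pf
begin

lemma gibbs_state_mu:
  assumes "F = UNIV" shows "gibbs_state t (mat_potential A) mu K l"
  by (unfold_locales; (rule mu(1) K l mat_potential_pos gibbs_bounds)?) (use assms in auto)

lemma AE_letters: "AE x in mu. \<forall>i. x i \<in> F"
proof (subst AE_all_countable, intro allI)
  fix n
  have "(\<Union>w\<in>{w. length w = Suc n \<and> w ! n \<notin> F}. cylinder t w) \<in> null_sets mu"
  proof (rule null_sets_UN')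
    fix w :: "nat list" assume w: "w \<in> {w. length w = Suc n \<and> w ! n \<notin> F}"
    interpret M: prob_space mu by (rule invariant_measures_prob[OF mu(1)])
    have "measure mu (cylinder t w) = 0"
    proof (cases "cylinder t w = {}")
      case False
      then obtain x where "x \<in> cylinder t w" by blast
      then have x: "x \<in> shift_space t" "w = map x [0..<Suc n]"
        using w by (auto simp: cylinder_iff_map simp del: upt_Suc)
      have "x n = w ! n" unfolding x(2) by (simp add: nth_append del: upt_Suc)
      then have "x n \<notin> F" using w by simp
      then show ?thesis using gibbs_bounds(3)[OF x(1), of "Suc n" n] x(2) by (simp del: upt_Suc)
    qed simp
    then show "cylinder t w \<in> null_sets mu"
      using invariant_measures_sets[OF mu(1)] by (simp add: null_sets_def M.emeasure_eq_measure)
  qed auto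
  then show "AE x in mu. x n \<in> F"
  proof (rule AE_I')
    show "{x \<in> space mu. x n \<notin> F} \<subseteq> (\<Union>w\<in>{w. length w = Suc n \<and> w ! n \<notin> F}. cylinder t w)"
    proof
      fix x assume "x \<in> {x \<in> space mu. x n \<notin> F}"
      then have "x \<in> shift_space t" "x n \<notin> F" using invariant_measures_space[OF mu(1)] by auto
      then show "x \<in> (\<Union>w\<in>{w. length w = Suc n \<and> w ! n \<notin> F}. cylinder t w)"
        by (intro UN_I[of "map x [0..<Suc n]"] in_cylinder_prefix) (auto simp: nth_append simp del: upt_Suc)
    qed
  qed
qed

text \<open>Almost surely all letters lie in the finite set \<open>F\<close>, so the partition by
  the first letter is finite and its names are words. The Gibbs bounds then make entropy plus energy
  of \<open>n\<close> letters at least \<open>n * ln l - ln K\<close>.\<close>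

theorem finite_subsystem_bound:
  assumes F: "finite F" and aa: "almost_additive t (mat_potential A)"
  shows "\<exists>L. (\<lambda>n. extended_integral mu (\<lambda>x. ln (mat_potential A n x)) / ereal (real n)) \<longlonglongrightarrow> L \<and>
    L \<noteq> - \<infinity> \<and> ereal (ln l) \<le> measure_entropy mu shift_map + L"
proof -
  \<comment> \<open>Letters outside \<open>F\<close> share one label, different from every letter of
    \<open>F\<close>; they occur with probability zero, but the label map is defined on the whole
    shift space.\<close>
  define lab where "lab x = (if x 0 \<in> F then x 0 else Suc (Max F))" for x :: "nat \<Rightarrow> nat"
  have "labelled_system t mu lab"
  proof
    show "mu \<in> invariant_measures t" by (rule mu(1))
    have "(\<lambda>x. (\<lambda>i. if i \<in> F then i else Suc (Max F)) (x 0)) \<in> measurable (borel_shift t) (count_space UNIV)"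
      by (rule measurable_compose[OF measurable_coordinate]) simp
    then show "lab \<in> measurable (borel_shift t) (count_space UNIV)" by (simp add: lab_def[abs_def])
    have "lab ` shift_space t \<subseteq> insert (Suc (Max F)) F" by (auto simp: lab_def)
    then show "finite (lab ` shift_space t)" by (rule finite_subset) (use F in simp)
  qed
  then interpret S: labelled_system t mu lab .
  let ?\<phi> = "mat_potential A"
  obtain D where D: "0 \<le> D" "\<And>n m x. 1 \<le> n \<Longrightarrow> 1 \<le> m \<Longrightarrow> x \<in> shift_space t \<Longrightarrow>
      ?\<phi> (n + m) x \<le> ?\<phi> n x * ?\<phi> m ((shift_map ^^ n) x) * exp D"
    using aa unfolding almost_additive_def by metis
  have name_cyl: "{y \<in> space mu. S.name n y = S.name n x} = cylinder t (map x [0..<n])"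
    if x: "x \<in> shift_space t" "\<forall>i. x i \<in> F" for n x
  proof -
    have lab_i: "lab ((shift_map ^^ i) y) = lab ((shift_map ^^ i) x) \<longleftrightarrow> y i = x i" for y i
    proof -
      have "x i \<le> Max F" using x(2) F by simp
      then show ?thesis using x(2) by (auto simp: lab_def shift_map_funpow)
    qed
    have "S.name n y = S.name n x \<longleftrightarrow> (\<forall>i<n. y i = x i)" for y
      unfolding S.name_def using lab_i by auto
    then show ?thesis by (auto simp: cylinder_def S.space_mu)
  qed
  have AE1: "AE x in mu. x \<in> space mu \<and> (\<forall>i. x i \<in> F) \<and> S.pr (S.name n) (S.name n x) = measure mu (cylinder t (map x [0..<n])) \<and>
      0 < S.pr (S.name n) (S.name n x)" for n
    using AE_letters S.AE_pr_pos[OF S.name_meas[of n]] AE_space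
  proof eventually_elim
    case (elim x)
    have "x \<in> shift_space t" using elim S.space_mu by simp
    then have "S.pr (S.name n) (S.name n x) = measure mu (cylinder t (map x [0..<n]))"
      using elim name_cyl unfolding S.pr_def by simp
    then show ?case using elim by simp
  qed
  define p where "p n x = ln (S.pr (S.name n) (S.name n x))" for n x
  have p_int: "integrable mu (p n)" for n
    unfolding p_def by (rule S.integrable_finite_label[OF S.name_meas S.name_fin])
  have AE2: "AE x in mu. p n x + real n * ln l - ln K \<le> ln (?\<phi> n x) \<and> ln (?\<phi> n x) \<le> p n x + real n * ln l + ln K"
    if n: "1 \<le> n" for n
    using AE1[of n]
  proof eventually_elim
    case (elim x)
    define z where "z = S.pr (S.name n) (S.name n x)"
    have xs: "x \<in> shift_space t" using elim S.space_mu by simp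
    have z: "0 < z" "z = measure mu (cylinder t (map x [0..<n]))" using elim by (auto simp: z_def)
    have pp: "0 < ?\<phi> n x" by (rule mat_potential_pos)
    have ln1: "ln (z * l ^ n) = p n x + real n * ln l"
      using z l by (simp add: ln_mult_pos ln_realpow p_def z_def)
    have "z \<le> K * ?\<phi> n x / l ^ n" unfolding z(2) by (rule gibbs_bounds(1)[OF xs n])
    then have "z * l ^ n \<le> K * ?\<phi> n x" using l by (simp add: field_simps)
    then have "ln (z * l ^ n) \<le> ln (K * ?\<phi> n x)" using z l K pp by (subst ln_le_cancel_iff) auto
    moreover have "ln (K * ?\<phi> n x) = ln K + ln (?\<phi> n x)" using K pp by (simp add: ln_mult_pos)
    moreover have "?\<phi> n x / l ^ n \<le> K * z" unfolding z(2) using elim by (intro gibbs_bounds(2)[OF xs n]) auto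
    then have "?\<phi> n x \<le> K * (z * l ^ n)" using l by (simp add: field_simps)
    then have "ln (?\<phi> n x) \<le> ln (K * (z * l ^ n))" using z l K pp by (subst ln_le_cancel_iff) auto
    moreover have "ln (K * (z * l ^ n)) = ln K + ln (z * l ^ n)" using K z l by (simp add: ln_mult_pos)
    ultimately show ?case unfolding ln1 by linarith
  qed
  have lm: "(\<lambda>x. ln (?\<phi> n x)) \<in> borel_measurable mu" for n
    using mat_potential_measurable[OF mu(1), of A n] by simp
  have int: "integrable mu (\<lambda>x. ln (?\<phi> n x))" if n: "1 \<le> n" for n
  proof (rule Bochner_Integration.integrable_bound[OF _ lm])
    show "integrable mu (\<lambda>x. \<bar>p n x\<bar> + (\<bar>real n * ln l\<bar> + \<bar>ln K\<bar>))" using p_int[of n] by simp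
    show "AE x in mu. norm (ln (?\<phi> n x)) \<le> norm (\<bar>p n x\<bar> + (\<bar>real n * ln l\<bar> + \<bar>ln K\<bar>))"
      using AE2[OF n] by eventually_elim (simp only: real_norm_def, linarith)
  qed
  define I where "I n = (\<integral>x. ln (?\<phi> n x) \<partial>mu)" for n
  have I_low: "real n * ln l - ln K \<le> S.ent (S.name n) + I n" if n: "1 \<le> n" for n
  proof -
    have "(\<integral>x. p n x + real n * ln l - ln K \<partial>mu) \<le> I n"
      unfolding I_def using AE2[OF n] by (intro integral_mono_AE int[OF n]) (auto simp: p_int)
    moreover have "(\<integral>x. p n x + real n * ln l - ln K \<partial>mu) = - S.ent (S.name n) + real n * ln l - ln K"
      using p_int[of n] by (simp add: S.prob_space S.ent_def p_def[abs_def])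
    ultimately show ?thesis by linarith
  qed
  have ent_le: "S.ent (S.name n) \<le> real n * S.ent (S.name 1)" if "1 \<le> n" for n
    using that
  proof (induction n rule: dec_induct)
    case (step n)
    have "S.ent (S.name (n + 1)) \<le> S.ent (S.name n) + S.ent (S.name 1)" by (rule S.ent_name_subadd)
    with step show ?case by (simp add: algebra_simps)
  qed simp
  \<comment> \<open>The supremum admits only measures whose energy limit exists. Almost-additivity
    makes \<open>I n + D\<close> subadditive, and \<open>I_low\<close> with \<open>ent_le\<close>
    bounds it below linearly, so Fekete's lemma provides a finite limit.\<close>
  have "\<exists>r. (\<lambda>n. (I n + D) / real n) \<longlonglongrightarrow> r \<and> (\<forall>n\<ge>1. r \<le> (I n + D) / real n)"
  proof (rule fekete)
    fix m n :: nat assume mn: "1 \<le> m" "1 \<le> n"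
    have "I (m + n) \<le> (\<integral>x. ln (?\<phi> m x) + ln (?\<phi> n ((shift_map ^^ m) x)) + D \<partial>mu)"
      unfolding I_def
    proof (rule integral_mono)
      show "integrable mu (\<lambda>x. ln (?\<phi> (m + n) x))" using mn by (intro int) simp
      show "integrable mu (\<lambda>x. ln (?\<phi> m x) + ln (?\<phi> n ((shift_map ^^ m) x)) + D)"
        using int[OF mn(1)] S.integral_shift(2)[OF lm int[OF mn(2)], of m] by simp
      fix x assume "x \<in> space mu"
      then have x: "x \<in> shift_space t" by (simp add: S.space_mu)
      have "ln (?\<phi> (m + n) x) \<le> ln (?\<phi> m x * ?\<phi> n ((shift_map ^^ m) x) * exp D)"
        using D(2)[OF mn x] mat_potential_pos by (subst ln_le_cancel_iff) auto
      also have "\<dots> = ln (?\<phi> m x) + ln (?\<phi> n ((shift_map ^^ m) x)) + D"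
        using mat_potential_pos by (simp add: ln_mult_pos)
      finally show "ln (?\<phi> (m + n) x) \<le> ln (?\<phi> m x) + ln (?\<phi> n ((shift_map ^^ m) x)) + D" .
    qed
    also have "\<dots> = I m + I n + D"
      unfolding I_def using int[OF mn(1)] S.integral_shift[OF lm, of n m] int[OF mn(2)] by (simp add: S.prob_space)
    finally show "I (m + n) + D \<le> (I m + D) + (I n + D)" by simp
  next
    fix n :: nat assume n: "1 \<le> n"
    have "ln K \<le> real n * \<bar>ln K\<bar>"
      using n mult_right_mono[of 1 "real n" "\<bar>ln K\<bar>"] by linarith
    then have "real n * ln l - real n * \<bar>ln K\<bar> - real n * S.ent (S.name 1) \<le> I n + D"
      using I_low[OF n] ent_le[OF n] D(1) by linarith
    then show "real n * (ln l - \<bar>ln K\<bar> - S.ent (S.name 1)) \<le> I n + D" by (simp add: right_diff_distrib)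
  qed
  then obtain r where r: "(\<lambda>n. (I n + D) / real n) \<longlonglongrightarrow> r" by blast
  have "(\<lambda>n. (I n + D) / real n - D / real n) \<longlonglongrightarrow> r - 0"
    by (intro tendsto_diff r lim_const_over_n)
  then have Ir: "(\<lambda>n. I n / real n) \<longlonglongrightarrow> r" by (simp add: diff_divide_distrib[symmetric])
  have conv: "(\<lambda>n. extended_integral mu (\<lambda>x. ln (?\<phi> n x)) / ereal (real n)) \<longlonglongrightarrow> ereal r"
  proof (rule Lim_transform_eventually)
    show "(\<lambda>n. ereal (I n / real n)) \<longlonglongrightarrow> ereal r" using Ir by simp
    show "\<forall>\<^sub>F n in sequentially. ereal (I n / real n) = extended_integral mu (\<lambda>x. ln (?\<phi> n x)) / ereal (real n)"
      using eventually_ge_at_top[of 1] by eventually_elim (simp add: S.extended_integral_eq[OF int] I_def)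
  qed
  have "ln l \<le> S.rate + r"
  proof (rule LIMSEQ_le)
    show "(\<lambda>n. S.ent (S.name n) / real n + I n / real n) \<longlonglongrightarrow> S.rate + r" by (intro tendsto_add S.rate Ir)
    have "(\<lambda>n. ln l - ln K / real n) \<longlonglongrightarrow> ln l - 0" by (intro tendsto_diff tendsto_const lim_const_over_n)
    then show "(\<lambda>n. ln l - ln K / real n) \<longlonglongrightarrow> ln l" by simp
    have "ln l - ln K / real n \<le> S.ent (S.name n) / real n + I n / real n" if n: "1 \<le> n" for n
    proof -
      have "(real n * ln l - ln K) / real n \<le> (S.ent (S.name n) + I n) / real n"
        using I_low[OF n] by (intro divide_right_mono) auto
      then show ?thesis using n by (simp add: diff_divide_distrib add_divide_distrib)
    qed
    then show "\<exists>N. \<forall>n\<ge>N. ln l - ln K / real n \<le> S.ent (S.name n) / real n + I n / real n" by blast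
  qed
  then have "ereal (ln l) \<le> ereal S.rate + ereal r" by simp
  also have "\<dots> \<le> measure_entropy mu shift_map + ereal r"
    by (intro add_right_mono S.rate_le_entropy)
  finally have "ereal (ln l) \<le> measure_entropy mu shift_map + ereal r" .
  with conv show ?thesis by (intro exI[of _ "ereal r"]) simp
qed

end

text \<open>Truncating the eigenvector \<open>v\<close> of the full system to \<open>F\<close> gives an approximate eigenvector of the
  subsystem; pairing it with the left eigenvector of the subsystem compares the two eigenvalues.\<close>

lemma eigenvalue_comparison:
  assumes full: "matrix_pf t A UNIV B l c C u v" and sub: "matrix_pf t A F B' l' c' C' u' v'"
    and tail: "(\<integral>\<^sup>+s. ennreal (if fst s \<in> F then 0 else v s) \<partial>count_space UNIV) \<le> ennreal (\<epsilon> * (c * l))" and \<epsilon>: "0 \<le> \<epsilon>"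
  shows "(1 - \<epsilon>) * l \<le> l'"
proof -
  interpret P: matrix_pf t A UNIV B l c C u v by (rule full)
  interpret Q: matrix_pf t A F B' l' c' C' u' v' by (rule sub)
  note l = P.l and l' = Q.l
  define x where "x s = ennreal (if fst s \<in> F then v s else 0)" for s
  have kQ: "Q.ker s r = P.ker s r" if "fst s \<in> F" "fst r \<in> F" for s r
    using that by (simp add: P.ker_def Q.ker_def)
  \<comment> \<open>Converts the normalisation of the full kernel into that of the
    subsystem.\<close>
  define q where "q = l / l'"
  have q: "0 < q" using l l' by (simp add: q_def)
  have main: "ennreal q * x r \<le> Q.push x r + ennreal (q * \<epsilon>) * x r" for r
  proof (cases "fst r \<in> F")
    case False
    then show ?thesis by (simp add: x_def)
  next
    case True
    have "ennreal (v r) = (\<integral>\<^sup>+s. ennreal (v s) * ennreal (P.ker s r / l) \<partial>count_space UNIV)"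
      using P.vG[of r] by simp
    also have "\<dots> \<le> (\<integral>\<^sup>+s. x s * ennreal (P.ker s r / l) + ennreal (if fst s \<in> F then 0 else v s) * ennreal (P.rowsum r / l) \<partial>count_space UNIV)"
    proof (rule nn_integral_mono)
      fix s
      have "P.ker s r / l \<le> P.rowsum r / l" using P.ker_le_rowsum[of s r] l by (simp add: divide_right_mono)
      then show "ennreal (v s) * ennreal (P.ker s r / l) \<le>
          x s * ennreal (P.ker s r / l) + ennreal (if fst s \<in> F then 0 else v s) * ennreal (P.rowsum r / l)"
        by (cases "fst s \<in> F") (simp_all add: x_def mult_left_mono ennreal_leI)
    qed
    also have "\<dots> = (\<integral>\<^sup>+s. x s * ennreal (P.ker s r / l) \<partial>count_space UNIV) +
        (\<integral>\<^sup>+s. ennreal (if fst s \<in> F then 0 else v s) \<partial>count_space UNIV) * ennreal (P.rowsum r / l)"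
      by (simp add: nn_integral_add nn_integral_multc)
    also have "\<dots> \<le> (\<integral>\<^sup>+s. x s * ennreal (P.ker s r / l) \<partial>count_space UNIV) + ennreal (\<epsilon> * (c * l)) * ennreal (P.rowsum r / l)"
      by (intro add_left_mono mult_right_mono tail) simp
    \<comment> \<open>The discarded part reaches \<open>r\<close> with weight at most proportional
      to \<open>rowsum r\<close>, which \<open>c * rowsum r \<le> v r\<close> absorbs; this is why
      the tail is measured against \<open>c * l\<close>.\<close>
    also have "ennreal (\<epsilon> * (c * l)) * ennreal (P.rowsum r / l) = ennreal (\<epsilon> * (c * P.rowsum r))"
      using \<epsilon> P.c l P.rowsum_pos[of r] by (subst ennreal_mult[symmetric]) auto
    also have "\<dots> \<le> ennreal (\<epsilon> * v r)"
      using P.v_ge[of r] \<epsilon> by (intro ennreal_leI mult_left_mono) auto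
    finally have "ennreal q * ennreal (v r) \<le> ennreal q * ((\<integral>\<^sup>+s. x s * ennreal (P.ker s r / l) \<partial>count_space UNIV) + ennreal (\<epsilon> * v r))"
      by (intro mult_left_mono) auto
    also have "\<dots> = ennreal q * (\<integral>\<^sup>+s. x s * ennreal (P.ker s r / l) \<partial>count_space UNIV) + ennreal (q * \<epsilon>) * ennreal (v r)"
      using q \<epsilon> P.v_nonneg[of r] by (simp add: distrib_left ennreal_mult mult.assoc)
    also have "ennreal q * (\<integral>\<^sup>+s. x s * ennreal (P.ker s r / l) \<partial>count_space UNIV) = Q.push x r"
    proof -
      have "ennreal q * (x s * ennreal (P.ker s r / l)) = x s * ennreal (Q.ker s r / l')" for s
      proof (cases "fst s \<in> F")
        case True
        have "q * (P.ker s r / l) = Q.ker s r / l'" using kQ[OF True \<open>fst r \<in> F\<close>] l by (simp add: q_def)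
        then have "ennreal q * ennreal (P.ker s r / l) = ennreal (Q.ker s r / l')"
          using q P.ker_nonneg[of s r] l by (subst ennreal_mult[symmetric]) auto
        then show ?thesis by (metis mult.left_commute)
      qed (simp add: x_def)
      then show ?thesis
        unfolding Q.push_def by (subst nn_integral_cmult[symmetric]) auto
    qed
    finally show ?thesis using True by (simp add: x_def)
  qed
  \<comment> \<open>The pairing with the eigenvector \<open>u'\<close>, invariant under
    \<open>Q.push\<close>. It is finite and positive, so it can be divided out of
    \<open>mm\<close>.\<close>
  define m where "m = Q.mass x"
  have "Q.mass (\<lambda>r. ennreal q * x r) \<le> Q.mass (\<lambda>r. Q.push x r + ennreal (q * \<epsilon>) * x r)"
    unfolding Q.mass_def using main by (intro nn_integral_mono mult_right_mono) auto
  then have mm: "ennreal q * m \<le> m + ennreal (q * \<epsilon>) * m"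
    by (simp add: Q.mass_cmult Q.mass_add Q.mass_push m_def)
  have "m \<le> ennreal C' * (\<integral>\<^sup>+s. x s \<partial>count_space UNIV)" unfolding m_def by (rule Q.mass_le_C)
  also have "\<dots> \<le> ennreal C' * (\<integral>\<^sup>+s. ennreal (v s) \<partial>count_space UNIV)"
    using P.v_nonneg by (intro mult_left_mono nn_integral_mono) (auto simp: x_def)
  also have "\<dots> < top" using P.v_total by (simp add: ennreal_mult_less_top)
  finally have fin: "m < top" .
  obtain i where i: "i \<in> F" using Q.F_ne by blast
  have "0 < c * P.rowsum (i, undefined)" using P.rowsum_pos P.c by (rule mult_pos_pos[rotated])
  then have "0 < v (i, undefined)" using P.v_ge[of "(i, undefined)"] by simp
  moreover have "0 < u' (i, undefined)" using Q.u_ge[of "(i, undefined)"] Q.c i by simp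
  ultimately have "0 < ennreal (v (i, undefined)) * ennreal (u' (i, undefined))"
    by (simp add: ennreal_zero_less_mult_iff)
  also have "\<dots> \<le> m"
    unfolding m_def Q.mass_def using i nn_integral_ge_point[of "(i, undefined)" UNIV "\<lambda>s. x s * ennreal (u' s)"]
    by (simp add: x_def)
  finally have pos: "0 < m" .
  define m' where "m' = enn2real m"
  have m': "m = ennreal m'" "0 < m'"
    using fin pos by (simp_all add: m'_def enn2real_positive_iff)
  have "q * m' \<le> m' + q * \<epsilon> * m'"
  proof -
    have "ennreal (q * m') \<le> ennreal (m' + q * \<epsilon> * m')"
      using mm q \<epsilon> m' by (simp add: ennreal_mult ennreal_plus)
    then show ?thesis using q \<epsilon> m' by (subst (asm) ennreal_le_iff) auto
  qed
  then have "q * m' \<le> (1 + q * \<epsilon>) * m'" by (simp add: algebra_simps)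
  then have "q \<le> 1 + q * \<epsilon>" using m'(2) by (simp only: mult_le_cancel_right_pos)
  then have "q * l' \<le> (1 + q * \<epsilon>) * l'" using l' by (intro mult_right_mono) auto
  moreover have "q * l' = l" using l' by (simp add: q_def)
  ultimately have "l \<le> l' + l * \<epsilon>" by (simp add: distrib_right mult.assoc) (metis mult.commute mult.left_commute)
  then show ?thesis by (simp add: algebra_simps)
qed

section \<open>Finite irreducible subalphabets and the final assembly\<close>

lemma path_rtrancl:
  assumes "\<And>i. i < n \<Longrightarrow> (s i, s (Suc i)) \<in> R" "i \<le> j" "j \<le> n"
  shows "(s i, s j) \<in> R\<^sup>*"
  using assms(2,3)
proof (induction j rule: dec_induct)
  case (step j)
  then show ?case using assms(1)[of j] by (simp add: rtrancl_into_rtrancl)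
qed simp

lemma path_trancl:
  assumes "\<And>i. i < n \<Longrightarrow> (s i, s (Suc i)) \<in> R" "1 \<le> n"
  shows "(s 0, s n) \<in> R\<^sup>+"
proof -
  have "(s 0, s 1) \<in> R" using assms(1)[of 0] assms(2) by simp
  moreover have "(s 1, s n) \<in> R\<^sup>*" using path_rtrancl[of n s R 1 n] assms by simp
  ultimately show ?thesis by simp
qed

lemma mixing_path:
  assumes "topologically_mixing t"
  shows "\<exists>s n. 1 \<le> n \<and> s 0 = a \<and> s n = b \<and> (\<forall>i. t (s i) (s (Suc i)))"
proof -
  obtain N where "\<forall>n>N. cylinder t [a] \<inter> (shift_map ^^ n) -` cylinder t [b] \<noteq> {}"
    using assms unfolding topologically_mixing_def by blast
  then obtain x where "x \<in> cylinder t [a]" "(shift_map ^^ Suc N) x \<in> cylinder t [b]" by blast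
  then show ?thesis
    by (intro exI[of _ x] exI[of _ "Suc N"]) (auto simp: cylinder_def shift_map_funpow shift_space_def simp del: funpow.simps)
qed

text \<open>A union of finitely many loops based at the letter \<open>0\<close>, one through each
  letter of \<open>P\<close>; any two letters are then joined by way of \<open>0\<close>.\<close>

lemma finite_irreducible_superset:
  assumes mix: "topologically_mixing t" and P: "finite (P :: nat set)"
  shows "\<exists>F. finite F \<and> P \<subseteq> F \<and> F \<noteq> {} \<and> (\<forall>a\<in>F. \<forall>b\<in>F. (a, b) \<in> {(i, j). i \<in> F \<and> j \<in> F \<and> t i j}\<^sup>+)"
proof -
  have "\<exists>s n. 1 \<le> n \<and> s 0 = 0 \<and> s n = 0 \<and> a \<in> s ` {..n} \<and> (\<forall>i<n. t (s i) (s (Suc i)))" for a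
  proof -
    obtain p m where p: "1 \<le> m" "p 0 = 0" "p m = a" "\<forall>i. t (p i) (p (Suc i))" using mixing_path[OF mix] by blast
    obtain q k where q: "1 \<le> k" "q 0 = a" "q k = 0" "\<forall>i. t (q i) (q (Suc i))" using mixing_path[OF mix] by blast
    define s where "s i = (if i \<le> m then p i else q (i - m))" for i
    have step: "t (s i) (s (Suc i))" for i
    proof -
      consider "i < m" | "i = m" | "m < i" by linarith
      then show ?thesis
      proof cases
        case 2
        then show ?thesis using p q(4)[rule_format, of 0] q(2) by (simp add: s_def)
      next
        case 3
        then show ?thesis using q(4)[rule_format, of "i - m"] by (simp add: s_def Suc_diff_le)
      qed (use p in \<open>simp add: s_def\<close>)
    qed
    have "s (m + k) = 0" using q by (simp add: s_def)
    moreover have "s 0 = 0" using p by (simp add: s_def)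
    moreover have "a \<in> s ` {..m + k}" using p by (intro image_eqI[of _ _ m]) (auto simp: s_def)
    ultimately show ?thesis using step p(1) by (intro exI[of _ s] exI[of _ "m + k"]) auto
  qed
  then have "\<forall>a. \<exists>s n. 1 \<le> n \<and> s 0 = 0 \<and> s n = 0 \<and> a \<in> s ` {..n} \<and> (\<forall>i<n. t (s i) (s (Suc i)))" ..
  from choice[OF this] obtain s where
    "\<forall>a. \<exists>n. 1 \<le> n \<and> s a 0 = 0 \<and> s a n = 0 \<and> a \<in> s a ` {..n} \<and> (\<forall>i<n. t (s a i) (s a (Suc i)))" ..
  from choice[OF this] obtain n where
    sn: "\<forall>a. 1 \<le> n a \<and> s a 0 = 0 \<and> s a (n a) = 0 \<and> a \<in> s a ` {..n a} \<and> (\<forall>i<n a. t (s a i) (s a (Suc i)))" ..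
  \<comment> \<open>\<open>0\<close> is inserted so that a loop at \<open>0\<close> exists even when
    \<open>P\<close> is empty; it supplies the nonempty path that the transitive closure
    demands.\<close>
  define F where "F = (\<Union>a\<in>insert 0 P. s a ` {..n a})"
  let ?R = "{(i, j). i \<in> F \<and> j \<in> F \<and> t i j}"
  have step: "(s a i, s a (Suc i)) \<in> ?R" if "a \<in> insert 0 P" "i < n a" for a i
    using that sn unfolding F_def by fastforce
  have to0: "(x, 0) \<in> ?R\<^sup>*" and from0: "(0, x) \<in> ?R\<^sup>*" if "x \<in> F" for x
  proof -
    obtain a i where ai: "a \<in> insert 0 P" "i \<le> n a" "x = s a i" using \<open>x \<in> F\<close> unfolding F_def by auto
    show "(x, 0) \<in> ?R\<^sup>*" using path_rtrancl[of "n a" "s a" ?R i "n a", OF step[OF ai(1)]] ai sn by simp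
    show "(0, x) \<in> ?R\<^sup>*" using path_rtrancl[of "n a" "s a" ?R 0 i, OF step[OF ai(1)]] ai sn by simp
  qed
  have loop: "(0, 0) \<in> ?R\<^sup>+" using path_trancl[of "n 0" "s 0" ?R, OF step[of 0]] sn by simp
  have "(a, b) \<in> ?R\<^sup>+" if "a \<in> F" "b \<in> F" for a b
    using to0[OF that(1)] loop from0[OF that(2)] by (meson rtrancl_trancl_trancl trancl_rtrancl_trancl)
  moreover have "finite F" using P by (simp add: F_def)
  moreover have "P \<subseteq> F" using sn by (auto simp: F_def)
  moreover have "F \<noteq> {}" by (auto simp: F_def)
  ultimately show ?thesis by blast
qed

lemma tail_small:
  fixes f :: "nat \<times> 'd::finite \<Rightarrow> real"
  assumes fin: "(\<integral>\<^sup>+s. ennreal (f s) \<partial>count_space UNIV) < top" and e: "0 < e"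
  shows "\<exists>N. (\<integral>\<^sup>+s. ennreal (if fst s \<le> N then 0 else f s) \<partial>count_space UNIV) \<le> ennreal e"
proof -
  have "(\<lambda>N. \<integral>\<^sup>+s. ennreal (if fst s \<le> N then 0 else f s) \<partial>count_space UNIV) \<longlonglongrightarrow> (\<integral>\<^sup>+s. 0 \<partial>count_space (UNIV :: (nat \<times> 'd) set))"
  proof (rule nn_integral_dominated_convergence[where w="\<lambda>s. ennreal (f s)"])
    show "AE s in count_space UNIV. (\<lambda>N. ennreal (if fst s \<le> N then 0 else f s)) \<longlonglongrightarrow> 0"
    proof (rule AE_I2)
      fix s :: "nat \<times> 'd"
      have "\<forall>\<^sub>F N in sequentially. 0 = ennreal (if fst s \<le> N then 0 else f s)"
        using eventually_ge_at_top[of "fst s"] by eventually_elim simp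
      then show "(\<lambda>N. ennreal (if fst s \<le> N then 0 else f s)) \<longlonglongrightarrow> 0"
        by (rule Lim_transform_eventually[OF tendsto_const])
    qed
  qed (use fin in auto)
  then have "\<forall>\<^sub>F N in sequentially. (\<integral>\<^sup>+s. ennreal (if fst s \<le> N then 0 else f s) \<partial>count_space UNIV) < ennreal e"
    by (rule order_tendstoD(2)) (use e in simp)
  then show ?thesis by (auto simp: eventually_sequentially intro: less_imp_le)
qed

theorem proposition7p1:
  fixes t :: "nat \<Rightarrow> nat \<Rightarrow> bool" and A :: "nat \<Rightarrow> real ^ 'd ^ 'd"
  assumes "transition_matrix t" and "topologically_mixing t" and "BIP t"
    and "\<And>k i j. 0 < A k $ i $ j"
    and "almost_additive t (mat_potential A)"
    and "summable (\<lambda>i. mat_norm (A i))"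
  shows "(\<forall>a. convergent (gurevich_seq t (mat_potential A) a) \<and>
           gurevich_pressure t (mat_potential A) a =
             Sup {measure_entropy \<mu> shift_map + L | \<mu> L. \<mu> \<in> invariant_measures t \<and>
               (\<lambda>n. extended_integral \<mu> (\<lambda>x. ln (mat_potential A n x)) / ereal (real n)) \<longlonglongrightarrow> L \<and>
               L \<noteq> - \<infinity>}) \<and>
         (\<exists>\<mu>. gibbs_measure t (mat_potential A) \<mu> \<and> mixing \<mu> shift_map)"
proof -
  note mix = assms(2) and A_pos = assms(4) and aa = assms(5) and summ = assms(6)
  obtain B where B: "finite B" "\<And>a. \<exists>b\<in>B. \<exists>b'\<in>B. t b a \<and> t a b'"
    using assms(3) unfolding BIP_def by blast
  have "matrix_subsystem t A UNIV B"
  proof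
    show "(a, b) \<in> {(i, j). i \<in> UNIV \<and> j \<in> UNIV \<and> t i j}\<^sup>+" for a b
    proof -
      obtain s n where s: "1 \<le> n" "s 0 = a" "s n = b" "\<forall>i. t (s i) (s (Suc i))" using mixing_path[OF mix] by blast
      then show ?thesis using path_trancl[of n s "{(i, j). i \<in> UNIV \<and> j \<in> UNIV \<and> t i j}"] by simp
    qed
    show "\<exists>b\<in>B. t b a" "\<exists>b\<in>B. t a b" for a using B(2)[of a] by blast+
  qed (use B A_pos summ in auto)
  then obtain l c C u v where pf: "matrix_pf t A UNIV B l c C u v"
    using matrix_subsystem.exists_matrix_pf by blast
  interpret P: matrix_pf t A UNIV B l c C u v by (rule pf)
  have gs: "gibbs_state t (mat_potential A) P.mu P.K l" by (rule P.gibbs_state_mu[OF refl])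
  interpret G: gibbs_state t "mat_potential A" P.mu P.K l by (rule gs)
  have mixing: "mixing P.mu shift_map" by (rule P.mu_mixing[OF refl mix])
  have lim: "gurevich_seq t (mat_potential A) a \<longlonglongrightarrow> ereal (ln l)" for a
  proof (rule G.gurevich_limit[OF mixing])
    obtain s n where "s 0 = a" "\<forall>i. t (s i) (s (Suc i))" using mixing_path[OF mix] by metis
    then have "s \<in> cylinder t [a]" by (simp add: cylinder_def shift_space_def)
    then show "cylinder t [a] \<noteq> {}" by blast
  qed
  let ?V = "{measure_entropy \<mu> shift_map + L | \<mu> L. \<mu> \<in> invariant_measures t \<and>
               (\<lambda>n. extended_integral \<mu> (\<lambda>x. ln (mat_potential A n x)) / ereal (real n)) \<longlonglongrightarrow> L \<and>
               L \<noteq> - \<infinity>}"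
  have upper: "measure_entropy \<mu> shift_map + L \<le> ereal (ln l)"
    if \<mu>: "\<mu> \<in> invariant_measures t"
      and L: "(\<lambda>n. extended_integral \<mu> (\<lambda>x. ln (mat_potential A n x)) / ereal (real n)) \<longlonglongrightarrow> L" "L \<noteq> - \<infinity>" for \<mu> L
  proof -
    have rate: "ereal (labelled_system.rate \<mu> lab) + L \<le> ereal (ln l)" if "labelled_system t \<mu> lab" for lab
      by (rule labelled_system.rate_plus_energy_le[OF that gs mat_potential_measurable[OF \<mu>] L])
    \<comment> \<open>The partition into a single cell has a real rate, so \<open>rate\<close> rules
      out \<open>L = \<infinity>\<close>; \<open>L\<close> can then be subtracted.\<close>
    have "labelled_system t \<mu> (\<lambda>_. 0)"
    proof
      have "(\<lambda>_. 0) ` shift_space t \<subseteq> {0 :: nat}" by auto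
      then show "finite ((\<lambda>_. 0 :: nat) ` shift_space t)" by (rule finite_subset) simp
    qed (use \<mu> in auto)
    then have "L \<noteq> \<infinity>" using rate by fastforce
    then obtain r where r: "L = ereal r" using L(2) by (cases L) auto
    have "measure_entropy \<mu> shift_map \<le> ereal (ln l - r)"
    proof (rule measure_entropy_le[OF \<mu>])
      fix lab assume "labelled_system t \<mu> lab"
      from rate[OF this] show "ereal (labelled_system.rate \<mu> lab) \<le> ereal (ln l - r)" by (simp add: r)
    qed
    then have "measure_entropy \<mu> shift_map + ereal r \<le> ereal (ln l - r) + ereal r" by (rule add_right_mono)
    then show ?thesis by (simp add: r)
  qed
  have lower: "ereal (ln l) \<le> Sup ?V + ereal e" if e: "0 < e" for e
  proof -
    \<comment> \<open>Chosen so that \<open>(1 - \<epsilon>) * l \<le> l'\<close> becomes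
      \<open>ln l \<le> ln l' + e\<close> after taking logarithms.\<close>
    define \<epsilon> where "\<epsilon> = 1 - exp (- e)"
    have \<epsilon>: "0 < \<epsilon>" "1 - \<epsilon> = exp (- e)" using e by (simp_all add: \<epsilon>_def)
    obtain N where N: "(\<integral>\<^sup>+s. ennreal (if fst s \<le> N then 0 else v s) \<partial>count_space UNIV) \<le> ennreal (\<epsilon> * (c * l))"
      using tail_small[OF P.v_total, of "\<epsilon> * (c * l)"] \<epsilon> P.c P.l by auto
    obtain F where F: "finite F" "{..N} \<subseteq> F" "F \<noteq> {}"
      "\<And>a b. a \<in> F \<Longrightarrow> b \<in> F \<Longrightarrow> (a, b) \<in> {(i, j). i \<in> F \<and> j \<in> F \<and> t i j}\<^sup>+"
      using finite_irreducible_superset[OF mix, of "{..N}"] by auto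
    \<comment> \<open>Irreducibility inside \<open>F\<close> supplies predecessors and successors in
      \<open>F\<close>, so the finite alphabet takes the place of the BIP set.\<close>
    have "matrix_subsystem t A F F"
    proof
      fix a assume a: "a \<in> F"
      show "\<exists>b\<in>F. t b a" using tranclD2[OF F(4)[OF a a]] by auto
      show "\<exists>b\<in>F. t a b" using tranclD[OF F(4)[OF a a]] by auto
    qed (use F A_pos summ in auto)
    then obtain l' c' C' u' v' where sub: "matrix_pf t A F F l' c' C' u' v'"
      using matrix_subsystem.exists_matrix_pf by blast
    interpret Q: matrix_pf t A F F l' c' C' u' v' by (rule sub)
    have "(1 - \<epsilon>) * l \<le> l'"
    proof (rule eigenvalue_comparison[OF pf sub])
      have "(\<integral>\<^sup>+s. ennreal (if fst s \<in> F then 0 else v s) \<partial>count_space UNIV) \<le>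
          (\<integral>\<^sup>+s. ennreal (if fst s \<le> N then 0 else v s) \<partial>count_space UNIV)"
        using F(2) P.v_nonneg by (intro nn_integral_mono) auto
      with N show "(\<integral>\<^sup>+s. ennreal (if fst s \<in> F then 0 else v s) \<partial>count_space UNIV) \<le> ennreal (\<epsilon> * (c * l))"
        by (rule order_trans[rotated])
    qed (use \<epsilon> in simp)
    then have "ln (exp (- e) * l) \<le> ln l'" using P.l Q.l \<epsilon> by (subst ln_le_cancel_iff) auto
    then have le: "ln l \<le> ln l' + e" using P.l by (simp add: ln_mult_pos)
    obtain L where L: "(\<lambda>n. extended_integral Q.mu (\<lambda>x. ln (mat_potential A n x)) / ereal (real n)) \<longlonglongrightarrow> L"
      "L \<noteq> - \<infinity>" "ereal (ln l') \<le> measure_entropy Q.mu shift_map + L"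
      using Q.finite_subsystem_bound[OF F(1) aa] by blast
    have "measure_entropy Q.mu shift_map + L \<le> Sup ?V"
      using Q.mu(1) L(1,2) by (intro Sup_upper) blast
    then have "ereal (ln l') \<le> Sup ?V" using L(3) by (rule order_trans[rotated])
    then have "ereal (ln l') + ereal e \<le> Sup ?V + ereal e" by (rule add_right_mono)
    moreover have "ereal (ln l) \<le> ereal (ln l') + ereal e" using le by simp
    ultimately show ?thesis by (rule order_trans[rotated])
  qed
  have "Sup ?V \<le> ereal (ln l)" by (rule Sup_least) (use upper in blast)
  moreover have "ereal (ln l) \<le> Sup ?V" by (rule ereal_le_epsilon2) (use lower in blast)
  ultimately have V: "Sup ?V = ereal (ln l)" by (rule order_antisym)
  have "convergent (gurevich_seq t (mat_potential A) a) \<and> gurevich_pressure t (mat_potential A) a = Sup ?V" for a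
    unfolding V gurevich_pressure_def using lim[of a] limI[OF lim[of a]] by (auto simp: convergent_def)
  then show ?thesis using G.is_gibbs_measure mixing by blast
qed

end
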